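(* Let $k$ be a fixed positive integer and $\varepsilon>0$. There is a semidefinite programming relaxation of $k$-set packing whose size is polynomial in the size of the instance and whose integrality gap is at most $\frac{k}{3}+1+\varepsilon$.
   Context: $k$-set packing: given a finite universe $\mathcal{U}$ and a collection $\mathcal{C}$ of $n$ subsets of $\mathcal{U}$, each of cardinality exactly $k$, find a collection of pairwise disjoint members of $\mathcal{C}$ of maximum cardinality. A relaxation's integrality gap is the supremum over instances of the ratio between its optimum value and the maximum packing size. *)

theory Defs
  imports
    "Jordan_Normal_Form.Matrix"
    "HOL-Computational_Algebra.Polynomial"
    "HOL-Library.Disjoint_Sets"
    "HOL-Library.Extended_Real"
    "HOL-Library.Log_Nat"
begin

section \<open>Set packing\<close>

text \<open>Every finite universe is, up to renaming, a finite set of natural numbers.\<close>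

definition packing_instance :: "nat \<Rightarrow> nat set \<Rightarrow> nat set set \<Rightarrow> bool" where
  "packing_instance k U C \<longleftrightarrow> finite U \<and> C \<subseteq> Pow U \<and> (\<forall>S\<in>C. card S = k)"

definition instance_size :: "nat set \<Rightarrow> nat set set \<Rightarrow> nat" where
  "instance_size U C = card U + (\<Sum>S\<in>C. card S)"

definition is_packing :: "nat set set \<Rightarrow> nat set set \<Rightarrow> bool" where
  "is_packing C M \<longleftrightarrow> M \<subseteq> C \<and> disjoint M"

definition max_packing :: "nat set set \<Rightarrow> nat" where
  "max_packing C = Max (card ` {M. is_packing C M})"


section \<open>Semidefinite programs\<close>

definition psd :: "nat \<Rightarrow> real mat \<Rightarrow> bool" where
  "psd d X \<longleftrightarrow> X \<in> carrier_mat d d \<and> X\<^sup>T = X \<and>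
     (\<forall>v \<in> carrier_vec d. 0 \<le> v \<bullet> (X *\<^sub>v v))"

definition frob :: "rat mat \<Rightarrow> real mat \<Rightarrow> real" where
  "frob A X = (\<Sum>i<dim_row X. \<Sum>j<dim_col X. of_rat (A $$ (i, j)) * X $$ (i, j))"

text \<open>
  A semidefinite program over symmetric matrices \<open>X\<close> of order \<open>sdp_dim\<close>: each pair \<open>(A, b)\<close> in
  \<open>sdp_constraints\<close> stands for \<open>frob A X \<le> b\<close> (an equation is a pair of such inequalities), and
  \<open>X\<close> is required to be positive semidefinite.  The decision variable \<open>x\<^sub>S\<close> of a set \<open>S\<close> is the
  linear functional \<open>frob (sdp_var S) X\<close>; affine functionals are covered because the constraints
  can fix an entry of \<open>X\<close> to 1.
\<close>

record packing_sdp =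
  sdp_dim :: nat
  sdp_constraints :: "(rat mat \<times> rat) list"
  sdp_var :: "nat set \<Rightarrow> rat mat"

definition wf_sdp :: "nat set set \<Rightarrow> packing_sdp \<Rightarrow> bool" where
  "wf_sdp C P \<longleftrightarrow>
     (\<forall>(A, b) \<in> set (sdp_constraints P). A \<in> carrier_mat (sdp_dim P) (sdp_dim P)) \<and>
     (\<forall>S\<in>C. sdp_var P S \<in> carrier_mat (sdp_dim P) (sdp_dim P))"

definition sdp_feasible :: "packing_sdp \<Rightarrow> real mat set" where
  "sdp_feasible P =
     {X. psd (sdp_dim P) X \<and> (\<forall>(A, b) \<in> set (sdp_constraints P). frob A X \<le> of_rat b)}"

text \<open>The vectors \<open>(x\<^sub>S)\<close>, \<open>S \<in> C\<close>, attained by feasible matrices, extended by 0 outside \<open>C\<close>.\<close>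

definition sdp_region :: "nat set set \<Rightarrow> packing_sdp \<Rightarrow> (nat set \<Rightarrow> real) set" where
  "sdp_region C P = (\<lambda>X S. if S \<in> C then frob (sdp_var P S) X else 0) ` sdp_feasible P"

definition sdp_value :: "nat set set \<Rightarrow> packing_sdp \<Rightarrow> ereal" where
  "sdp_value C P = (SUP x \<in> sdp_region C P. ereal (\<Sum>S\<in>C. x S))"

text \<open>Size is the order of the matrix plus the binary encoding length of all the data.\<close>

definition rat_size :: "rat \<Rightarrow> nat" where
  "rat_size r = (case quotient_of r of (p, q) \<Rightarrow> 1 + nat (bitlen \<bar>p\<bar>) + nat (bitlen q))"

definition mat_size :: "rat mat \<Rightarrow> nat" where
  "mat_size A = (\<Sum>i<dim_row A. \<Sum>j<dim_col A. rat_size (A $$ (i, j)))"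

definition sdp_size :: "nat set set \<Rightarrow> packing_sdp \<Rightarrow> nat" where
  "sdp_size C P =
     sdp_dim P + (\<Sum>(A, b) \<leftarrow> sdp_constraints P. mat_size A + rat_size b)
     + (\<Sum>S\<in>C. mat_size (sdp_var P S))"


section \<open>Relaxations and their integrality gap\<close>

text \<open>
  A relaxation of the \<^emph>\<open>problem\<close> assigns a program to each instance.  The incidence vectors of all
  packings must be feasible.  The last clause ties the instances together: deleting members of
  the collection only means setting their variables to 0, and the program of the smaller
  instance must not cut off any solution obtained in this way.  Without a condition of this kind
  the notion would be void, since the program of each single instance could simply contain the
  inequality that bounds the sum of all variables by the maximum size of a packing.
\<close>

definition sdp_relaxation ::
    "nat \<Rightarrow> (nat set \<Rightarrow> nat set set \<Rightarrow> packing_sdp) \<Rightarrow> bool" where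
  "sdp_relaxation k R \<longleftrightarrow>
     (\<forall>U C. packing_instance k U C \<longrightarrow>
        wf_sdp C (R U C) \<and>
        (\<forall>M. is_packing C M \<longrightarrow> (\<lambda>S. of_bool (S \<in> M)) \<in> sdp_region C (R U C)) \<and>
        (\<forall>C' \<subseteq> C. {x \<in> sdp_region C (R U C). \<forall>S \<in> C - C'. x S = 0}
                    \<subseteq> sdp_region C' (R U C')))"

definition polynomial_size ::
    "nat \<Rightarrow> (nat set \<Rightarrow> nat set set \<Rightarrow> packing_sdp) \<Rightarrow> bool" where
  "polynomial_size k R \<longleftrightarrow>
     (\<exists>p :: nat poly. \<forall>U C. packing_instance k U C \<longrightarrow>
        sdp_size C (R U C) \<le> poly p (instance_size U C))"

text \<open>For the empty collection the ratio is 0/0, so that degenerate instance is left out.\<close>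

definition integrality_gap ::
    "nat \<Rightarrow> (nat set \<Rightarrow> nat set set \<Rightarrow> packing_sdp) \<Rightarrow> ereal" where
  "integrality_gap k R =
     (SUP (U, C) \<in> {(U, C). packing_instance k U C \<and> C \<noteq> {}}.
        sdp_value C (R U C) / ereal (real (max_packing C)))"

end

theory Submission
  imports Defs "HOL-Real_Asymp.Real_Asymp"
begin


text \<open>
  The relaxation asks for a signed measure of total mass 1 on the packings that is nonnegative on
  every event describing which sets meet a given set of at most \<open>r\<close> elements; \<open>x\<^sub>S\<close> is the mass of
  the packings containing \<open>S\<close>.  Deleting sets pushes the measure forward.  There are polynomially
  many such events, so by Gaussian elimination polynomially many packings carry enough measures.

  For the gap, let \<open>A\<close> be a maximum packing and view each set as a hyperedge on the members of \<open>A\<close>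
  that it meets.  By maximality every packing \<open>Y\<close> meets at least \<open>card Y\<close> members.  Suppose the
  total mass exceeds \<open>(k/3 + 1 + \<epsilon>) card A\<close>.  Since the mass at a member is at most \<open>k\<close>, the
  hyperedges with one vertex (loops) and two vertices (edges) satisfy
  \<open>2 loops + edges > (3 + 3\<epsilon>) card A\<close>.  Repeatedly deleting the vertices with \<open>2 loops + degree \<le> 3\<close>
  does not decrease a potential, so a constant fraction of the mass is on \<open>hubs\<close>: loopless vertices
  surviving \<open>h\<close> rounds.  The packing contains a tree below each hub in which, up to one extra set,
  every vertex has degree at least 4, so that the random walk down the tree spreads out like \<open>3\<^sup>-\<^sup>h\<close>.
  A 3-colouring of the elements gives each hub three slots, whose walks start in branches
  that are disjoint near the hub; walks of different slots then rarely intersect.  By pigeonhole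
  there is a packing in which the walks of two unused slots end in the same leaf.
  Their union, an arm, joins two hubs and has at most one more vertex than sets.  Collecting more
  arms than there are hubs, each disjoint from the earlier ones, yields a packing that meets fewer
  members of \<open>A\<close> than it has sets.
\<close>

section \<open>Packings and local events\<close>

text \<open>Since \<open>t\<close> is signed, no random packing can be drawn from it: an inequality
  between expectations is available only if it holds on every packing and both sides are decided by
  inspecting boundedly many elements. Hence peeling, trees and walks stop after a constant number
  \<open>h\<close> of rounds, inequalities are made local to at most \<open>k\<close> members of
  \<open>A\<close> and then summed, and a packing is found by showing that its absence would force a
  false inequality on all packings. The 3 in the gap: a set meeting \<open>c\<close> members of
  \<open>A\<close> satisfies \<open>3 - c <= 2 [c = 1] + [c = 2]\<close>, while the sum of
  \<open>c x_S\<close> is at most \<open>k card A\<close>. More arms than hubs consume over two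
  slots per hub, hence three slots. The expected number of slots blocked by one walk is only bounded
  by a multiple of \<open>h^2\<close>. Keeping one hub in \<open>q\<close>, with \<open>q\<close> of
  order \<open>h^2\<close>, makes it small, and the leaf weights, of order \<open>3^-h\<close>,
  still beat the factor \<open>q\<close>. Only the first \<open>J\<close> levels are coloured
  because the chance of a good colouring enters \<open>\<delta>\<close>, and \<open>h\<close> is
  chosen after \<open>\<delta>\<close>.\<close>

definition restr :: "nat set set \<Rightarrow> nat set \<Rightarrow> nat set set" where
  "restr M V = {S \<in> M. S \<inter> V \<noteq> {}}"

text \<open>All event masses are read off one signed \<open>t\<close>, so the views of different
  \<open>V\<close> are automatically consistent; only their signs are constrained. The level
  \<open>r\<close> is the analogue of the round in a Sherali-Adams hierarchy.\<close>

definition pseudo_dist :: "nat \<Rightarrow> nat set \<Rightarrow> nat set set \<Rightarrow> (nat set set \<Rightarrow> real) \<Rightarrow> bool" where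
  "pseudo_dist r U C t \<longleftrightarrow> (\<Sum>M | is_packing C M. t M) = 1 \<and>
     (\<forall>V N. V \<subseteq> U \<longrightarrow> card V \<le> r \<longrightarrow> 0 \<le> (\<Sum>M | is_packing C M \<and> restr M V = N. t M))"

lemma packing_meet: "is_packing C M \<Longrightarrow> S \<in> M \<Longrightarrow> S' \<in> M \<Longrightarrow> x \<in> S \<Longrightarrow> x \<in> S' \<Longrightarrow> S = S'"
  by (auto simp: is_packing_def pairwise_def disjnt_def)

lemma packing_finite:
  assumes "packing_instance k U C"
  shows "finite U" "finite C" "finite {M. is_packing C M \<and> Q M}"
proof -
  show "finite U" using assms by (simp add: packing_instance_def)
  show "finite C" using assms finite_subset[of C "Pow U"] by (simp add: packing_instance_def)
  thus "finite {M. is_packing C M \<and> Q M}" by (simp add: is_packing_def)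
qed

text \<open>Disjointness makes the choice of a common element with \<open>V\<close> injective. The
  bound limits both the number of events and the degrees in the hypergraph.\<close>

lemma card_restr_le:
  assumes M: "is_packing C M" and V: "finite V"
  shows "card (restr M V) \<le> card V"
proof -
  define g where "g S = (SOME x. x \<in> S \<inter> V)" for S
  have g: "g S \<in> S \<inter> V" if "S \<in> restr M V" for S
    unfolding g_def by (rule someI_ex) (use that in \<open>auto simp: restr_def\<close>)
  have "inj_on g (restr M V)"
  proof
    fix S S' assume S: "S \<in> restr M V" "S' \<in> restr M V" "g S = g S'"
    have "g S \<in> S" "g S \<in> S'" using g[OF S(1)] g[OF S(2)] S(3) by auto
    moreover have "S \<in> M" "S' \<in> M" using S by (auto simp: restr_def)
    ultimately show "S = S'" using packing_meet[OF M] by metis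
  qed
  moreover have "g ` restr M V \<subseteq> V" using g by auto
  ultimately show ?thesis by (intro card_inj_on_le[OF _ _ V])
qed

section \<open>Packings relative to a maximum packing\<close>

locale packing_graph =
  fixes k :: nat and U :: "nat set" and C A :: "nat set set"
  assumes inst: "packing_instance k U C" and kpos: "k > 0"
    and A_pack: "is_packing C A"
    and A_max: "\<And>M. is_packing C M \<Longrightarrow> card M \<le> card A"
begin

definition packs :: "nat set set set" where
  "packs = {M. is_packing C M}"

definition vs :: "nat set \<Rightarrow> nat set set" where
  "vs S = {a \<in> A. a \<inter> S \<noteq> {}}"

definition star :: "nat set set \<Rightarrow> nat set \<Rightarrow> nat set set" where
  "star M a = {S \<in> M. a \<in> vs S}"

definition loops :: "nat set set \<Rightarrow> nat set \<Rightarrow> nat set set" where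
  "loops M a = {S \<in> M. vs S = {a}}"

text \<open>Parallel edges count separately, because members of \<open>M\<close> are counted and not
  neighbours. The vertex \<open>a\<close> need not lie in \<open>D\<close>, so the edges from a
  deleted vertex to the survivors are covered.\<close>

definition edges :: "nat set set \<Rightarrow> nat set set \<Rightarrow> nat set \<Rightarrow> nat set set" where
  "edges M D a = {S \<in> M. \<exists>b\<in>D. b \<noteq> a \<and> vs S = {a, b}}"

text \<open>Vertices are deleted in simultaneous rounds: survival of \<open>j\<close> rounds is
  decided within distance \<open>j\<close>, unlike membership in the limit.\<close>

primrec layer :: "nat set set \<Rightarrow> nat \<Rightarrow> nat set set" where
  "layer M 0 = A"
| "layer M (Suc j) = {a \<in> layer M j. 4 \<le> 2 * card (loops M a) + card (edges M (layer M j) a)}"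

lemma fin_U: "finite U" and C_sub: "S \<in> C \<Longrightarrow> S \<subseteq> U" and card_C: "S \<in> C \<Longrightarrow> card S = k"
  using inst by (auto simp: packing_instance_def)

lemma fin_C: "finite C"
  using inst by (meson finite_Pow_iff finite_subset packing_instance_def)

lemma fin_S: "S \<in> C \<Longrightarrow> finite S"
  using finite_subset[OF C_sub fin_U] .

lemma packsD: assumes "M \<in> packs" shows "M \<subseteq> C" "disjoint M" "finite M"
  using assms fin_C by (auto simp: packs_def is_packing_def intro: finite_subset)

lemma fin_packs: "finite packs"
  unfolding packs_def is_packing_def using fin_C by simp

lemma packs_sub: "M \<in> packs \<Longrightarrow> Y \<subseteq> M \<Longrightarrow> Y \<in> packs"
  unfolding packs_def is_packing_def using pairwise_subset[of disjnt M Y] by auto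

lemma A_packs: "A \<in> packs" and A_C: "A \<subseteq> C" and fin_A: "finite A" and A_disj: "disjoint A"
  using A_pack fin_C finite_subset by (auto simp: packs_def is_packing_def)

lemma S_nonempty: "S \<in> C \<Longrightarrow> S \<noteq> {}"
  using card_C kpos by fastforce

lemma vs_A: "vs S \<subseteq> A" and fin_vs: "finite (vs S)"
  using fin_A by (auto simp: vs_def)

lemma vs_self: "S \<in> A \<Longrightarrow> vs S = {S}"
proof -
  assume S: "S \<in> A"
  have "S \<inter> S \<noteq> {}" using S_nonempty S A_C by auto
  moreover have "a \<inter> S = {}" if "a \<in> A" "a \<noteq> S" for a
    using A_disj that S unfolding disjoint_def by simp
  ultimately show ?thesis using S by (auto simp: vs_def)
qed

text \<open>Members of \<open>A\<close> that \<open>Y\<close> does not touch can be kept beside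
  \<open>Y\<close>: the swap behind \<open>vs_nonempty\<close> and \<open>gain\<close>.\<close>

lemma exchange:
  assumes "Y \<subseteq> C" "disjoint Y" "B \<subseteq> A" "\<And>S. S \<in> Y \<Longrightarrow> vs S \<inter> B = {}"
  shows "is_packing C (Y \<union> B)"
proof -
  have *: "S \<inter> T = {}" if "S \<in> Y" "T \<in> B" for S T
    using assms(3) assms(4)[OF that(1)] that(2) by (auto simp: vs_def)
  have "S \<inter> T = {}" if "S \<in> Y \<union> B" "T \<in> Y \<union> B" "S \<noteq> T" for S T
    using that(1,2)
  proof (elim UnE)
    assume "S \<in> B" "T \<in> B" thus ?thesis using A_disj assms(3) that(3) unfolding disjoint_def by blast
  next
    assume "S \<in> Y" "T \<in> Y" thus ?thesis using assms(2) that(3) unfolding disjoint_def by blast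
  qed (use *[of S T] *[of T S] in auto)
  thus ?thesis using assms(1,3) A_C by (auto simp: is_packing_def disjoint_def)
qed

lemma vs_nonempty: assumes "S \<in> C" shows "vs S \<noteq> {}"
proof
  assume e: "vs S = {}"
  hence nS: "S \<notin> A" using vs_self by fastforce
  have "is_packing C ({S} \<union> A)" by (rule exchange) (use e assms in \<open>auto simp: disjoint_def\<close>)
  from A_max[OF this] show False using nS fin_A by simp
qed

text \<open>Otherwise replacing the members of \<open>A\<close> that \<open>Y\<close> meets by
  \<open>Y\<close> would enlarge \<open>A\<close>. In this form maximality excludes every
  configuration with more sets than vertices.\<close>

lemma gain: assumes "Y \<in> packs" shows "card Y \<le> card (\<Union>(vs ` Y))"
proof -
  let ?V = "\<Union>(vs ` Y)"
  have VA: "?V \<subseteq> A" using vs_A by blast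
  have Y: "Y \<subseteq> C" "disjoint Y" "finite Y" using packsD[OF assms] by auto
  have disj: "Y \<inter> (A - ?V) = {}" using vs_self by fastforce
  have "is_packing C (Y \<union> (A - ?V))" by (rule exchange) (use Y in auto)
  from A_max[OF this] have "card Y + card (A - ?V) \<le> card A"
    using disj Y(3) fin_A by (simp add: card_Un_disjoint)
  moreover have "card (A - ?V) = card A - card ?V"
    using VA fin_A by (simp add: card_Diff_subset finite_subset)
  moreover have "card ?V \<le> card A" using VA fin_A by (simp add: card_mono)
  ultimately show ?thesis by linarith
qed

lemma card_hitting_le: "M \<in> packs \<Longrightarrow> finite X \<Longrightarrow> card {S \<in> M. S \<inter> X \<noteq> {}} \<le> card X"
  using card_restr_le[of C M X] by (simp add: packs_def restr_def)

lemma card_vs_le: "S \<in> C \<Longrightarrow> card (vs S) \<le> k"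
  using card_hitting_le[OF A_packs fin_S, of S] card_C[of S] by (simp add: vs_def)

lemma card_star_le: assumes "M \<in> packs" "a \<in> A" shows "card (star M a) \<le> k"
proof -
  have "star M a = {S \<in> M. S \<inter> a \<noteq> {}}" using assms by (auto simp: star_def vs_def)
  thus ?thesis using card_hitting_le[OF assms(1) fin_S, of a] card_C assms(2) A_C by auto
qed

lemma fin_star: "M \<in> packs \<Longrightarrow> finite (star M a)"
  using packsD(3) by (simp add: star_def)

lemma edges_star: "edges M D a \<subseteq> star M a"
  by (auto simp: edges_def star_def)

lemma fin_edges: "M \<in> packs \<Longrightarrow> finite (edges M D a)"
  by (rule finite_subset[OF edges_star fin_star])

lemma card_edges_le: "M \<in> packs \<Longrightarrow> a \<in> A \<Longrightarrow> card (edges M D a) \<le> k"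
  using card_mono[OF fin_star edges_star, of M D a] card_star_le[of M a] by simp

lemma edges_mono: "D \<subseteq> D' \<Longrightarrow> edges M D a \<subseteq> edges M D' a"
  by (auto simp: edges_def)

lemma layer_antimono: "i \<le> j \<Longrightarrow> layer M j \<subseteq> layer M i"
  by (induction rule: dec_induct) auto

lemma layer_A: "layer M j \<subseteq> A"
  using layer_antimono[of 0 j M] by simp

text \<open>Two loops at \<open>a\<close> could replace \<open>a\<close> in the maximum
  packing.\<close>

lemma card_loops_le: assumes "M \<in> packs" shows "card (loops M a) \<le> 1"
proof -
  have "loops M a \<in> packs" using assms packs_sub by (auto simp: loops_def)
  from gain[OF this] have "card (loops M a) \<le> card (\<Union>(vs ` loops M a))" .
  also have "\<dots> \<le> card {a}" by (rule card_mono) (auto simp: loops_def)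
  finally show ?thesis by simp
qed

section \<open>Search trees, tree walks and hubs\<close>

primrec tree :: "nat \<Rightarrow> nat set set \<Rightarrow> nat set \<Rightarrow> nat \<Rightarrow> nat set set \<times> nat set set" where
  "tree h M w 0 = ({w}, {w})"
| "tree h M w (Suc t) =
     (let R = {u \<in> layer M (h - Suc t) - snd (tree h M w t).
                 \<exists>S\<in>M. \<exists>v \<in> fst (tree h M w t). vs S = {v, u}}
      in (R, snd (tree h M w t) \<union> R))"

definition level :: "nat \<Rightarrow> nat set set \<Rightarrow> nat set \<Rightarrow> nat \<Rightarrow> nat set set" where
  "level h M w t = fst (tree h M w t)"

definition seen :: "nat \<Rightarrow> nat set set \<Rightarrow> nat set \<Rightarrow> nat \<Rightarrow> nat set set" where
  "seen h M w t = snd (tree h M w t)"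

text \<open>Any edge from the previous level may serve as the parent edge; a further edge inside the
  tree becomes \<open>extra\<close>. The choice is determined by \<open>M\<close> near the tree, so
  it can be reproduced from local data.\<close>

definition up :: "nat \<Rightarrow> nat set set \<Rightarrow> nat set \<Rightarrow> nat \<Rightarrow> nat set \<Rightarrow> nat set" where
  "up h M w t u = (SOME S. S \<in> M \<and> (\<exists>v \<in> level h M w t. vs S = {v, u}))"

definition par :: "nat \<Rightarrow> nat set set \<Rightarrow> nat set \<Rightarrow> nat \<Rightarrow> nat set \<Rightarrow> nat set" where
  "par h M w t u = (SOME v. v \<in> level h M w t \<and> vs (up h M w t u) = {v, u})"

text \<open>
  The degree is taken towards the next layer, and away from the root one of these edges leads back
  to the parent; \<open>wt\<close> is therefore the distribution of the walk that chooses uniformly among \<open>deg - 1\<close>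
  edges.  It is a sub-distribution below each child of the root, whose own weight is 1.
\<close>

definition deg :: "nat \<Rightarrow> nat set set \<Rightarrow> nat \<Rightarrow> nat set \<Rightarrow> real" where
  "deg h M t v = real (card (edges M (layer M (h - Suc t)) v))"

primrec wt :: "nat \<Rightarrow> nat set set \<Rightarrow> nat set \<Rightarrow> nat \<Rightarrow> nat set \<Rightarrow> real" where
  "wt h M w 0 u = 1"
| "wt h M w (Suc t) u =
     wt h M w t (par h M w t u) * (if t = 0 then 1 else 1 / (deg h M t (par h M w t u) - 1))"

primrec path :: "nat \<Rightarrow> nat set set \<Rightarrow> nat set \<Rightarrow> nat \<Rightarrow> nat set \<Rightarrow> nat set set" where
  "path h M w 0 u = {}"
| "path h M w (Suc t) u = insert (up h M w t u) (path h M w t (par h M w t u))"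

text \<open>The ancestor at level 1, that is, the child of the root whose subtree contains
  \<open>u\<close>; the value at level 0 is a dummy.\<close>

primrec branch :: "nat \<Rightarrow> nat set set \<Rightarrow> nat set \<Rightarrow> nat \<Rightarrow> nat set \<Rightarrow> nat set" where
  "branch h M w 0 u = u"
| "branch h M w (Suc t) u = (if t = 0 then u else branch h M w t (par h M w t u))"

text \<open>Looplessness gives the root at least four edges, hence three branches even if one edge
  is lost.\<close>

definition hub :: "nat \<Rightarrow> nat set set \<Rightarrow> nat set \<Rightarrow> bool" where
  "hub h M w \<longleftrightarrow> w \<in> layer M h \<and> loops M w = {}"

lemma wt_one [simp]: "wt h M w (Suc 0) u = 1"
  by simp

lemma level_0: "level h M w 0 = {w}" and seen_0: "seen h M w 0 = {w}"
  by (simp_all add: level_def seen_def)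

text \<open>Depth and layer index add up to \<open>h\<close>: a vertex at depth \<open>t\<close>
  lies in layer \<open>h - t\<close>, so it still has the guaranteed degree towards layer
  \<open>h - t - 1\<close>, where its children are sought.\<close>

lemma level_Suc: "level h M w (Suc t) =
    {u \<in> layer M (h - Suc t) - seen h M w t. \<exists>S\<in>M. \<exists>v \<in> level h M w t. vs S = {v, u}}"
  and seen_Suc: "seen h M w (Suc t) = seen h M w t \<union> level h M w (Suc t)"
  by (simp_all add: level_def seen_def Let_def)

end

section \<open>The tree below a hub\<close>

locale hub_tree = packing_graph +
  fixes h :: nat and M :: "nat set set" and w :: "nat set"
  assumes M: "M \<in> packs" and hub: "hub h M w" and h0: "h > 0"
begin

abbreviation "R \<equiv> level h M w"
abbreviation "Z \<equiv> seen h M w"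
abbreviation "ups \<equiv> up h M w"
abbreviation "pr \<equiv> par h M w"
abbreviation "W \<equiv> wt h M w"
abbreviation "d \<equiv> deg h M"
abbreviation "pth \<equiv> path h M w"
abbreviation "br \<equiv> branch h M w"

lemma w_layer: "w \<in> layer M h" and no_loop: "loops M w = {}"
  using hub by (auto simp: hub_def)

lemma R_Z: "R t \<subseteq> Z t"
  by (cases t) (auto simp: level_0 seen_0 seen_Suc)

lemma Z_mono: "s \<le> t \<Longrightarrow> Z s \<subseteq> Z t"
  by (induction rule: dec_induct) (auto simp: seen_Suc)

lemma R_Z_le: "s \<le> t \<Longrightarrow> R s \<subseteq> Z t"
  using R_Z Z_mono by blast

lemma R_disj: assumes "u \<in> R s" "u \<in> R t" shows "s = t"
proof -
  have *: False if "s < t" "u \<in> R s" "u \<in> R t" for s t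
  proof -
    obtain t' where t': "t = Suc t'" "s \<le> t'" using \<open>s < t\<close> by (cases t) auto
    have "u \<in> Z t'" using R_Z_le[OF t'(2)] that(2) by blast
    thus False using that(3) t'(1) by (simp add: level_Suc)
  qed
  show ?thesis using *[of s t] *[of t s] assms by (cases s t rule: linorder_cases) auto
qed

lemma R_layer: "t \<le> h \<Longrightarrow> R t \<subseteq> layer M (h - t)"
  using w_layer by (cases t) (auto simp: level_0 level_Suc)

lemma R_A: "R t \<subseteq> A"
  using w_layer layer_A by (cases t) (auto simp: level_0 level_Suc)

lemma Z_A: "Z t \<subseteq> A"
  by (induction t) (use w_layer layer_A R_A in \<open>auto simp: seen_0 seen_Suc\<close>)

lemma fin_R: "finite (R t)" and fin_Z: "finite (Z t)"
  using finite_subset[OF R_A fin_A] finite_subset[OF Z_A fin_A] by auto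

lemma ups: assumes "u \<in> R (Suc t)"
  shows "ups t u \<in> M" "pr t u \<in> R t" "vs (ups t u) = {pr t u, u}" "pr t u \<noteq> u"
proof -
  have "\<exists>S. S \<in> M \<and> (\<exists>v \<in> R t. vs S = {v, u})" using assms by (auto simp: level_Suc)
  from someI_ex[OF this] have 1: "ups t u \<in> M" "\<exists>v \<in> R t. vs (ups t u) = {v, u}"
    unfolding up_def by auto
  from 1(2) have "\<exists>v. v \<in> R t \<and> vs (ups t u) = {v, u}" by blast
  from someI_ex[OF this] have 2: "pr t u \<in> R t" "vs (ups t u) = {pr t u, u}"
    unfolding par_def by auto
  show "ups t u \<in> M" "pr t u \<in> R t" "vs (ups t u) = {pr t u, u}" by fact+
  show "pr t u \<noteq> u" using 2(1) assms R_disj[of u t "Suc t"] by auto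
qed

text \<open>If the two children differed, each would be the parent of the other, which their depths
  forbid. So a set serves as a tree edge only once.\<close>

lemma ups_inj: assumes "u \<in> R (Suc s)" "v \<in> R (Suc t)" "ups s u = ups t v"
  shows "u = v \<and> s = t"
proof -
  have e: "{pr s u, u} = {pr t v, v}" using ups(3)[OF assms(1)] ups(3)[OF assms(2)] assms(3) by simp
  show ?thesis
  proof (cases "u = v")
    case True thus ?thesis using R_disj assms(1,2) by blast
  next
    case False
    hence "u = pr t v" "v = pr s u" using e unfolding doubleton_eq_iff by metis+
    hence "Suc s = t" "Suc t = s"
      using R_disj[OF assms(1), of t] R_disj[OF assms(2), of s] ups(2)[OF assms(1)] ups(2)[OF assms(2)] by auto
    thus ?thesis by simp
  qed
qed

definition TS :: "nat \<Rightarrow> nat set set" where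
  "TS n = {ups t u | t u. t < n \<and> u \<in> R (Suc t)}"

lemma TS_M: "TS n \<subseteq> M" using ups by (auto simp: TS_def)

lemma TS_Suc: "TS (Suc n) = TS n \<union> ups n ` R (Suc n)"
  by (auto simp: TS_def less_Suc_eq)

text \<open>Every vertex but the root brings exactly one new set.\<close>

lemma card_TS: "card (TS n) + 1 = card (Z n)"
proof (induction n)
  case 0 thus ?case by (simp add: TS_def seen_0)
next
  case (Suc n)
  have "TS n \<inter> ups n ` R (Suc n) = {}"
  proof (rule ccontr)
    assume "TS n \<inter> ups n ` R (Suc n) \<noteq> {}"
    then obtain t u v where "t < n" "u \<in> R (Suc t)" "v \<in> R (Suc n)" "ups t u = ups n v"
      unfolding TS_def by blast
    thus False using ups_inj[of u t v n] by simp
  qed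
  moreover have "inj_on (ups n) (R (Suc n))" by (rule inj_onI) (use ups_inj[of _ n _ n] in blast)
  moreover have "finite (TS n)" using finite_subset[OF TS_M packsD(3)[OF M]] .
  ultimately have "card (TS (Suc n)) = card (TS n) + card (R (Suc n))"
    using fin_R by (simp add: TS_Suc card_Un_disjoint card_image)
  moreover have "Z n \<inter> R (Suc n) = {}" by (auto simp: level_Suc)
  hence "card (Z (Suc n)) = card (Z n) + card (R (Suc n))"
    using fin_R fin_Z by (simp add: seen_Suc card_Un_disjoint)
  ultimately show ?case using Suc by simp
qed

lemma TS_vs: "S \<in> TS n \<Longrightarrow> vs S \<subseteq> Z n"
proof -
  assume "S \<in> TS n"
  then obtain t u where t: "S = ups t u" "t < n" "u \<in> R (Suc t)" by (auto simp: TS_def)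
  show "vs S \<subseteq> Z n"
    using ups(2,3)[OF t(3)] t R_Z_le[of t n] R_Z_le[of "Suc t" n] by auto
qed

definition extra :: "nat set \<Rightarrow> bool" where
  "extra S \<longleftrightarrow> S \<in> M \<and> S \<notin> TS h \<and> vs S \<subseteq> Z h"

text \<open>The tree has one set fewer than vertices, so two extra sets would contradict \<open>gain\<close>.\<close>

lemma extra_unique: assumes "extra S" "extra T" shows "S = T"
proof (rule ccontr)
  assume ne: "S \<noteq> T"
  let ?Y = "insert S (insert T (TS h))"
  have "?Y \<subseteq> M" using assms TS_M by (auto simp: extra_def)
  hence "?Y \<in> packs" using packs_sub[OF M] by simp
  have "finite (TS h)" using finite_subset[OF TS_M packsD(3)[OF M]] .
  hence "card ?Y = card (TS h) + 2" using assms ne by (simp add: extra_def)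
  moreover have "card (\<Union>(vs ` ?Y)) \<le> card (Z h)"
    using assms TS_vs by (intro card_mono fin_Z) (auto simp: extra_def)
  ultimately show False using gain[OF \<open>?Y \<in> packs\<close>] card_TS[of h] by linarith
qed

lemma loop_extra: assumes "L \<in> loops M u" "u \<in> Z h" shows "extra L"
proof -
  have "L \<notin> TS h"
  proof
    assume "L \<in> TS h"
    then obtain t v where t: "L = ups t v" "v \<in> R (Suc t)" by (auto simp: TS_def)
    show False using ups(3,4)[OF t(2)] t(1) assms(1) by (auto simp: loops_def)
  qed
  thus ?thesis using assms by (auto simp: extra_def loops_def)
qed

text \<open>Loops at two tree vertices would be two extra sets.\<close>

lemma loop_vertex_unique:
  assumes "loops M u \<noteq> {}" "loops M v \<noteq> {}" "u \<in> Z h" "v \<in> Z h" shows "u = v"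
proof -
  obtain L L' where L: "L \<in> loops M u" "L' \<in> loops M v" using assms by auto
  have "L = L'" using extra_unique[OF loop_extra[OF L(1) assms(3)] loop_extra[OF L(2) assms(4)]] .
  thus ?thesis using L by (auto simp: loops_def)
qed

definition children :: "nat \<Rightarrow> nat set \<Rightarrow> nat set set" where
  "children t u = {v \<in> R (Suc t). pr t v = u}"

lemma fin_children: "finite (children t u)"
  using fin_R by (simp add: children_def)

abbreviation E :: "nat \<Rightarrow> nat set \<Rightarrow> nat set set" where
  "E t u \<equiv> edges M (layer M (h - Suc t)) u"

lemma child_edge: assumes "v \<in> children t u" "t < h" shows "ups t v \<in> E t u"
proof -
  have v: "v \<in> R (Suc t)" "pr t v = u" using assms by (auto simp: children_def)
  show ?thesis using ups[OF v(1)] v R_layer[of "Suc t"] assms(2) by (auto simp: edges_def)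
qed

text \<open>Layers shrink as their index grows, so the parent, in layer \<open>h - t\<close>, also
  lies in layer \<open>h - t - 2\<close>. The edge back to it is therefore counted by
  \<open>deg\<close> and is the one subtracted in \<open>deg - 1\<close>.\<close>

lemma parent_edge: assumes "u \<in> R (Suc t)" "Suc t < h" shows "ups t u \<in> E (Suc t) u"
proof -
  have "pr t u \<in> layer M (h - t)" using ups(2)[OF assms(1)] R_layer[of t] assms(2) by auto
  hence "pr t u \<in> layer M (h - Suc (Suc t))"
    using subsetD[OF layer_antimono[of "h - Suc (Suc t)" "h - t" M]] by simp
  moreover have "vs (ups t u) = {u, pr t u}" using ups(3)[OF assms(1)] by blast
  ultimately show ?thesis using ups(1,4)[OF assms(1)] unfolding edges_def by blast
qed

lemma card_children_le: assumes "u \<in> R t" "0 < t" "t < h"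
  shows "real (card (children t u)) \<le> d t u - 1"
proof -
  obtain s where s: "t = Suc s" using assms by (cases t) auto
  have inj: "inj_on (ups t) (children t u)"
    by (rule inj_onI) (use ups_inj[of _ t _ t] in \<open>unfold children_def, blast\<close>)
  have "ups t ` children t u \<subseteq> E t u - {ups s u}"
  proof (rule image_subsetI)
    fix v assume v: "v \<in> children t u"
    have "ups t v \<noteq> ups s u"
      using ups_inj[of v t u s] v assms(1) s by (auto simp: children_def)
    thus "ups t v \<in> E t u - {ups s u}" using child_edge[OF v assms(3)] by simp
  qed
  hence "card (children t u) \<le> card (E t u - {ups s u})"
    using card_inj_on_le[OF inj] fin_edges[OF M] by simp
  moreover have "ups s u \<in> E t u" using parent_edge[of u s] assms s by auto
  hence "card (E t u - {ups s u}) + 1 = card (E t u)"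
    using card_Suc_Diff1[OF fin_edges[OF M], of "ups s u"] by simp
  ultimately show ?thesis unfolding deg_def by linarith
qed

text \<open>The other end of the edge lies in the next layer, so it has been seen already or joins
  the next level. Either way both ends are tree vertices, and the edge is a tree edge or
  extra.\<close>

lemma edge_cases: assumes "u \<in> R t" "t < h" "S \<in> E t u"
  shows "S \<in> ups t ` children t u \<or> (0 < t \<and> S = ups (t - 1) u) \<or> extra S"
proof -
  obtain v where v: "v \<in> layer M (h - Suc t)" "v \<noteq> u" "vs S = {u, v}" and SM: "S \<in> M"
    using assms(3) by (auto simp: edges_def)
  have Zt: "Z (Suc t) \<subseteq> Z h" using Z_mono assms(2) by simp
  have uZ: "u \<in> Z h" using R_Z_le[of t h] assms by auto
  have vZ: "v \<in> Z (Suc t)"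
  proof (cases "v \<in> Z t")
    case True thus ?thesis by (simp add: seen_Suc)
  next
    case False
    hence "v \<in> R (Suc t)" using v SM assms(1) by (auto simp: level_Suc)
    thus ?thesis by (simp add: seen_Suc)
  qed
  show ?thesis
  proof (cases "S \<in> TS h")
    case False thus ?thesis using SM v(3) uZ vZ Zt by (auto simp: extra_def)
  next
    case True
    then obtain s z where z: "S = ups s z" "z \<in> R (Suc s)" by (auto simp: TS_def)
    have "{pr s z, z} = {u, v}" using ups(3)[OF z(2)] z(1) v(3) by simp
    then consider "z = u" | "z = v" "pr s z = u" by (auto simp: doubleton_eq_iff)
    thus ?thesis
    proof cases
      case 1 hence "t = Suc s" using R_disj[OF assms(1), of "Suc s"] z(2) by simp
      thus ?thesis using 1 z by auto
    next
      case 2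
      hence "t = s" using R_disj[OF assms(1), of s] ups(2)[OF z(2)] by simp
      thus ?thesis using 2 z by (auto simp: children_def)
    qed
  qed
qed

text \<open>The ends of the extra set when it is a proper edge: there the walk may find fewer
  children than its \<open>deg - 1\<close> choices.\<close>

definition defect :: "nat set \<Rightarrow> bool" where
  "defect u \<longleftrightarrow> (\<exists>S v. extra S \<and> v \<noteq> u \<and> vs S = {u, v})"

lemma card_children_ge: assumes "u \<in> R t" "t < h"
  shows "d t u \<le> card (children t u) + of_bool (0 < t) + of_bool (defect u)"
proof -
  have ext: "card {S \<in> E t u. extra S} \<le> of_bool (defect u)"
  proof (cases "defect u")
    case True
    obtain S0 v where S0: "extra S0" using True by (auto simp: defect_def)
    have "{S \<in> E t u. extra S} \<subseteq> {S0}" using extra_unique[OF _ S0] by auto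
    hence "card {S \<in> E t u. extra S} \<le> card {S0}" by (rule card_mono[rotated]) simp
    thus ?thesis using True by simp
  next
    case False
    hence "{S \<in> E t u. extra S} = {}" unfolding defect_def edges_def by blast
    thus ?thesis by (metis card.empty zero_le)
  qed
  let ?P = "if 0 < t then {ups (t - 1) u} else {}"
  have "E t u \<subseteq> ups t ` children t u \<union> ?P \<union> {S \<in> E t u. extra S}"
    using edge_cases[OF assms] by auto
  hence "card (E t u) \<le> card (ups t ` children t u \<union> ?P \<union> {S \<in> E t u. extra S})"
    using fin_edges[OF M] fin_children by (intro card_mono) auto
  also have "\<dots> \<le> card (ups t ` children t u) + card ?P + card {S \<in> E t u. extra S}"
    using card_Un_le[of "ups t ` children t u \<union> ?P" "{S \<in> E t u. extra S}"]
      card_Un_le[of "ups t ` children t u" ?P] by linarith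
  also have "\<dots> \<le> card (children t u) + of_bool (0 < t) + of_bool (defect u)"
  proof -
    have "card ?P \<le> of_bool (0 < t)" by simp
    thus ?thesis using ext card_image_le[OF fin_children, of "ups t" t u] by linarith
  qed
  finally have "real (card (E t u)) \<le> real (card (children t u) + of_bool (0 < t) + of_bool (defect u))"
    by (simp only: of_nat_le_iff)
  thus ?thesis unfolding deg_def by (simp only: of_nat_add of_nat_of_bool)
qed

text \<open>A loop counts twice towards the threshold 4 and there is at most one, so at least two
  proper edges remain.\<close>

lemma deg_loop: assumes "u \<in> R t" "t < h"
  shows "d t u \<ge> 2" "loops M u = {} \<Longrightarrow> d t u \<ge> 4"
proof -
  have "h - t = Suc (h - Suc t)" using assms(2) by simp
  hence "u \<in> layer M (Suc (h - Suc t))" using subsetD[OF R_layer assms(1)] assms(2) by simp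
  hence *: "4 \<le> 2 * card (loops M u) + card (E t u)" by (simp only: layer.simps mem_Collect_eq)
  show "d t u \<ge> 2" using * card_loops_le[OF M, of u] unfolding deg_def by linarith
  show "d t u \<ge> 4" if "loops M u = {}" using * that unfolding deg_def by simp
qed

lemma defect_no_loop: assumes "defect u" "u \<in> Z h" shows "loops M u = {}"
proof (rule ccontr)
  assume "loops M u \<noteq> {}"
  then obtain L where L: "L \<in> loops M u" by auto
  obtain S v where "extra S" "v \<noteq> u" "vs S = {u, v}" using assms by (auto simp: defect_def)
  thus False using extra_unique[of S L] loop_extra[OF L assms(2)] L by (auto simp: loops_def)
qed

lemma card_defect: "card {u. defect u} \<le> 2" "finite {u. defect u}"
proof -
  have "finite {u. defect u} \<and> card {u. defect u} \<le> 2"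
  proof (cases "\<exists>u. defect u")
    case True
    then obtain S u v where S: "extra S" "vs S = {u, v}" unfolding defect_def by blast
    have sub: "{u. defect u} \<subseteq> {u, v}"
    proof
      fix x assume "x \<in> {u. defect u}"
      then obtain T y where T: "extra T" "vs T = {x, y}" unfolding defect_def by blast
      have "vs T = vs S" using extra_unique[OF T(1) S(1)] by simp
      hence "{x, y} = {u, v}" using S(2) T(2) by simp
      thus "x \<in> {u, v}" by blast
    qed
    have "card {u, v} \<le> 2" by (simp add: card_insert_if)
    have "finite {u. defect u}" by (rule finite_subset[OF sub]) simp
    moreover have "card {u. defect u} \<le> card {u, v}" by (rule card_mono[OF _ sub]) simp
    ultimately show ?thesis using \<open>card {u, v} \<le> 2\<close> by simp
  next
    case False
    thus ?thesis by simp
  qed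
  thus "card {u. defect u} \<le> 2" "finite {u. defect u}" by auto
qed

end


section \<open>Walk weights\<close>

context hub_tree
begin

declare wt.simps(2) [simp del] layer.simps(2) [simp del]

lemma sum_level_Suc:
  "(\<Sum>v\<in>R (Suc t). f v) = (\<Sum>u\<in>R t. \<Sum>v\<in>children t u. (f v :: real))"
proof -
  have "(\<Sum>u\<in>R t. sum f {v \<in> R (Suc t). pr t v = u}) = sum f (R (Suc t))"
    by (rule sum.group[OF fin_R fin_R]) (use ups(2) in blast)
  thus ?thesis by (simp add: children_def)
qed

lemma child: "v \<in> children t u \<Longrightarrow> v \<in> R (Suc t)" "v \<in> children t u \<Longrightarrow> pr t v = u"
  by (simp_all add: children_def)

lemma deg_pos: "u \<in> R t \<Longrightarrow> t < h \<Longrightarrow> d t u - 1 \<ge> 1"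
  using deg_loop(1)[of u t] by linarith

lemma wt_nonneg: "u \<in> R t \<Longrightarrow> t \<le> h \<Longrightarrow> 0 \<le> W t u"
proof (induction t arbitrary: u)
  case (Suc t)
  have "pr t u \<in> R t" using ups(2)[OF Suc.prems(1)] .
  thus ?case using Suc.IH[of "pr t u"] deg_pos[of "pr t u" t] Suc.prems(2) by (simp add: wt.simps)
qed simp

lemma wt_child: "v \<in> children t u \<Longrightarrow> 0 < t \<Longrightarrow> W (Suc t) v = W t u / (d t u - 1)"
  using child(2)[of v t u] by (simp add: wt.simps)

text \<open>Each step after the first divides by \<open>deg - 1 >= 3\<close>, except at a vertex
  with a loop, where only \<open>deg - 1 >= 1\<close> holds. The tree has at most one such vertex,
  so the loss is a single factor 3; the second alternative records that it has been spent.\<close>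

lemma wt_le: assumes "u \<in> R (Suc t)" "Suc t \<le> h"
  shows "W (Suc t) u \<le> (1/3) ^ t \<or> (W (Suc t) u \<le> 3 * (1/3) ^ t \<and> (\<exists>z\<in>Z t. loops M z \<noteq> {}))"
  using assms
proof (induction t arbitrary: u)
  case 0 thus ?case by simp
next
  case (Suc t)
  define v where "v = pr (Suc t) u"
  have v: "v \<in> R (Suc t)" using ups(2)[OF Suc.prems(1)] by (simp add: v_def)
  have Wu: "W (Suc (Suc t)) u = W (Suc t) v / (d (Suc t) v - 1)" by (simp add: v_def wt.simps)
  have W0: "0 \<le> W (Suc t) v" using wt_nonneg[OF v] Suc.prems(2) by simp
  note IH = Suc.IH[OF v]
  have vZ: "v \<in> Z (Suc t)" using R_Z v by blast
  show ?case
  proof (cases "loops M v = {}")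
    case True
    have "d (Suc t) v - 1 \<ge> 3" using deg_loop(2)[OF v _ True] Suc.prems(2) by simp
    hence "W (Suc t) v / (d (Suc t) v - 1) \<le> W (Suc t) v / 3"
      using W0 by (intro divide_left_mono) auto
    hence le: "W (Suc (Suc t)) u \<le> W (Suc t) v / 3" unfolding Wu .
    have sub: "Z t \<subseteq> Z (Suc t)" using Z_mono by simp
    from IH Suc.prems(2) consider "W (Suc t) v \<le> (1/3) ^ t"
      | "W (Suc t) v \<le> 3 * (1/3) ^ t" "\<exists>z\<in>Z t. loops M z \<noteq> {}" by auto
    thus ?thesis
    proof cases
      case 1
      hence "W (Suc (Suc t)) u \<le> (1/3) ^ Suc t" using le by simp
      thus ?thesis by simp
    next
      case 2
      hence "W (Suc (Suc t)) u \<le> 3 * (1/3) ^ Suc t" using le by simp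
      moreover have "\<exists>z\<in>Z (Suc t). loops M z \<noteq> {}" using 2(2) sub by (meson subsetD)
      ultimately show ?thesis by simp
    qed
  next
    case False
    \<comment> \<open>An earlier looped vertex would coincide with \<open>v\<close>, but
      \<open>v\<close> was not seen before its own level.\<close>
    have "\<not> (\<exists>z\<in>Z t. loops M z \<noteq> {})"
    proof
      assume "\<exists>z\<in>Z t. loops M z \<noteq> {}"
      then obtain z where z: "z \<in> Z t" "loops M z \<noteq> {}" by blast
      have "z \<in> Z h" "v \<in> Z h"
        using z(1) vZ Z_mono[of t h] Z_mono[of "Suc t" h] Suc.prems(2) by auto
      hence "z = v" using loop_vertex_unique[OF z(2) False] by simp
      thus False using z(1) v by (simp add: level_Suc)
    qed
    hence 1: "W (Suc t) v \<le> (1/3) ^ t" using IH Suc.prems(2) by simp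
    have "1 \<le> d (Suc t) v - 1" using deg_pos[OF v] Suc.prems(2) by simp
    hence "W (Suc t) v / (d (Suc t) v - 1) \<le> W (Suc t) v / 1"
      using W0 by (intro divide_left_mono) auto
    hence "W (Suc (Suc t)) u \<le> 3 * (1/3) ^ Suc t" using 1 unfolding Wu by simp
    thus ?thesis using False vZ by blast
  qed
qed

text \<open>One factor 3 pays for the looped vertex, the other for the first step, which divides by
  nothing.\<close>

lemma wt_le_power: assumes "u \<in> R t" "0 < t" "t \<le> h" shows "W t u \<le> 9 * (1/3) ^ t"
proof -
  obtain s where s: "t = Suc s" using assms(2) by (cases t) auto
  have p: "(0::real) \<le> (1/3) ^ s" by (rule zero_le_power) simp
  have "W (Suc s) u \<le> (1/3) ^ s \<or> W (Suc s) u \<le> 3 * (1/3) ^ s"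
    using wt_le[of u s] assms(1,3) unfolding s by blast
  hence "W t u \<le> 3 * (1/3) ^ s" using p unfolding s by linarith
  thus ?thesis by (simp add: s)
qed

text \<open>A vertex hands \<open>W / (deg - 1)\<close> to each of at most \<open>deg - 1\<close>
  children, so nothing is gained from one level to the next.\<close>

lemma mass_step:
  assumes "0 < t" "t < h" "\<And>u. u \<in> R t \<Longrightarrow> 0 \<le> g u"
  shows "(\<Sum>v\<in>R (Suc t). W (Suc t) v * g (pr t v)) \<le> (\<Sum>u\<in>R t. W t u * g u)"
proof -
  have "(\<Sum>v\<in>R (Suc t). W (Suc t) v * g (pr t v)) =
      (\<Sum>u\<in>R t. \<Sum>v\<in>children t u. W (Suc t) v * g (pr t v))" by (rule sum_level_Suc)
  also have "\<dots> = (\<Sum>u\<in>R t. real (card (children t u)) * (W t u / (d t u - 1) * g u))"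
    by (intro sum.cong refl) (simp add: wt_child[OF _ assms(1)] child(2) cong: sum.cong)
  also have "\<dots> \<le> (\<Sum>u\<in>R t. W t u * g u)"
  proof (rule sum_mono)
    fix u assume u: "u \<in> R t"
    have "real (card (children t u)) * (W t u / (d t u - 1) * g u) \<le> (d t u - 1) * (W t u / (d t u - 1) * g u)"
      using card_children_le[OF u assms(1,2)] wt_nonneg[OF u] assms(2,3) u deg_pos[OF u assms(2)]
      by (intro mult_right_mono) auto
    thus "real (card (children t u)) * (W t u / (d t u - 1) * g u) \<le> W t u * g u"
      using deg_pos[OF u assms(2)] by simp
  qed
  finally show ?thesis .
qed

lemma card_children_k: assumes "u \<in> R t" "t < h" shows "card (children t u) \<le> k"
proof -
  have "inj_on (ups t) (children t u)"
  proof (rule inj_onI)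
    fix x y assume x: "x \<in> children t u" and y: "y \<in> children t u" and e: "ups t x = ups t y"
    show "x = y" using ups_inj[OF child(1)[OF x] child(1)[OF y] e] by simp
  qed
  moreover have "ups t ` children t u \<subseteq> E t u"
    by (rule image_subsetI) (rule child_edge[OF _ assms(2)])
  ultimately have "card (children t u) \<le> card (E t u)"
    by (rule card_inj_on_le[OF _ _ fin_edges[OF M]])
  thus ?thesis using card_edges_le[OF M, of u "layer M (h - Suc t)"] subsetD[OF R_A assms(1)] by simp
qed

lemma card_level: "t \<le> h \<Longrightarrow> card (R t) \<le> k ^ t"
proof (induction t)
  case (Suc t)
  have "real (card (R (Suc t))) = (\<Sum>v\<in>R (Suc t). 1)" by simp
  also have "\<dots> = (\<Sum>u\<in>R t. real (card (children t u)))"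
    unfolding sum_level_Suc by simp
  also have "\<dots> \<le> (\<Sum>u\<in>R t. real k)"
    by (intro sum_mono of_nat_mono card_children_k) (use Suc.prems in auto)
  also have "\<dots> = real (card (R t)) * real k" by simp
  also have "\<dots> \<le> real (k ^ t) * real k"
    using Suc by (intro mult_right_mono of_nat_mono) auto
  also have "\<dots> = real (k ^ Suc t)" by simp
  finally show ?case by (simp only: of_nat_le_iff)
qed (simp add: level_0)

lemma level_mass: "0 < t \<Longrightarrow> t \<le> h \<Longrightarrow> (\<Sum>u\<in>R t. W t u) \<le> k"
proof (induction t)
  case (Suc t)
  show ?case
  proof (cases "t = 0")
    case True
    have "card (R (Suc 0)) \<le> k" using card_level[of "Suc 0"] h0 by simp
    thus ?thesis using True by simp
  next
    case False
    have "(\<Sum>v\<in>R (Suc t). W (Suc t) v * 1) \<le> (\<Sum>u\<in>R t. W t u * 1)"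
      by (rule mass_step) (use False Suc.prems in auto)
    thus ?thesis using Suc False by simp
  qed
qed simp

definition bmass :: "nat \<Rightarrow> nat set \<Rightarrow> real" where
  "bmass t b = (\<Sum>u\<in>R t. W t u * of_bool (br t u = b))"

text \<open>Mass is lost only at a defect, which has weight at most 1 and at least 3 edges to choose from.\<close>

lemma branch_mass: assumes "b \<in> R (Suc 0)"
  shows "Suc t \<le> h \<Longrightarrow> bmass (Suc t) b \<le> 1 \<and> 1 - real (card {u \<in> Z t. defect u}) / 3 \<le> bmass (Suc t) b"
proof (induction t)
  case 0
  have "bmass (Suc 0) b = (\<Sum>u\<in>R (Suc 0). if u = b then 1 else 0)"
    unfolding bmass_def by (intro sum.cong) auto
  also have "\<dots> = 1" using assms fin_R by (simp add: sum.delta)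
  finally show ?case by simp
next
  case (Suc t)
  let ?s = "Suc t"
  have s: "0 < ?s" "?s < h" using Suc.prems by auto
  have brs: "br (Suc ?s) v = br ?s (pr ?s v)" for v by simp
  have up: "bmass (Suc ?s) b \<le> bmass ?s b"
    unfolding bmass_def brs by (rule mass_step[OF s]) simp
  let ?D = "{u \<in> R ?s. defect u}"
  have "bmass ?s b - real (card ?D) / 3 \<le> bmass (Suc ?s) b"
  proof -
    have one: "W ?s u * of_bool (br ?s u = b) - of_bool (defect u) / 3 \<le>
        real (card (children ?s u)) * (W ?s u / (d ?s u - 1) * of_bool (br ?s u = b))"
      if u: "u \<in> R ?s" for u
    proof (cases "br ?s u = b")
      case False thus ?thesis by simp
    next
      case True
      let ?x = "W ?s u / (d ?s u - 1)"
      have W0: "0 \<le> W ?s u" using wt_nonneg[OF u] s by simp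
      have dp: "1 \<le> d ?s u - 1" using deg_pos[OF u s(2)] .
      have x0: "0 \<le> ?x" using W0 dp by simp
      have c: "d ?s u - 1 - of_bool (defect u) \<le> real (card (children ?s u))"
        using card_children_ge[OF u s(2)] by simp
      have "(d ?s u - 1 - of_bool (defect u)) * ?x \<le> real (card (children ?s u)) * ?x"
        by (rule mult_right_mono[OF c x0])
      moreover have "(d ?s u - 1 - of_bool (defect u)) * ?x = W ?s u - of_bool (defect u) * ?x"
        using dp by (simp add: field_simps)
      moreover have "of_bool (defect u) * ?x \<le> of_bool (defect u) / 3"
      proof (cases "defect u")
        case True
        have "u \<in> Z h" using R_Z_le[of ?s h] s u by auto
        hence "loops M u = {}" using defect_no_loop[OF True] by simp
        hence "4 \<le> d ?s u" using deg_loop(2)[OF u s(2)] by simp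
        moreover have "W ?s u \<le> 1"
        proof -
          have "W ?s u = (\<Sum>v\<in>{u}. W ?s v * of_bool (br ?s v = b))" using \<open>br ?s u = b\<close> by simp
          also have "\<dots> \<le> bmass ?s b" unfolding bmass_def
            using u fin_R wt_nonneg s by (intro sum_mono2) auto
          finally show ?thesis using Suc by simp
        qed
        ultimately have "?x \<le> 1 / 3" using W0 by (intro frac_le) auto
        thus ?thesis using True by simp
      qed simp
      ultimately show ?thesis using True by simp
    qed
    have "bmass ?s b - real (card ?D) / 3 =
        (\<Sum>u\<in>R ?s. W ?s u * of_bool (br ?s u = b)) - (\<Sum>u\<in>R ?s. of_bool (defect u)) / 3"
      unfolding bmass_def using fin_R by (simp add: sum_of_bool_eq Int_def)
    also have "\<dots> = (\<Sum>u\<in>R ?s. W ?s u * of_bool (br ?s u = b) - of_bool (defect u) / 3)"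
      by (simp add: sum_subtractf sum_divide_distrib)
    also have "\<dots> \<le> (\<Sum>u\<in>R ?s. real (card (children ?s u)) * (W ?s u / (d ?s u - 1) * of_bool (br ?s u = b)))"
      by (rule sum_mono[OF one])
    also have "\<dots> = bmass (Suc ?s) b"
      unfolding bmass_def brs sum_level_Suc
      by (intro sum.cong refl) (simp add: wt_child[OF _ s(1)] child(2) cong: sum.cong)
    finally show ?thesis .
  qed
  moreover have "card {u \<in> Z ?s. defect u} = card {u \<in> Z t. defect u} + card ?D"
  proof -
    have "{u \<in> Z ?s. defect u} = {u \<in> Z t. defect u} \<union> ?D" by (auto simp: seen_Suc)
    moreover have "{u \<in> Z t. defect u} \<inter> ?D = {}" by (auto simp: level_Suc)
    ultimately show ?thesis using fin_Z fin_R by (simp add: card_Un_disjoint)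
  qed
  ultimately show ?case using Suc up by (auto simp: add_divide_distrib)
qed

text \<open>At most two defects, each costing at most 1/3, leave 1/3 of the unit mass of a
  branch.\<close>

lemma bmass_bounds: assumes "b \<in> R (Suc 0)"
  shows "1 / 3 \<le> bmass h b" "bmass h b \<le> 1"
proof -
  obtain t where t: "h = Suc t" using h0 by (cases h) auto
  have "card {u \<in> Z t. defect u} \<le> card {u. defect u}"
    using card_defect(2) by (intro card_mono) auto
  hence "card {u \<in> Z t. defect u} \<le> 2" using card_defect(1) by simp
  hence "real (card {u \<in> Z t. defect u}) \<le> 2" by simp
  thus "1 / 3 \<le> bmass h b" "bmass h b \<le> 1" using branch_mass[OF assms, of t] unfolding t by auto
qed

text \<open>The root has no parent edge, and at most one of its at least four edges is
  extra.\<close>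

lemma card_branches: "3 \<le> card (R (Suc 0))"
proof -
  have w: "w \<in> R 0" by (simp add: level_0)
  have "4 \<le> d 0 w" using deg_loop(2)[OF w h0 no_loop] .
  moreover have "d 0 w \<le> real (card (children 0 w)) + 1"
    using card_children_ge[OF w h0] by (cases "defect w") auto
  moreover have "children 0 w \<subseteq> R (Suc 0)" by (auto simp: children_def)
  hence "card (children 0 w) \<le> card (R (Suc 0))" using fin_R by (intro card_mono)
  ultimately show ?thesis by linarith
qed

lemma path_M: "u \<in> R t \<Longrightarrow> pth t u \<subseteq> M"
  by (induction t arbitrary: u) (use ups(1,2) in auto)

lemma card_path: "card (pth t u) \<le> t"
  by (induction t arbitrary: u) (auto intro: le_trans[OF card_insert_le_m1] simp: card_insert_if le_SucI)

lemma branch_level: "u \<in> R (Suc t) \<Longrightarrow> br (Suc t) u \<in> R (Suc 0)"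
proof (induction t arbitrary: u)
  case (Suc t)
  show ?case using Suc.IH[OF ups(2)[OF Suc.prems]] by simp
qed simp

lemma path_node: "S \<in> pth n u \<Longrightarrow> u \<in> R n \<Longrightarrow>
    \<exists>t<n. \<exists>v\<in>R (Suc t). S = ups t v \<and> br (Suc t) v = br n u"
proof (induction n arbitrary: u)
  case (Suc n)
  show ?case
  proof (cases "S = ups n u")
    case True thus ?thesis using Suc.prems by blast
  next
    case False
    hence S: "S \<in> pth n (pr n u)" using Suc.prems by simp
    hence n0: "n \<noteq> 0" by (cases n) auto
    from Suc.IH[OF S ups(2)[OF Suc.prems(2)]] obtain t v where
      "t < n" "v \<in> R (Suc t)" "S = ups t v" "br (Suc t) v = br n (pr n u)" by blast
    moreover have "br (Suc n) u = br n (pr n u)" using n0 by simp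
    ultimately show ?thesis by (metis less_SucI)
  qed
qed simp

text \<open>A union bound over the depth: either the last edge is \<open>S\<close>, or
  \<open>S\<close> lies on the path to the parent, whose share is controlled by
  \<open>mass_step\<close>.\<close>

lemma path_mass: "n \<le> h \<Longrightarrow> (\<Sum>u\<in>R n. W n u * of_bool (S \<in> pth n u)) \<le>
    (\<Sum>t<n. \<Sum>v\<in>R (Suc t). W (Suc t) v * of_bool (ups t v = S))"
proof (induction n)
  case 0 thus ?case by simp
next
  case (Suc n)
  have "(\<Sum>u\<in>R (Suc n). W (Suc n) u * of_bool (S \<in> pth (Suc n) u)) \<le>
     (\<Sum>u\<in>R (Suc n). W (Suc n) u * of_bool (ups n u = S) + W (Suc n) u * of_bool (S \<in> pth n (pr n u)))"
  proof (rule sum_mono)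
    fix u assume "u \<in> R (Suc n)"
    hence "0 \<le> W (Suc n) u" using wt_nonneg[of u "Suc n"] Suc.prems by simp
    thus "W (Suc n) u * of_bool (S \<in> pth (Suc n) u) \<le>
        W (Suc n) u * of_bool (ups n u = S) + W (Suc n) u * of_bool (S \<in> pth n (pr n u))"
      unfolding path.simps by (cases "ups n u = S"; cases "S \<in> pth n (pr n u)") auto
  qed
  also have "\<dots> = (\<Sum>u\<in>R (Suc n). W (Suc n) u * of_bool (ups n u = S)) +
       (\<Sum>u\<in>R (Suc n). W (Suc n) u * of_bool (S \<in> pth n (pr n u)))"
    by (rule sum.distrib)
  also have "(\<Sum>u\<in>R (Suc n). W (Suc n) u * of_bool (S \<in> pth n (pr n u))) \<le>
      (\<Sum>u\<in>R n. W n u * of_bool (S \<in> pth n u))"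
  proof (cases "n = 0")
    case True thus ?thesis by simp
  next
    case False
    show ?thesis by (rule mass_step) (use False Suc.prems in auto)
  qed
  finally show ?case using Suc by simp
qed

end

lemma (in packing_graph) tree_locale: "M \<in> packs \<Longrightarrow> hub h M w \<Longrightarrow> 0 < h \<Longrightarrow> hub_tree k U C A h M w"
  by unfold_locales

context packing_graph
begin

declare wt.simps(2) [simp del] layer.simps(2) [simp del]

definition hubs :: "nat \<Rightarrow> nat set set \<Rightarrow> nat set set" where
  "hubs h M = {w \<in> A. hub h M w}"

lemma fin_hubs: "finite (hubs h M)"
  using fin_A by (simp add: hubs_def)

text \<open>
  The weight that passes from \<open>p\<close> through \<open>S\<close> enters \<open>p\<close> through one of the other \<open>deg - 1\<close> edges, each
  of which carries at most 1 by induction, and is divided by \<open>deg - 1\<close>.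
\<close>

lemma inflow:
  assumes M: "M \<in> packs" and h: "0 < h"
  shows "t < h \<Longrightarrow> (\<Sum>w\<in>hubs h M. wt h M w (Suc t) u *
      of_bool (u \<in> level h M w (Suc t) \<and> up h M w t u = S)) \<le> 1"
proof (induction t arbitrary: S u)
  case 0
  let ?T = "{w \<in> hubs h M. u \<in> level h M w (Suc 0) \<and> up h M w 0 u = S}"
  have "(\<Sum>w\<in>hubs h M. wt h M w (Suc 0) u * of_bool (u \<in> level h M w (Suc 0) \<and> up h M w 0 u = S)) =
      (\<Sum>w\<in>?T. 1)"
    using fin_hubs by (intro sum.mono_neutral_cong_right) auto
  also have "\<dots> = real (card ?T)" by simp
  \<comment> \<open>At depth 1 the parent is the root itself, and it is the end of \<open>S\<close>
    other than \<open>u\<close>; so only one hub qualifies.\<close>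
  also have "card ?T \<le> 1"
  proof -
    have uniq: "v = w" if v: "v \<in> ?T" and w: "w \<in> ?T" for v w
    proof -
      interpret V: hub_tree k U C A h M v using tree_locale[OF M _ h] v by (simp add: hubs_def)
      interpret W: hub_tree k U C A h M w using tree_locale[OF M _ h] w by (simp add: hubs_def)
      have u1: "u \<in> level h M v (Suc 0)" "up h M v 0 u = S"
        and u2: "u \<in> level h M w (Suc 0)" "up h M w 0 u = S" using v w by auto
      have "par h M v 0 u = v" "par h M w 0 u = w"
        using V.ups(2)[OF u1(1)] W.ups(2)[OF u2(1)] by (simp_all add: level_0)
      hence "{v, u} = {w, u}" "v \<noteq> u" "w \<noteq> u"
        using V.ups(3,4)[OF u1(1)] W.ups(3,4)[OF u2(1)] u1(2) u2(2) by simp_all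
      thus ?thesis by (auto simp: doubleton_eq_iff)
    qed
    have fT: "finite ?T" using fin_hubs by simp
    have "\<forall>v\<in>?T. \<forall>w\<in>?T. v = w" by (intro ballI uniq)
    thus ?thesis unfolding One_nat_def card_le_Suc0_iff_eq[OF fT] .
  qed
  finally show ?case by simp
next
  case (Suc t)
  let ?T = "{w \<in> hubs h M. u \<in> level h M w (Suc (Suc t)) \<and> up h M w (Suc t) u = S}"
  have eq: "(\<Sum>w\<in>hubs h M. wt h M w (Suc (Suc t)) u *
        of_bool (u \<in> level h M w (Suc (Suc t)) \<and> up h M w (Suc t) u = S)) =
      (\<Sum>w\<in>?T. wt h M w (Suc (Suc t)) u)"
    using fin_hubs by (intro sum.mono_neutral_cong_right) auto
  show ?case
  proof (cases "?T = {}")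
    case True
    show ?thesis unfolding eq True by simp
  next
    case False
    then obtain w0 where w0: "w0 \<in> ?T" by blast
    define p where "p = par h M w0 (Suc t) u"
    interpret W0: hub_tree k U C A h M w0 using tree_locale[OF M _ h] w0 by (simp add: hubs_def)
    have u0: "u \<in> level h M w0 (Suc (Suc t))" "up h M w0 (Suc t) u = S" using w0 by auto
    have vsS: "vs S = {p, u}" "p \<noteq> u" "p \<in> level h M w0 (Suc t)"
      using W0.ups[OF u0(1)] u0(2) by (simp_all add: p_def)
    define X where "X = edges M (layer M (h - Suc (Suc t))) p - {S}"
    define e where "e = deg h M (Suc t) p - 1"
    have SX: "S \<in> edges M (layer M (h - Suc (Suc t))) p"
      using W0.child_edge[of u "Suc t" p] u0 Suc.prems by (simp add: W0.children_def p_def)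
    have fX: "finite X" using fin_edges[OF M] by (simp add: X_def)
    have cX: "real (card X) = e"
      using card_Suc_Diff1[OF fin_edges[OF M] SX] unfolding X_def e_def deg_def by linarith
    have e1: "e \<ge> 1" using W0.deg_pos[OF vsS(3) Suc.prems] by (simp add: e_def)
    \<comment> \<open>The end of \<open>S\<close> other than \<open>u\<close> is the parent of
      \<open>u\<close> in the tree of every hub in \<open>?T\<close>, and \<open>deg\<close> does
      not depend on the hub, so all these weights share the divisor \<open>e\<close>.\<close>
    have step: "wt h M w (Suc (Suc t)) u = wt h M w (Suc t) p / e \<and>
        p \<in> level h M w (Suc t) \<and> up h M w t p \<in> X" if w: "w \<in> ?T" for w
    proof -
      interpret V: hub_tree k U C A h M w using tree_locale[OF M _ h] w by (simp add: hubs_def)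
      have u1: "u \<in> level h M w (Suc (Suc t))" "up h M w (Suc t) u = S" using w by auto
      have "{par h M w (Suc t) u, u} = {p, u}" "par h M w (Suc t) u \<noteq> u"
        using V.ups(3,4)[OF u1(1)] u1(2) vsS(1) by simp_all
      hence pw: "par h M w (Suc t) u = p" by (auto simp: doubleton_eq_iff)
      have pl: "p \<in> level h M w (Suc t)" using V.ups(2)[OF u1(1)] pw by simp
      have "up h M w t p \<noteq> S"
        using V.ups_inj[OF pl u1(1)] u1(2) vsS(2) by auto
      thus ?thesis using V.parent_edge[OF pl Suc.prems] pl pw by (simp add: X_def e_def wt.simps(2))
    qed
    have 1: "(\<Sum>w\<in>?T. wt h M w (Suc (Suc t)) u) = (\<Sum>w\<in>?T. wt h M w (Suc t) p) / e"
      unfolding sum_divide_distrib using step by (intro sum.cong) auto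
    have "(\<Sum>w\<in>?T. wt h M w (Suc t) p) =
        (\<Sum>w\<in>?T. \<Sum>S'\<in>X. wt h M w (Suc t) p * of_bool (p \<in> level h M w (Suc t) \<and> up h M w t p = S'))"
    proof (intro sum.cong refl)
      fix w assume w: "w \<in> ?T"
      have "(\<Sum>S'\<in>X. wt h M w (Suc t) p * of_bool (p \<in> level h M w (Suc t) \<and> up h M w t p = S')) =
          (\<Sum>S'\<in>X. if up h M w t p = S' then wt h M w (Suc t) p else 0)"
        using step[OF w] by (intro sum.cong) auto
      also have "\<dots> = wt h M w (Suc t) p" using fX step[OF w] by (simp add: sum.delta')
      finally show "wt h M w (Suc t) p = (\<Sum>S'\<in>X. wt h M w (Suc t) p *
          of_bool (p \<in> level h M w (Suc t) \<and> up h M w t p = S'))" by (rule sym)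
    qed
    also have "\<dots> \<le> (\<Sum>w\<in>hubs h M. \<Sum>S'\<in>X. wt h M w (Suc t) p * of_bool (p \<in> level h M w (Suc t) \<and> up h M w t p = S'))"
    proof (intro sum_mono2 fin_hubs)
      fix w assume w: "w \<in> hubs h M - ?T"
      interpret V: hub_tree k U C A h M w using tree_locale[OF M _ h] w by (simp add: hubs_def)
      have "p \<in> level h M w (Suc t) \<Longrightarrow> 0 \<le> wt h M w (Suc t) p"
        using V.wt_nonneg[of p "Suc t"] Suc.prems by simp
      thus "0 \<le> (\<Sum>S'\<in>X. wt h M w (Suc t) p * of_bool (p \<in> level h M w (Suc t) \<and> up h M w t p = S'))"
        by (intro sum_nonneg) auto
    qed auto
    also have "\<dots> = (\<Sum>S'\<in>X. \<Sum>w\<in>hubs h M. wt h M w (Suc t) p * of_bool (p \<in> level h M w (Suc t) \<and> up h M w t p = S'))"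
      by (rule sum.swap)
    also have "\<dots> \<le> (\<Sum>S'\<in>X. 1)" by (intro sum_mono Suc.IH) (use Suc.prems in simp)
    also have "\<dots> = e" using cX by simp
    finally have "(\<Sum>w\<in>?T. wt h M w (Suc t) p) \<le> e" .
    hence "(\<Sum>w\<in>?T. wt h M w (Suc t) p) / e \<le> 1" using e1 by simp
    thus ?thesis unfolding eq 1 .
  qed
qed

text \<open>\<open>S\<close> acts as the parent edge of one of its at most \<open>k\<close> vertices
  at one of \<open>h\<close> depths, and \<open>inflow\<close> bounds each possibility by 1. Hence
  the load on a set stays bounded however many hubs there are.\<close>

lemma path_inflow:
  assumes M: "M \<in> packs" and h: "0 < h" and S: "S \<in> C"
  shows "(\<Sum>w\<in>hubs h M. \<Sum>u\<in>level h M w h. wt h M w h u * of_bool (S \<in> path h M w h u)) \<le> real h * real k"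
proof -
  have "(\<Sum>w\<in>hubs h M. \<Sum>u\<in>level h M w h. wt h M w h u * of_bool (S \<in> path h M w h u)) \<le>
     (\<Sum>w\<in>hubs h M. \<Sum>t<h. \<Sum>v\<in>vs S. wt h M w (Suc t) v * of_bool (v \<in> level h M w (Suc t) \<and> up h M w t v = S))"
  proof (rule sum_mono)
    fix w assume w: "w \<in> hubs h M"
    interpret V: hub_tree k U C A h M w using tree_locale[OF M _ h] w by (simp add: hubs_def)
    have "(\<Sum>v\<in>level h M w (Suc t). wt h M w (Suc t) v * of_bool (up h M w t v = S)) =
       (\<Sum>v\<in>vs S. wt h M w (Suc t) v * of_bool (v \<in> level h M w (Suc t) \<and> up h M w t v = S))" for t
    proof (rule sum.mono_neutral_cong)
      show "finite (level h M w (Suc t))" "finite (vs S)" using V.fin_R fin_vs by auto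
      fix v assume "v \<in> level h M w (Suc t) - vs S"
      thus "wt h M w (Suc t) v * of_bool (up h M w t v = S) = 0" using V.ups(3)[of v t] by auto
    qed auto
    thus "(\<Sum>u\<in>level h M w h. wt h M w h u * of_bool (S \<in> path h M w h u)) \<le>
       (\<Sum>t<h. \<Sum>v\<in>vs S. wt h M w (Suc t) v * of_bool (v \<in> level h M w (Suc t) \<and> up h M w t v = S))"
      using V.path_mass[of h S] by simp
  qed
  also have "\<dots> = (\<Sum>t<h. \<Sum>v\<in>vs S. \<Sum>w\<in>hubs h M. wt h M w (Suc t) v * of_bool (v \<in> level h M w (Suc t) \<and> up h M w t v = S))"
    by (subst sum.swap) (intro sum.cong refl sum.swap)
  also have "\<dots> \<le> (\<Sum>t<h. \<Sum>v\<in>vs S. 1)"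
    by (intro sum_mono inflow[OF M h]) simp
  also have "\<dots> = real h * real (card (vs S))" by simp
  also have "\<dots> \<le> real h * real k" using card_vs_le[OF S] by (intro mult_left_mono) auto
  finally show ?thesis .
qed

end


section \<open>Locality\<close>

context packing_graph
begin

text \<open>It spreads along all members of \<open>M\<close>, including those that meet three or
  more members of \<open>A\<close>. The ball depends on \<open>M\<close> itself: it is the region
  explored by an adaptive search.\<close>

primrec ball :: "nat set set \<Rightarrow> nat set set \<Rightarrow> nat \<Rightarrow> nat set set" where
  "ball M X 0 = X"
| "ball M X (Suc n) = ball M X n \<union> (\<Union>b\<in>ball M X n. \<Union>(vs ` star M b))"

definition agree :: "nat set set \<Rightarrow> nat set set \<Rightarrow> nat set set \<Rightarrow> bool" where
  "agree M M' Y \<longleftrightarrow> (\<forall>b\<in>Y. star M' b = star M b)"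

text \<open>\<open>f\<close> is decided by exploring \<open>n\<close> steps from \<open>X\<close>.
  The number of elements inspected is then bounded, which is what a pseudo-expectation
  needs.\<close>

definition loc :: "nat set set \<Rightarrow> nat \<Rightarrow> (nat set set \<Rightarrow> 'b) \<Rightarrow> bool" where
  "loc X n f \<longleftrightarrow> (\<forall>M\<in>packs. \<forall>M'\<in>packs. agree M M' (ball M X n) \<longrightarrow> f M' = f M)"

lemma agree_sub: "agree M M' Y \<Longrightarrow> Y' \<subseteq> Y \<Longrightarrow> agree M M' Y'"
  by (auto simp: agree_def)

lemma agreeD: "agree M M' Y \<Longrightarrow> b \<in> Y \<Longrightarrow> star M' b = star M b"
  by (auto simp: agree_def)

lemma ball_mono: "m \<le> n \<Longrightarrow> ball M X m \<subseteq> ball M X n"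
  by (induction rule: dec_induct) auto

lemma ball_mono_X: "X \<subseteq> Y \<Longrightarrow> ball M X n \<subseteq> ball M Y n"
proof (induction n)
  case (Suc n)
  thus ?case unfolding ball.simps by (intro Un_mono UN_mono) auto
qed simp

lemma ball_A: "X \<subseteq> A \<Longrightarrow> ball M X n \<subseteq> A"
proof (induction n)
  case (Suc n)
  have "(\<Union>b\<in>ball M X n. \<Union>(vs ` star M b)) \<subseteq> A" using vs_A by (intro UN_least)
  thus ?case using Suc by simp
qed simp

lemma ball_add: "ball M (ball M X m) n = ball M X (m + n)"
  by (induction n) simp_all

lemma ball_sub: assumes "b \<in> ball M X m" "m + n \<le> l" shows "ball M {b} n \<subseteq> ball M X l"
proof -
  have "ball M {b} n \<subseteq> ball M (ball M X m) n" using assms(1) by (intro ball_mono_X) simp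
  also have "\<dots> \<subseteq> ball M X l" unfolding ball_add by (rule ball_mono[OF assms(2)])
  finally show ?thesis .
qed

lemma ball_step: "b \<in> ball M X n \<Longrightarrow> S \<in> star M b \<Longrightarrow> c \<in> vs S \<Longrightarrow> c \<in> ball M X (Suc n)"
  by auto

text \<open>Equal stars up to radius \<open>n\<close> fix the ball one step further out, hence
  \<open>Suc n\<close>.\<close>

lemma ball_agree: "agree M M' (ball M X n) \<Longrightarrow> j \<le> Suc n \<Longrightarrow> ball M' X j = ball M X j"
proof (induction j)
  case (Suc j)
  have IH: "ball M' X j = ball M X j" using Suc by simp
  have "ball M X j \<subseteq> ball M X n" using Suc.prems(2) by (intro ball_mono) simp
  hence "star M' b = star M b" if "b \<in> ball M X j" for b
    using agreeD[OF Suc.prems(1)] that by blast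
  thus ?case unfolding ball.simps IH by (intro arg_cong2[where f="(\<union>)"] refl SUP_cong) auto
qed simp

text \<open>At most \<open>k\<close> sets meet a vertex, and each of them has at most
  \<open>k\<close> vertices.\<close>

lemma card_ball: assumes M: "M \<in> packs" and X: "X \<subseteq> A"
  shows "card (ball M X n) \<le> card X * (1 + k * k) ^ n"
proof (induction n)
  case (Suc n)
  let ?B = "ball M X n"
  have BA: "?B \<subseteq> A" using ball_A[OF X] .
  have fB: "finite ?B" using finite_subset[OF BA fin_A] .
  have "card (\<Union>b\<in>?B. \<Union>(vs ` star M b)) \<le> (\<Sum>b\<in>?B. card (\<Union>(vs ` star M b)))"
    by (rule card_UN_le[OF fB])
  also have "\<dots> \<le> (\<Sum>b\<in>?B. k * k)"
  proof (rule sum_mono)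
    fix b assume b: "b \<in> ?B"
    have "card (\<Union>(vs ` star M b)) \<le> (\<Sum>S\<in>star M b. card (vs S))"
      by (rule card_UN_le[OF fin_star[OF M]])
    also have "\<dots> \<le> (\<Sum>S\<in>star M b. k)"
      using packsD(1)[OF M] by (intro sum_mono card_vs_le) (auto simp: star_def)
    also have "\<dots> \<le> k * k" using card_star_le[OF M, of b] subsetD[OF BA b] by simp
    finally show "card (\<Union>(vs ` star M b)) \<le> k * k" .
  qed
  also have "\<dots> = card ?B * (k * k)" by simp
  finally have "card (ball M X (Suc n)) \<le> card ?B + card ?B * (k * k)"
    using card_Un_le[of ?B "\<Union>b\<in>?B. \<Union>(vs ` star M b)"] by simp
  also have "\<dots> = card ?B * (1 + k * k)" by simp
  also have "\<dots> \<le> card X * (1 + k * k) ^ n * (1 + k * k)" using Suc by (rule mult_right_mono) simp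
  finally show ?case by (simp add: mult_ac)
qed simp

lemma loc_mono: assumes "loc X m f" "X \<subseteq> Y" "m \<le> n" shows "loc Y n f"
proof -
  have "ball M X m \<subseteq> ball M Y n" for M
    using ball_mono[OF assms(3), of M X] ball_mono_X[OF assms(2), of M n] by simp
  thus ?thesis using assms(1) agree_sub unfolding loc_def by metis
qed

lemma loops_cong: "star M' a = star M a \<Longrightarrow> loops M' a = loops M a"
proof -
  assume "star M' a = star M a"
  moreover have "loops N a = {S \<in> star N a. vs S = {a}}" for N by (auto simp: loops_def star_def)
  ultimately show ?thesis by simp
qed

lemma edges_cong:
  assumes "star M' a = star M a" "\<And>S b. S \<in> star M a \<Longrightarrow> b \<in> vs S \<Longrightarrow> b \<in> D' \<longleftrightarrow> b \<in> D"
  shows "edges M' D' a = edges M D a"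
proof -
  have "edges N D a = {S \<in> star N a. \<exists>b\<in>D. b \<noteq> a \<and> vs S = {a, b}}" for N D
    by (auto simp: edges_def star_def)
  moreover have "{S \<in> star M a. \<exists>b\<in>D'. b \<noteq> a \<and> vs S = {a, b}} = {S \<in> star M a. \<exists>b\<in>D. b \<noteq> a \<and> vs S = {a, b}}"
  proof (rule Collect_cong)
    fix S
    have "\<And>b. S \<in> star M a \<Longrightarrow> vs S = {a, b} \<Longrightarrow> b \<in> D' \<longleftrightarrow> b \<in> D" using assms(2) by blast
    thus "(S \<in> star M a \<and> (\<exists>b\<in>D'. b \<noteq> a \<and> vs S = {a, b})) = (S \<in> star M a \<and> (\<exists>b\<in>D. b \<noteq> a \<and> vs S = {a, b}))"
      by metis
  qed
  ultimately show ?thesis using assms(1) by simp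
qed

lemma layer_agree: "agree M M' (ball M {a} j) \<Longrightarrow> a \<in> layer M' j \<longleftrightarrow> a \<in> layer M j"
proof (induction j arbitrary: a)
  case (Suc j)
  have st: "star M' a = star M a"
    using agreeD[OF Suc.prems] ball_mono[of 0 "Suc j" M "{a}"] by simp
  have 1: "a \<in> layer M' j \<longleftrightarrow> a \<in> layer M j"
    by (rule Suc.IH[OF agree_sub[OF Suc.prems ball_mono]]) simp
  have "b \<in> layer M' j \<longleftrightarrow> b \<in> layer M j" if "S \<in> star M a" "b \<in> vs S" for S b
  proof (rule Suc.IH[OF agree_sub[OF Suc.prems]])
    have "b \<in> ball M {a} (Suc 0)" by (rule ball_step[OF _ that]) simp
    thus "ball M {b} j \<subseteq> ball M {a} (Suc j)" by (rule ball_sub) simp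
  qed
  hence "edges M' (layer M' j) a = edges M (layer M j) a" by (rule edges_cong[OF st])
  thus ?case using 1 loops_cong[OF st] by (simp add: layer.simps)
qed simp

lemma edges_agree: assumes "agree M M' (ball M {a} (Suc j))"
  shows "edges M' (layer M' j) a = edges M (layer M j) a"
proof (rule edges_cong)
  show "star M' a = star M a"
    using agreeD[OF assms] ball_mono[of 0 "Suc j" M "{a}"] by simp
  fix S b assume S: "S \<in> star M a" "b \<in> vs S"
  have "b \<in> ball M {a} (Suc 0)" by (rule ball_step[OF _ S]) simp
  hence "ball M {b} j \<subseteq> ball M {a} (Suc j)" by (rule ball_sub) simp
  thus "b \<in> layer M' j \<longleftrightarrow> b \<in> layer M j" by (rule layer_agree[OF agree_sub[OF assms]])
qed

text \<open>Testing whether a vertex at distance \<open>t + 1\<close> lies in layer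
  \<open>h - t - 1\<close> explores \<open>h - t - 1\<close> further steps, so the whole tree is
  decided within radius \<open>h\<close>.\<close>

lemma tree_agree:
  assumes ag: "agree M M' (ball M {w} h)"
  shows "t \<le> h \<Longrightarrow> level h M' w t = level h M w t \<and> seen h M' w t = seen h M w t \<and> level h M w t \<subseteq> ball M {w} t"
proof (induction t)
  case 0 thus ?case by (simp add: level_0 seen_0)
next
  case (Suc t)
  have IH: "level h M' w t = level h M w t" "seen h M' w t = seen h M w t" "level h M w t \<subseteq> ball M {w} t"
    using Suc by simp_all
  have st: "star M' v = star M v" if "v \<in> level h M w t" for v
    using agreeD[OF ag] IH(3) that ball_mono[of t h M "{w}"] Suc.prems by auto
  have adj: "(\<exists>S\<in>M'. \<exists>v\<in>level h M w t. vs S = {v, u}) \<longleftrightarrow> (\<exists>S\<in>M. \<exists>v\<in>level h M w t. vs S = {v, u})" for u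
  proof -
    have "(\<exists>S\<in>N. \<exists>v\<in>level h M w t. vs S = {v, u}) \<longleftrightarrow> (\<exists>v\<in>level h M w t. \<exists>S\<in>star N v. vs S = {v, u})" for N
      by (auto simp: star_def)
    thus ?thesis using st by simp
  qed
  have nb: "u \<in> ball M {w} (Suc t)" if ex: "\<exists>S\<in>M. \<exists>v\<in>level h M w t. vs S = {v, u}" for u
  proof -
    obtain S v where "S \<in> M" "v \<in> level h M w t" "vs S = {v, u}" using ex by blast
    thus ?thesis using IH(3) ball_step[of v M "{w}" t S u] by (auto simp: star_def)
  qed
  have ly: "u \<in> layer M' (h - Suc t) \<longleftrightarrow> u \<in> layer M (h - Suc t)" if "u \<in> ball M {w} (Suc t)" for u
    by (rule layer_agree[OF agree_sub[OF ag ball_sub[OF that]]]) (use Suc.prems in simp)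
  have lv: "level h M' w (Suc t) = level h M w (Suc t)"
    unfolding level_Suc IH(1,2) adj using nb ly by blast
  moreover have "level h M w (Suc t) \<subseteq> ball M {w} (Suc t)" unfolding level_Suc using nb by blast
  ultimately show ?case using IH(2) by (simp only: seen_Suc)
qed

text \<open>Equal defining predicates give equal \<open>SOME\<close> choices.\<close>

lemma up_agree: assumes ag: "agree M M' (ball M {w} h)" and t: "t < h"
  shows "up h M' w t u = up h M w t u" "par h M' w t u = par h M w t u"
proof -
  have lv: "level h M' w t = level h M w t" and sub: "level h M w t \<subseteq> ball M {w} t"
    using tree_agree[OF ag, of t] t by simp_all
  have st: "star M' v = star M v" if "v \<in> level h M w t" for v
    using agreeD[OF ag] sub that ball_mono[of t h M "{w}"] t by auto
  have "S \<in> M' \<and> (\<exists>v\<in>level h M w t. vs S = {v, u}) \<longleftrightarrow> S \<in> M \<and> (\<exists>v\<in>level h M w t. vs S = {v, u})" for S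
  proof -
    have "S \<in> N \<and> (\<exists>v\<in>level h M w t. vs S = {v, u}) \<longleftrightarrow> (\<exists>v\<in>level h M w t. S \<in> star N v \<and> vs S = {v, u})" for N
      by (auto simp: star_def)
    thus ?thesis using st by simp
  qed
  thus up: "up h M' w t u = up h M w t u" unfolding up_def lv by simp
  show "par h M' w t u = par h M w t u" unfolding par_def lv up ..
qed

lemma branch_path_agree: assumes ag: "agree M M' (ball M {w} h)"
  shows "t \<le> h \<Longrightarrow> branch h M' w t u = branch h M w t u \<and> path h M' w t u = path h M w t u"
proof (induction t arbitrary: u)
  case (Suc t)
  have t: "t < h" using Suc.prems by simp
  note IH = Suc.IH[OF less_imp_le[OF t]]
  show ?case by (simp only: branch.simps path.simps up_agree[OF ag t] IH)
qed simp

lemma hub_agree: assumes ag: "agree M M' (ball M {w} h)"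
  shows "hub h M' w = hub h M w"
proof -
  have "w \<in> ball M {w} h" using ball_mono[of 0 h M "{w}"] by simp
  hence "loops M' w = loops M w" by (intro loops_cong agreeD[OF ag])
  thus ?thesis using layer_agree[OF ag] by (simp add: hub_def)
qed

lemma wt_agree: assumes ag: "agree M M' (ball M {w} h)" and M: "M \<in> packs" and hb: "hub h M w" and h: "0 < h"
  shows "t \<le> h \<Longrightarrow> u \<in> level h M w t \<Longrightarrow> wt h M' w t u = wt h M w t u"
proof (induction t arbitrary: u)
  case (Suc t)
  interpret T: hub_tree k U C A h M w using tree_locale[OF M hb h] .
  have t: "t < h" using Suc.prems by simp
  let ?p = "par h M w t u"
  have p: "?p \<in> level h M w t" using T.ups(2)[OF Suc.prems(2)] .
  have "level h M w t \<subseteq> ball M {w} t" using tree_agree[OF ag, of t] t by simp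
  hence "?p \<in> ball M {w} t" using p by blast
  hence "ball M {?p} (Suc (h - Suc t)) \<subseteq> ball M {w} h" by (rule ball_sub) (use t in simp)
  hence "edges M' (layer M' (h - Suc t)) ?p = edges M (layer M (h - Suc t)) ?p"
    by (intro edges_agree agree_sub[OF ag])
  hence "deg h M' t ?p = deg h M t ?p" by (simp add: deg_def)
  thus ?case using Suc.IH[OF _ p] t by (simp only: wt.simps up_agree[OF ag t])
qed simp

text \<open>Only the first \<open>J\<close> levels of the branch are tested; the deeper part is left
  to the decay of the weights.\<close>

definition coloured :: "nat \<Rightarrow> nat set set \<Rightarrow> nat set \<Rightarrow> nat \<Rightarrow> (nat \<Rightarrow> nat) \<Rightarrow> nat \<Rightarrow> nat set \<Rightarrow> bool" where
  "coloured h M w J \<chi> i b \<longleftrightarrow> (\<forall>t<J. \<forall>v\<in>level h M w (Suc t). branch h M w (Suc t) v = b \<longrightarrow>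
      (\<forall>x\<in>up h M w t v. \<chi> x = i))"

definition leaves :: "nat \<Rightarrow> nat set set \<Rightarrow> nat set \<Rightarrow> nat \<Rightarrow> (nat \<Rightarrow> nat) \<Rightarrow> nat \<Rightarrow> nat set set" where
  "leaves h M w J \<chi> i = {u \<in> level h M w h. coloured h M w J \<chi> i (branch h M w h u)}"

text \<open>The unnormalised expectation of \<open>F\<close> over the walk of slot
  \<open>(w, i)\<close>, set to 0 on packings where \<open>w\<close> is not a hub.\<close>

definition slot_sum :: "nat \<Rightarrow> nat \<Rightarrow> (nat \<Rightarrow> nat) \<Rightarrow> nat set \<Rightarrow> nat \<Rightarrow> (nat set \<Rightarrow> nat set set \<Rightarrow> real) \<Rightarrow> nat set set \<Rightarrow> real" where
  "slot_sum h J \<chi> w i F M =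
     of_bool (hub h M w) * (\<Sum>u\<in>leaves h M w J \<chi> i. wt h M w h u * F u (path h M w h u))"

lemma coloured_agree: assumes ag: "agree M M' (ball M {w} h)" and J: "J \<le> h"
  shows "coloured h M' w J \<chi> i b = coloured h M w J \<chi> i b"
  unfolding coloured_def
proof (intro all_cong ball_cong)
  fix t assume t: "t < J"
  have th: "Suc t \<le> h" "t < h" using t J by auto
  show "level h M' w (Suc t) = level h M w (Suc t)" using tree_agree[OF ag th(1)] by simp
  fix v assume "v \<in> level h M w (Suc t)"
  show "(branch h M' w (Suc t) v = b \<longrightarrow> (\<forall>x\<in>up h M' w t v. \<chi> x = i)) \<longleftrightarrow>
    (branch h M w (Suc t) v = b \<longrightarrow> (\<forall>x\<in>up h M w t v. \<chi> x = i))"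
    using branch_path_agree[OF ag th(1)] up_agree[OF ag th(2)] by simp
qed

lemma leaves_agree: assumes ag: "agree M M' (ball M {w} h)" and J: "J \<le> h"
  shows "leaves h M' w J \<chi> i = leaves h M w J \<chi> i"
  unfolding leaves_def using tree_agree[OF ag, of h] branch_path_agree[OF ag, of h] coloured_agree[OF ag J] by simp

lemma slot_sum_agree:
  assumes ag: "agree M M' (ball M {w} h)" and M: "M \<in> packs" and h: "0 < h" and J: "J \<le> h"
  shows "slot_sum h J \<chi> w i F M' = slot_sum h J \<chi> w i F M"
proof (cases "hub h M w")
  case True
  have "wt h M' w h u * F u (path h M' w h u) = wt h M w h u * F u (path h M w h u)"
    if "u \<in> leaves h M w J \<chi> i" for u
    using wt_agree[OF ag M True h, of h u] branch_path_agree[OF ag, of h u] that by (simp add: leaves_def)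
  thus ?thesis unfolding slot_sum_def leaves_agree[OF ag J] using hub_agree[OF ag] by simp
qed (simp add: slot_sum_def hub_agree[OF ag])

lemma loc_slot_sum: "0 < h \<Longrightarrow> J \<le> h \<Longrightarrow> loc {w} h (slot_sum h J \<chi> w i F)"
  unfolding loc_def using slot_sum_agree by blast

lemma locI: "(\<And>M M'. M \<in> packs \<Longrightarrow> M' \<in> packs \<Longrightarrow> agree M M' (ball M X n) \<Longrightarrow> f M' = f M) \<Longrightarrow> loc X n f"
  by (simp add: loc_def)

lemma locD: "loc X n f \<Longrightarrow> M \<in> packs \<Longrightarrow> M' \<in> packs \<Longrightarrow> agree M M' (ball M X n) \<Longrightarrow> f M' = f M"
  by (simp add: loc_def)

lemma loc_comp2: "loc X n f \<Longrightarrow> loc X n g \<Longrightarrow> loc X n (\<lambda>M. F (f M) (g M))"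
  unfolding loc_def by metis

lemma loc_comp: "loc X n f \<Longrightarrow> loc X n (\<lambda>M. F (f M))"
  unfolding loc_def by metis

lemma loc_const: "loc X n (\<lambda>M. c)"
  by (simp add: loc_def)

lemma loc_sum: assumes "\<And>i. i \<in> I \<Longrightarrow> loc X n (f i)" shows "loc X n (\<lambda>M. \<Sum>i\<in>I. f i M)"
  using assms unfolding loc_def by (metis (no_types, lifting) sum.cong)

text \<open>Following parents backwards shows that only hubs near \<open>u\<close> have
  \<open>u\<close> in their trees; this makes sums over all hubs local at a leaf or at a
  set.\<close>

lemma level_adj_back: assumes "M \<in> packs" "hub h M w" "0 < h"
  shows "u \<in> level h M w t \<Longrightarrow> w \<in> ball M {u} t"
proof (induction t arbitrary: u)
  case 0 thus ?case by (simp add: level_0)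
next
  case (Suc t)
  interpret T: hub_tree k U C A h M w using tree_locale[OF assms] .
  note p = T.ups[OF Suc.prems]
  have "up h M w t u \<in> star M u" using p(1,3) by (simp add: star_def)
  hence "par h M w t u \<in> ball M {u} (Suc 0)" using p(3) by (intro ball_step[of u]) auto
  hence "ball M {par h M w t u} t \<subseteq> ball M {u} (Suc t)" by (rule ball_sub) simp
  thus ?case using Suc.IH[OF p(2)] by blast
qed

text \<open>The terms to be compared are those inside the ball of radius \<open>m\<close>, which is
  the same for both packings by \<open>ball_agree\<close>.\<close>

lemma loc_near_sum:
  fixes f :: "nat set \<Rightarrow> nat set set \<Rightarrow> real"
  assumes "\<And>w. w \<in> I \<Longrightarrow> loc {w} n (f w)" "I \<subseteq> A"
    and far: "\<And>M w. M \<in> packs \<Longrightarrow> w \<in> I \<Longrightarrow> w \<notin> ball M X m \<Longrightarrow> f w M = 0"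
  shows "loc X (m + n) (\<lambda>M. \<Sum>w\<in>I. f w M)"
proof (rule locI)
  fix M M' assume M: "M \<in> packs" "M' \<in> packs" and ag: "agree M M' (ball M X (m + n))"
  have beq: "ball M' X m = ball M X m" by (rule ball_agree[OF ag]) simp
  show "(\<Sum>w\<in>I. f w M') = (\<Sum>w\<in>I. f w M)"
  proof (rule sum.cong[OF refl])
    fix w assume w: "w \<in> I"
    show "f w M' = f w M"
    proof (cases "w \<in> ball M X m")
      case True
      hence "ball M {w} n \<subseteq> ball M X (m + n)" by (rule ball_sub) simp
      thus ?thesis by (intro locD[OF assms(1)[OF w] M] agree_sub[OF ag])
    next
      case False
      thus ?thesis using far[OF M(1) w] far[OF M(2) w] beq by simp
    qed
  qed
qed

end

section \<open>Pseudo-expectations\<close>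

locale pseudo = packing_graph +
  fixes r :: nat and t :: "nat set set \<Rightarrow> real"
  assumes pseudo: "pseudo_dist r U C t"
begin

definition E :: "(nat set set \<Rightarrow> real) \<Rightarrow> real" where
  "E f = (\<Sum>M\<in>packs. t M * f M)"

lemma E_add: "E (\<lambda>M. f M + g M) = E f + E g"
  by (simp add: E_def distrib_left sum.distrib)

lemma E_diff: "E (\<lambda>M. f M - g M) = E f - E g"
  by (simp add: E_def right_diff_distrib sum_subtractf)

lemma E_cmult: "E (\<lambda>M. c * f M) = c * E f"
  by (simp add: E_def sum_distrib_left mult_ac)

lemma E_sum: "E (\<lambda>M. \<Sum>i\<in>I. f i M) = (\<Sum>i\<in>I. E (f i))"
  unfolding E_def sum_distrib_left by (rule sum.swap)

lemma E_const: "E (\<lambda>M. c) = c"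
  using pseudo by (simp add: E_def pseudo_dist_def packs_def flip: sum_distrib_right)

lemma E_cong: "(\<And>M. M \<in> packs \<Longrightarrow> f M = g M) \<Longrightarrow> E f = E g"
  unfolding E_def by (intro sum.cong) auto

text \<open>\<open>V M\<close> is a stopping set: the packings split into the events \<open>restr M (V M) = N\<close>, on which \<open>f\<close> is constant.\<close>

lemma E_stop:
  assumes V: "\<And>M. M \<in> packs \<Longrightarrow> V M \<subseteq> U \<and> card (V M) \<le> r"
    and stop: "\<And>M M'. M \<in> packs \<Longrightarrow> M' \<in> packs \<Longrightarrow> restr M' (V M) = restr M (V M) \<Longrightarrow> V M' = V M \<and> f M' = f M"
    and nonneg: "\<And>M. M \<in> packs \<Longrightarrow> 0 \<le> f M"
  shows "0 \<le> E f"
proof -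
  define key where "key M = (V M, restr M (V M))" for M
  have "E f = (\<Sum>\<kappa>\<in>key ` packs. \<Sum>M\<in>{M \<in> packs. key M = \<kappa>}. t M * f M)"
    unfolding E_def by (rule sum.image_gen[OF fin_packs])
  also have "\<dots> \<ge> 0"
  proof (rule sum_nonneg)
    fix \<kappa> assume "\<kappa> \<in> key ` packs"
    then obtain N where N: "N \<in> packs" "\<kappa> = key N" by blast
    have eq: "{M \<in> packs. key M = \<kappa>} = {M. is_packing C M \<and> restr M (V N) = restr N (V N)}"
    proof (rule Set.set_eqI)
      fix M
      have "key M = key N \<longleftrightarrow> restr M (V N) = restr N (V N)" if "M \<in> packs"
        using stop[OF N(1) that] by (auto simp: key_def)
      thus "M \<in> {M \<in> packs. key M = \<kappa>} \<longleftrightarrow> M \<in> {M. is_packing C M \<and> restr M (V N) = restr N (V N)}"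
        unfolding N(2) by (auto simp: packs_def)
    qed
    have "(\<Sum>M\<in>{M \<in> packs. key M = \<kappa>}. t M * f M) = (\<Sum>M\<in>{M \<in> packs. key M = \<kappa>}. t M * f N)"
      using stop[OF N(1)] unfolding eq by (intro sum.cong refl) (auto simp: packs_def)
    also have "\<dots> = (\<Sum>M\<in>{M \<in> packs. key M = \<kappa>}. t M) * f N" by (simp add: sum_distrib_right)
    also have "0 \<le> \<dots>"
      unfolding eq using pseudo V[OF N(1)] nonneg[OF N(1)] by (intro mult_nonneg_nonneg) (auto simp: pseudo_dist_def)
    finally show "0 \<le> (\<Sum>M\<in>{M \<in> packs. key M = \<kappa>}. t M * f M)" .
  qed
  finally show ?thesis .
qed

text \<open>The stopping set is the union of the members of \<open>A\<close> in the ball: the sets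
  that meet it determine all stars there.\<close>

lemma E_nonneg:
  assumes l: "loc X n f" and X: "X \<subseteq> A" and r: "k * (card X * (1 + k * k) ^ n) \<le> r"
    and nonneg: "\<And>M. M \<in> packs \<Longrightarrow> 0 \<le> f M"
  shows "0 \<le> E f"
proof (rule E_stop[where V = "\<lambda>M. \<Union>(ball M X n)"])
  fix M assume M: "M \<in> packs"
  have BA: "ball M X n \<subseteq> A" using ball_A[OF X] .
  have fB: "finite (ball M X n)" using finite_subset[OF BA fin_A] .
  have "card (\<Union>(ball M X n)) \<le> (\<Sum>b\<in>ball M X n. card b)"
    using card_UN_le[OF fB, of "\<lambda>b. b"] by simp
  also have "\<dots> = (\<Sum>b\<in>ball M X n. k)" using BA A_C card_C by (intro sum.cong) auto
  also have "\<dots> = k * card (ball M X n)" by simp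
  also have "\<dots> \<le> r" by (rule le_trans[OF mult_left_mono[OF card_ball[OF M X, of n] le0] r])
  finally have "card (\<Union>(ball M X n)) \<le> r" .
  moreover have "\<Union>(ball M X n) \<subseteq> U" using BA A_C C_sub by (intro Union_least) auto
  ultimately show "\<Union>(ball M X n) \<subseteq> U \<and> card (\<Union>(ball M X n)) \<le> r" by simp
  fix M' assume M': "M' \<in> packs" and eq: "restr M' (\<Union>(ball M X n)) = restr M (\<Union>(ball M X n))"
  have "agree M M' (ball M X n)"
    unfolding agree_def
  proof
    fix b assume b: "b \<in> ball M X n"
    have "star N b = {S \<in> restr N (\<Union>(ball M X n)). b \<inter> S \<noteq> {}}" for N
      using b BA by (auto simp: star_def restr_def vs_def)
    thus "star M' b = star M b" using eq by simp
  qed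
  thus "\<Union>(ball M' X n) = \<Union>(ball M X n) \<and> f M' = f M"
    using ball_agree[of M M' X n n] locD[OF l M M'] by simp
qed (use nonneg in simp)

lemma E_mono:
  assumes "loc X n f" "loc X n g" "X \<subseteq> A" "k * (card X * (1 + k * k) ^ n) \<le> r"
    "\<And>M. M \<in> packs \<Longrightarrow> f M \<le> g M"
  shows "E f \<le> E g"
proof -
  have "0 \<le> E (\<lambda>M. g M - f M)"
    by (rule E_nonneg[OF loc_comp2[OF assms(2,1)] assms(3,4)]) (use assms(5) in simp)
  thus ?thesis by (simp add: E_diff)
qed

definition mass :: "nat set \<Rightarrow> real" where
  "mass S = E (\<lambda>M. of_bool (S \<in> M))"

text \<open>Inspecting the single element \<open>x\<close> reveals the sets that cover it, of which
  a packing has at most one.\<close>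

lemma mass_element: assumes "x \<in> U" "1 \<le> r" shows "(\<Sum>S | S \<in> C \<and> x \<in> S. mass S) \<le> 1"
proof -
  let ?f = "\<lambda>M. (1::real) - (\<Sum>S | S \<in> C \<and> x \<in> S. of_bool (S \<in> M))"
  have f: "?f M = 1 - real (card (restr M {x}))" if "M \<in> packs" for M
  proof -
    have "{S. S \<in> C \<and> x \<in> S} \<inter> {S. S \<in> M} = restr M {x}"
      using packsD(1)[OF that] by (auto simp: restr_def)
    thus ?thesis using fin_C by (simp add: sum_of_bool_eq)
  qed
  have "0 \<le> E ?f"
  proof (rule E_stop[where V = "\<lambda>M. {x}"])
    fix M M' assume M: "M \<in> packs" and M': "M' \<in> packs" and e: "restr M' {x} = restr M {x}"
    show "{x} = {x} \<and> ?f M' = ?f M" unfolding f[OF M] f[OF M'] e by simp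
  next
    fix M assume M: "M \<in> packs"
    have "card (restr M {x}) \<le> 1" using card_hitting_le[OF M, of "{x}"] by (simp add: restr_def)
    thus "0 \<le> ?f M" unfolding f[OF M] by simp
  qed (use assms in auto)
  also have "E ?f = 1 - (\<Sum>S | S \<in> C \<and> x \<in> S. mass S)"
    by (simp only: E_diff E_const E_sum mass_def)
  finally show ?thesis by simp
qed

end


section \<open>The potential of the layers\<close>

context packing_graph
begin

lemma loc_layer: "loc {a} j (\<lambda>M. a \<in> layer M j)"
  by (rule locI, rule layer_agree, assumption)

lemma loc_edges: "loc {a} (Suc j) (\<lambda>M. edges M (layer M j) a)"
  by (rule locI, rule edges_agree, assumption)

lemma star_agree: "agree M M' (ball M X n) \<Longrightarrow> a \<in> X \<Longrightarrow> star M' a = star M a"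
  using subsetD[OF ball_mono[of 0 n M X], of a] by (simp add: agree_def)

lemma loc_star: "a \<in> X \<Longrightarrow> loc X n (\<lambda>M. star M a)"
  by (rule locI, rule star_agree, assumption+)

lemma loc_loops: "a \<in> X \<Longrightarrow> loc X n (\<lambda>M. loops M a)"
  by (rule locI, rule loops_cong, rule star_agree, assumption+)

text \<open>The star of one vertex of \<open>S\<close> shows whether \<open>S\<close> is present,
  and \<open>vs S\<close> is nonempty by maximality of \<open>A\<close>.\<close>

lemma loc_mem: assumes "S \<in> C" shows "loc (vs S) n (\<lambda>M. S \<in> M)"
proof -
  obtain a where a: "a \<in> vs S" using vs_nonempty[OF assms] by (meson ex_in_conv)
  show ?thesis
  proof (rule locI)
    fix M M' assume "agree M M' (ball M (vs S) n)"
    hence "star M' a = star M a" using a by (rule star_agree)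
    hence "S \<in> star M' a \<longleftrightarrow> S \<in> star M a" by (rule arg_cong)
    thus "(S \<in> M') = (S \<in> M)" unfolding star_def using a by simp
  qed
qed

lemma loc_hub: "loc {a} h (\<lambda>M. hub h M a)"
  by (rule locI, rule hub_agree, assumption)

lemma edges_swap:
  assumes M: "M \<in> packs" and PQ: "P \<inter> Q = {}" "finite P" "finite Q"
  shows "(\<Sum>a\<in>P. real (card (edges M Q a))) = (\<Sum>b\<in>Q. real (card (edges M P b)))"
proof -
  have *: "real (card (edges M Q a)) = (\<Sum>b\<in>Q. real (card {S \<in> M. vs S = {a, b}}))"
    if "a \<notin> Q" "finite Q" for a Q
  proof -
    have "edges M Q a = (\<Union>b\<in>Q. {S \<in> M. vs S = {a, b}})"
      using that(1) by (auto simp: edges_def)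
    moreover have "card (\<Union>b\<in>Q. {S \<in> M. vs S = {a, b}}) = (\<Sum>b\<in>Q. card {S \<in> M. vs S = {a, b}})"
      using packsD(3)[OF M] that by (intro card_UN_disjoint) (auto simp: doubleton_eq_iff)
    ultimately show ?thesis by simp
  qed
  have "(\<Sum>a\<in>P. real (card (edges M Q a))) = (\<Sum>a\<in>P. \<Sum>b\<in>Q. real (card {S \<in> M. vs S = {a, b}}))"
    using PQ by (intro sum.cong refl *) auto
  also have "\<dots> = (\<Sum>b\<in>Q. \<Sum>a\<in>P. real (card {S \<in> M. vs S = {b, a}}))"
    by (subst sum.swap) (simp add: insert_commute)
  also have "\<dots> = (\<Sum>b\<in>Q. real (card (edges M P b)))"
    using PQ by (intro sum.cong refl *[symmetric]) auto
  finally show ?thesis .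
qed

text \<open>Summed over a layer this is \<open>2 loops + edges - 3 vertices\<close>.\<close>

definition local_pot :: "nat \<Rightarrow> nat set \<Rightarrow> nat set set \<Rightarrow> real" where
  "local_pot j a M = 2 * real (card (loops M a)) + real (card (edges M (layer M j) a)) / 2 - 3"

definition pot :: "nat \<Rightarrow> nat set set \<Rightarrow> real" where
  "pot j M = (\<Sum>a\<in>A. of_bool (a \<in> layer M j) * local_pot j a M)"

text \<open>
  An edge inside a layer contributes 1/2 at each end, so deleting \<open>b\<close> costs its own share and 1/2 at
  each remaining neighbour; this is outweighed by the 3 because \<open>2 loops + degree \<le> 3\<close>.
\<close>

definition gain_term :: "nat \<Rightarrow> nat set \<Rightarrow> nat set set \<Rightarrow> real" where
  "gain_term j b M = of_bool (b \<in> layer M j \<and> b \<notin> layer M (Suc j)) *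
     (3 - 2 * real (card (loops M b)) - real (card (edges M (layer M j) b)) / 2
        - real (card (edges M (layer M (Suc j)) b)) / 2)"

text \<open>Edges between survivors and deleted vertices are lost at the surviving ends;
  \<open>edges_swap\<close> moves this loss to the deleted ends. The change becomes a sum of local
  terms, to which expectations can be applied one by one.\<close>

lemma pot_step: assumes M: "M \<in> packs"
  shows "pot (Suc j) M - pot j M = (\<Sum>b\<in>A. gain_term j b M)"
proof -
  define D where "D = layer M j"
  define D' where "D' = layer M (Suc j)"
  define X where "X = D - D'"
  have sub: "D' \<subseteq> D" "D \<subseteq> A" using layer_antimono[of j "Suc j" M] layer_A by (auto simp: D_def D'_def)
  have "finite D" using finite_subset[OF sub(2) fin_A] .
  hence fin: "finite D" "finite D'" "finite X" using finite_subset[OF sub(1)] by (simp_all add: X_def)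
  have split: "(\<Sum>a\<in>D. f a) = (\<Sum>a\<in>D'. f a) + (\<Sum>a\<in>X. f a)" for f :: "nat set \<Rightarrow> real"
    using sum.subset_diff[OF sub(1) fin(1), of f] by (simp add: X_def add.commute)
  have restrict: "(\<Sum>a\<in>A. of_bool (a \<in> B) * f a) = (\<Sum>a\<in>B. f a)" if "B \<subseteq> A" for B and f :: "nat set \<Rightarrow> real"
    using that fin_A by (intro sum.mono_neutral_cong_right) auto
  have e: "real (card (edges M D a)) = real (card (edges M D' a)) + real (card (edges M X a))" if "a \<in> D'" for a
  proof -
    have D: "b \<in> D \<longleftrightarrow> b \<in> D' \<or> b \<in> X" for b using sub by (auto simp: X_def)
    have "edges M D a = edges M D' a \<union> edges M X a"
      unfolding edges_def bex_simps Bex_def D by (rule Set.set_eqI) (simp, metis)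
    moreover have "edges M D' a \<inter> edges M X a = {}"
    proof -
      have False if S: "S \<in> edges M D' a" "S \<in> edges M X a" for S
      proof -
        from S obtain b c where "b \<in> D'" "b \<noteq> a" "vs S = {a, b}" "c \<in> X" "c \<noteq> a" "vs S = {a, c}"
          unfolding edges_def by blast
        moreover from this have "b = c" by (simp add: doubleton_eq_iff)
        ultimately show False by (simp add: X_def)
      qed
      thus ?thesis by blast
    qed
    ultimately show ?thesis using fin_edges[OF M] by (simp add: card_Un_disjoint)
  qed
  have 1: "pot j M = (\<Sum>a\<in>D. local_pot j a M)" "pot (Suc j) M = (\<Sum>a\<in>D'. local_pot (Suc j) a M)"
    unfolding pot_def D_def[symmetric] D'_def[symmetric] using sub by (auto intro!: restrict)
  have "(\<Sum>a\<in>D'. local_pot j a M) = (\<Sum>a\<in>D'. local_pot (Suc j) a M + real (card (edges M X a)) / 2)"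
    by (intro sum.cong refl) (simp add: local_pot_def e flip: D_def D'_def)
  also have "\<dots> = pot (Suc j) M + (\<Sum>a\<in>D'. real (card (edges M X a))) / 2"
    by (simp add: sum.distrib sum_divide_distrib 1)
  also have "(\<Sum>a\<in>D'. real (card (edges M X a))) = (\<Sum>b\<in>X. real (card (edges M D' b)))"
    by (rule edges_swap[OF M _ fin(2,3)]) (auto simp: X_def)
  finally have 2: "(\<Sum>a\<in>D'. local_pot j a M) = pot (Suc j) M + (\<Sum>b\<in>X. real (card (edges M D' b))) / 2" .
  have "(\<Sum>b\<in>A. gain_term j b M) = (\<Sum>b\<in>A. of_bool (b \<in> X) * (- local_pot j b M - real (card (edges M D' b)) / 2))"
    by (intro sum.cong refl) (simp add: gain_term_def local_pot_def X_def D_def D'_def)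
  also have "\<dots> = (\<Sum>b\<in>X. - local_pot j b M - real (card (edges M D' b)) / 2)"
    by (rule restrict) (use sub in \<open>auto simp: X_def\<close>)
  also have "\<dots> = - (\<Sum>b\<in>X. local_pot j b M) - (\<Sum>b\<in>X. real (card (edges M D' b))) / 2"
    by (simp add: sum_subtractf sum_negf sum_divide_distrib)
  finally show ?thesis using 2 split[of "\<lambda>a. local_pot j a M"] 1(1) by linarith
qed

lemma gain_term_nonneg: assumes M: "M \<in> packs" shows "0 \<le> gain_term j b M"
proof (cases "b \<in> layer M j \<and> b \<notin> layer M (Suc j)")
  case True
  hence "\<not> 4 \<le> 2 * card (loops M b) + card (edges M (layer M j) b)" by (simp add: layer.simps)
  hence "2 * card (loops M b) + card (edges M (layer M j) b) \<le> 3" by linarith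
  moreover have "edges M (layer M (Suc j)) b \<subseteq> edges M (layer M j) b"
    by (intro edges_mono layer_antimono) simp
  hence "card (edges M (layer M (Suc j)) b) \<le> card (edges M (layer M j) b)"
    by (rule card_mono[OF fin_edges[OF M]])
  ultimately show ?thesis by (simp add: gain_term_def)
next
  case False
  hence "of_bool (b \<in> layer M j \<and> b \<notin> layer M (Suc j)) = (0 :: real)" by (simp only: of_bool_eq)
  thus ?thesis unfolding gain_term_def by (simp only: mult_zero_left order_refl)
qed

lemma loc_gain_term: "loc {b} (Suc (Suc j)) (gain_term j b)"
proof (rule locI)
  fix M M' assume M: "M \<in> packs" "M' \<in> packs" and ag: "agree M M' (ball M {b} (Suc (Suc j)))"
  have "b \<in> layer M' j \<longleftrightarrow> b \<in> layer M j" "b \<in> layer M' (Suc j) \<longleftrightarrow> b \<in> layer M (Suc j)"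
    by (rule layer_agree[OF agree_sub[OF ag ball_mono]]; simp)+
  moreover have "edges M' (layer M' j) b = edges M (layer M j) b"
    "edges M' (layer M' (Suc j)) b = edges M (layer M (Suc j)) b"
    by (rule edges_agree[OF agree_sub[OF ag ball_mono]]; simp)+
  moreover have "loops M' b = loops M b" using locD[OF loc_loops M ag] by simp
  ultimately show "gain_term j b M' = gain_term j b M" by (simp only: gain_term_def)
qed

lemma pot_0: assumes M: "M \<in> packs"
  shows "pot 0 M = (\<Sum>S\<in>C. of_bool (S \<in> M) * (2 * of_bool (card (vs S) = 1) + of_bool (card (vs S) = 2))) - 3 * real (card A)"
proof -
  have MC: "M \<subseteq> C" using packsD[OF M] by simp
  have cardsum: "real (card {S \<in> M. P S}) = (\<Sum>S\<in>C. of_bool (S \<in> M \<and> P S))" for P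
  proof -
    have "C \<inter> {S. S \<in> M \<and> P S} = {S \<in> M. P S}" using MC by auto
    thus ?thesis using fin_C by (simp add: sum_of_bool_eq)
  qed
  have 1: "(\<Sum>a\<in>A. real (card (loops M a))) = (\<Sum>S\<in>C. of_bool (S \<in> M) * of_bool (card (vs S) = 1))"
  proof -
    have "(\<Sum>a\<in>A. real (card (loops M a))) = (\<Sum>S\<in>C. \<Sum>a\<in>A. of_bool (S \<in> M \<and> vs S = {a}))"
      unfolding loops_def cardsum by (rule sum.swap)
    also have "\<dots> = (\<Sum>S\<in>C. of_bool (S \<in> M) * of_bool (card (vs S) = 1))"
    proof (rule sum.cong[OF refl])
      fix S
      show "(\<Sum>a\<in>A. of_bool (S \<in> M \<and> vs S = {a})) = (of_bool (S \<in> M) * of_bool (card (vs S) = 1) :: real)"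
      proof (cases "card (vs S) = 1")
        case True
        then obtain c where c: "vs S = {c}" by (rule card_1_singletonE)
        have "c \<in> A" using c vs_A by auto
        hence "A \<inter> {a. S \<in> M \<and> {c} = {a}} = (if S \<in> M then {c} else {})" by auto
        thus ?thesis using c fin_A by (simp add: sum_of_bool_eq)
      next
        case False
        have "vs S \<noteq> {a}" for a using False by auto
        thus ?thesis using False by simp
      qed
    qed
    finally show ?thesis .
  qed
  have 2: "(\<Sum>a\<in>A. real (card (edges M A a))) = (\<Sum>S\<in>C. of_bool (S \<in> M) * (2 * of_bool (card (vs S) = 2)))"
  proof -
    have "(\<Sum>a\<in>A. real (card (edges M A a))) = (\<Sum>S\<in>C. \<Sum>a\<in>A. of_bool (S \<in> M \<and> (\<exists>b\<in>A. b \<noteq> a \<and> vs S = {a, b})))"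
      unfolding edges_def cardsum by (rule sum.swap)
    also have "\<dots> = (\<Sum>S\<in>C. of_bool (S \<in> M) * (2 * of_bool (card (vs S) = 2)))"
    proof (rule sum.cong[OF refl])
      fix S
      show "(\<Sum>a\<in>A. of_bool (S \<in> M \<and> (\<exists>b\<in>A. b \<noteq> a \<and> vs S = {a, b}))) = (of_bool (S \<in> M) * (2 * of_bool (card (vs S) = 2)) :: real)"
      proof (cases "card (vs S) = 2")
        case True
        then obtain c d where c: "vs S = {c, d}" "c \<noteq> d" by (meson card_2_iff)
        have cd: "c \<in> A" "d \<in> A" using c vs_A by auto
        have "(\<exists>b\<in>A. b \<noteq> a \<and> {c, d} = {a, b}) \<longleftrightarrow> a = c \<or> a = d" for a
          using cd c(2) by (auto simp: doubleton_eq_iff)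
        hence "A \<inter> {a. S \<in> M \<and> (\<exists>b\<in>A. b \<noteq> a \<and> {c, d} = {a, b})} = (if S \<in> M then {c, d} else {})" using cd by auto
        thus ?thesis using c fin_A by (simp add: sum_of_bool_eq)
      next
        case False
        have "(b \<noteq> a \<and> vs S = {a, b}) = False" for a b using False by (auto simp: card_2_iff)
        hence "(\<exists>b\<in>A. b \<noteq> a \<and> vs S = {a, b}) = False" for a by (simp only: bex_simps simp_thms Bex_def)
        thus ?thesis using False by (simp only: of_bool_eq simp_thms sum.neutral_const mult_zero_right)
      qed
    qed
    finally show ?thesis .
  qed
  have "pot 0 M = (\<Sum>a\<in>A. 2 * real (card (loops M a)) + real (card (edges M A a)) / 2 - 3)"
    unfolding pot_def local_pot_def by (intro sum.cong) auto
  also have "\<dots> = 2 * (\<Sum>a\<in>A. real (card (loops M a))) + (\<Sum>a\<in>A. real (card (edges M A a))) / 2 - 3 * real (card A)"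
    by (simp add: sum_subtractf sum.distrib sum_distrib_left sum_divide_distrib)
  finally show ?thesis unfolding 1 2
    by (simp add: distrib_left sum.distrib sum_distrib_left sum_divide_distrib mult_ac)
qed

text \<open>At most one loop leaves degree at least 2, so a neighbour in layer \<open>h\<close>
  exists. If it had a loop too, the two loops and the joining edge would be three sets on two
  vertices, against \<open>gain\<close>.\<close>

lemma loop_neighbour:
  assumes M: "M \<in> packs" and a: "a \<in> layer M (Suc h)" "loops M a \<noteq> {}"
  shows "\<exists>b\<in>A. hub h M b \<and> a \<noteq> b \<and> (\<exists>S\<in>M. vs S = {a, b})"
proof -
  have "4 \<le> 2 * card (loops M a) + card (edges M (layer M h) a)" using a by (simp add: layer.simps)
  hence "card (edges M (layer M h) a) \<noteq> 0" using card_loops_le[OF M, of a] by linarith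
  then obtain S where "S \<in> edges M (layer M h) a" by fastforce
  then obtain b where b: "b \<in> layer M h" "b \<noteq> a" "S \<in> M" "vs S = {a, b}" by (auto simp: edges_def)
  have "loops M b = {}"
  proof (rule ccontr)
    assume "loops M b \<noteq> {}"
    then obtain L L' where L: "L \<in> loops M a" "L' \<in> loops M b" using a by auto
    have vL: "vs L = {a}" "vs L' = {b}" "L \<in> M" "L' \<in> M" using L by (auto simp: loops_def)
    let ?Y = "{L, L', S}"
    have "L \<noteq> L'" "L \<noteq> S" "L' \<noteq> S" using vL b by auto
    hence "card ?Y = 3" by simp
    moreover have "\<Union>(vs ` ?Y) = {a, b}" using vL b by auto
    moreover have "?Y \<in> packs" by (rule packs_sub[OF M]) (use vL b in auto)
    ultimately show False using gain[of ?Y] b(2) by simp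
  qed
  thus ?thesis using b layer_A[of M h] unfolding hub_def by blast
qed

end

text \<open>\<open>N\<close> is a radius that the level \<open>r\<close> can afford around any
  \<open>k\<close> vertices.\<close>

locale gap = pseudo +
  fixes N :: nat
  assumes rN: "k * (k * (1 + k * k) ^ N) \<le> r"
begin

lemma rad: assumes "card X \<le> k" "n \<le> N" shows "k * (card X * (1 + k * k) ^ n) \<le> r"
proof -
  have "(1 + k * k) ^ n \<le> (1 + k * k) ^ N" by (rule power_increasing[OF assms(2)]) simp
  hence "k * (card X * (1 + k * k) ^ n) \<le> k * (k * (1 + k * k) ^ N)"
    using assms(1) by (intro mult_le_mono) auto
  thus ?thesis using rN by (rule le_trans)
qed

lemma E_pos:
  assumes "loc X n f" "n \<le> N" "X \<subseteq> A" "card X \<le> k" "\<And>M. M \<in> packs \<Longrightarrow> 0 \<le> f M"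
  shows "0 \<le> E f"
  using E_nonneg[OF assms(1,3) rad[OF assms(4,2)] assms(5)] .

lemma E_le:
  assumes "loc X n f" "loc X n g" "n \<le> N" "X \<subseteq> A" "card X \<le> k" "\<And>M. M \<in> packs \<Longrightarrow> f M \<le> g M"
  shows "E f \<le> E g"
  using E_mono[OF assms(1,2,4) rad[OF assms(5,3)] assms(6)] .

lemma E_pos1:
  assumes "loc {a} n f" "n \<le> N" "a \<in> A" "\<And>M. M \<in> packs \<Longrightarrow> 0 \<le> f M"
  shows "0 \<le> E f"
  by (rule E_pos[OF assms(1,2)]) (use assms(3,4) kpos in auto)

lemma E_le1:
  assumes "loc {a} n f" "loc {a} n g" "n \<le> N" "a \<in> A" "\<And>M. M \<in> packs \<Longrightarrow> f M \<le> g M"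
  shows "E f \<le> E g"
  by (rule E_le[OF assms(1-3)]) (use assms(4,5) kpos in auto)

lemma mass_nonneg: "S \<in> C \<Longrightarrow> 0 \<le> mass S"
  unfolding mass_def
  by (rule E_pos[OF loc_comp[OF loc_mem, of _ 0 of_bool]]) (use vs_A card_vs_le in auto)

lemma r1: "1 \<le> r"
proof -
  have "1 \<le> k * (k * (1 + k * k) ^ N)" using kpos by simp
  thus ?thesis using rN by (rule le_trans)
qed

text \<open>Adding up \<open>mass_element\<close> over \<open>X\<close> counts each of these sets
  \<open>card (S \<inter> X)\<close> times, hence at least once.\<close>

lemma mass_hit: assumes "finite X" "X \<subseteq> U" shows "(\<Sum>S | S \<in> C \<and> S \<inter> X \<noteq> {}. mass S) \<le> real (card X)"
proof -
  have "(\<Sum>S | S \<in> C \<and> S \<inter> X \<noteq> {}. mass S) \<le> (\<Sum>S | S \<in> C \<and> S \<inter> X \<noteq> {}. real (card (S \<inter> X)) * mass S)"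
  proof (rule sum_mono)
    fix S assume S: "S \<in> {S. S \<in> C \<and> S \<inter> X \<noteq> {}}"
    have "card (S \<inter> X) \<noteq> 0" using S assms(1) by simp
    hence "1 \<le> real (card (S \<inter> X))" by simp
    thus "mass S \<le> real (card (S \<inter> X)) * mass S"
      using mult_right_mono[of 1 "real (card (S \<inter> X))" "mass S"] mass_nonneg[of S] S by simp
  qed
  also have "\<dots> \<le> (\<Sum>S\<in>C. real (card (S \<inter> X)) * mass S)"
    using fin_C mass_nonneg by (intro sum_mono2) auto
  also have "\<dots> = (\<Sum>S\<in>C. \<Sum>x\<in>X. of_bool (x \<in> S) * mass S)"
  proof (rule sum.cong[OF refl])
    fix S
    have "X \<inter> {x. x \<in> S} = S \<inter> X" by blast
    thus "real (card (S \<inter> X)) * mass S = (\<Sum>x\<in>X. of_bool (x \<in> S) * mass S)"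
      using assms(1) by (simp add: sum_of_bool_eq flip: sum_distrib_right)
  qed
  also have "\<dots> = (\<Sum>x\<in>X. \<Sum>S\<in>C. of_bool (x \<in> S) * mass S)" by (rule sum.swap)
  also have "\<dots> = (\<Sum>x\<in>X. \<Sum>S | S \<in> C \<and> x \<in> S. mass S)"
    using fin_C by (intro sum.cong refl sum.mono_neutral_cong_right) auto
  also have "\<dots> \<le> (\<Sum>x\<in>X. 1)" by (intro sum_mono mass_element r1) (use assms in auto)
  finally show ?thesis by simp
qed

lemma mass_vs: "(\<Sum>S\<in>C. real (card (vs S)) * mass S) \<le> real k * real (card A)"
proof -
  have "(\<Sum>S\<in>C. real (card (vs S)) * mass S) = (\<Sum>S\<in>C. \<Sum>a\<in>A. of_bool (a \<inter> S \<noteq> {}) * mass S)"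
  proof (rule sum.cong[OF refl])
    fix S
    have "A \<inter> {a. a \<inter> S \<noteq> {}} = vs S" by (auto simp: vs_def)
    thus "real (card (vs S)) * mass S = (\<Sum>a\<in>A. of_bool (a \<inter> S \<noteq> {}) * mass S)"
      using fin_A by (simp add: sum_of_bool_eq flip: sum_distrib_right)
  qed
  also have "\<dots> = (\<Sum>a\<in>A. \<Sum>S\<in>C. of_bool (a \<inter> S \<noteq> {}) * mass S)" by (rule sum.swap)
  also have "\<dots> = (\<Sum>a\<in>A. \<Sum>S | S \<in> C \<and> S \<inter> a \<noteq> {}. mass S)"
    using fin_C by (intro sum.cong refl sum.mono_neutral_cong_right) auto
  also have "\<dots> \<le> (\<Sum>a\<in>A. real k)"
  proof (rule sum_mono)
    fix a assume "a \<in> A"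
    hence "a \<in> C" using A_C by auto
    thus "(\<Sum>S | S \<in> C \<and> S \<inter> a \<noteq> {}. mass S) \<le> real k"
      using mass_hit[OF fin_S C_sub, of a] card_C[of a] by simp
  qed
  finally show ?thesis by (simp add: mult.commute)
qed

text \<open>Three times the amount by which the value exceeds
  \<open>(k/3 + 1) card A\<close>.\<close>

definition excess :: real where
  "excess = 3 * (\<Sum>S\<in>C. mass S) - (real k + 3) * real (card A)"

text \<open>Of the 3 units per set, \<open>card (vs S)\<close> are paid for by
  \<open>mass_vs\<close>. What remains is 2 for a loop, 1 for an edge and nothing positive
  otherwise.\<close>

lemma pot_0_excess: "excess \<le> E (pot 0)"
proof -
  have "E (pot 0) = E (\<lambda>M. (\<Sum>S\<in>C. (2 * of_bool (card (vs S) = 1) + of_bool (card (vs S) = 2)) * of_bool (S \<in> M)) - 3 * real (card A))"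
    by (rule E_cong) (simp add: pot_0 mult.commute)
  also have "\<dots> = (\<Sum>S\<in>C. (2 * of_bool (card (vs S) = 1) + of_bool (card (vs S) = 2)) * mass S) - 3 * real (card A)"
    by (simp only: E_diff E_const E_sum E_cmult mass_def)
  finally have *: "E (pot 0) = (\<Sum>S\<in>C. (2 * of_bool (card (vs S) = 1) + of_bool (card (vs S) = 2)) * mass S) - 3 * real (card A)" .
  have "(\<Sum>S\<in>C. 3 * mass S - real (card (vs S)) * mass S) \<le>
      (\<Sum>S\<in>C. (2 * of_bool (card (vs S) = 1) + of_bool (card (vs S) = 2)) * mass S)"
  proof (rule sum_mono)
    fix S assume S: "S \<in> C"
    have "card (vs S) \<noteq> 0" using vs_nonempty[OF S] fin_vs by simp
    then consider "card (vs S) = 1" | "card (vs S) = 2" | "3 \<le> card (vs S)" by linarith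
    hence "3 - real (card (vs S)) \<le> 2 * of_bool (card (vs S) = 1) + of_bool (card (vs S) = 2)"
      by cases auto
    thus "3 * mass S - real (card (vs S)) * mass S \<le> (2 * of_bool (card (vs S) = 1) + of_bool (card (vs S) = 2)) * mass S"
      using mult_right_mono[OF _ mass_nonneg[OF S]] by (simp only: left_diff_distrib[symmetric])
  qed
  thus ?thesis using mass_vs unfolding excess_def *
    by (simp add: sum_subtractf sum_distrib_left[symmetric] algebra_simps)
qed

lemma pot_mono: assumes "Suc (Suc j) \<le> N" shows "E (pot j) \<le> E (pot (Suc j))"
proof -
  have "E (pot (Suc j)) - E (pot j) = E (\<lambda>M. pot (Suc j) M - pot j M)" by (simp add: E_diff)
  also have "\<dots> = E (\<lambda>M. \<Sum>b\<in>A. gain_term j b M)" by (rule E_cong) (rule pot_step)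
  also have "\<dots> = (\<Sum>b\<in>A. E (gain_term j b))" by (rule E_sum)
  also have "\<dots> \<ge> 0" by (intro sum_nonneg E_pos1[OF loc_gain_term assms] gain_term_nonneg)
  finally show ?thesis by simp
qed

lemma pot_excess: "Suc j \<le> N \<Longrightarrow> excess \<le> E (pot j)"
  by (induction j) (use pot_0_excess pot_mono in \<open>force+\<close>)

text \<open>A vertex contributes at most \<open>k\<close> to the potential, so a large potential
  forces many survivors.\<close>

lemma layer_mass: assumes "Suc j \<le> N"
  shows "excess \<le> real k * (\<Sum>a\<in>A. E (\<lambda>M. of_bool (a \<in> layer M j)))"
proof -
  have "E (pot j) = (\<Sum>a\<in>A. E (\<lambda>M. of_bool (a \<in> layer M j) * local_pot j a M))"
    unfolding pot_def by (rule E_sum)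
  also have "\<dots> \<le> (\<Sum>a\<in>A. E (\<lambda>M. real k * of_bool (a \<in> layer M j)))"
  proof (rule sum_mono)
    fix a assume a: "a \<in> A"
    show "E (\<lambda>M. of_bool (a \<in> layer M j) * local_pot j a M) \<le> E (\<lambda>M. real k * of_bool (a \<in> layer M j))"
    proof (rule E_le1[where n = "Suc j" and a = a])
      have 1: "loc {a} (Suc j) (\<lambda>M. a \<in> layer M j)" by (rule loc_mono[OF loc_layer]) auto
      have 2: "loc {a} (Suc j) (\<lambda>M. loops M a)" by (rule loc_loops) simp
      have "loc {a} (Suc j) (local_pot j a)"
        unfolding local_pot_def
        using loc_comp2[OF 2 loc_edges, where F = "\<lambda>x y. 2 * real (card x) + real (card y) / 2 - 3"] .
      thus "loc {a} (Suc j) (\<lambda>M. of_bool (a \<in> layer M j) * local_pot j a M)"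
        using loc_comp2[OF 1, where F = "\<lambda>x y. of_bool x * y"] by blast
      show "loc {a} (Suc j) (\<lambda>M. real k * of_bool (a \<in> layer M j))"
        using loc_comp[OF 1, where F = "\<lambda>x. real k * of_bool x"] .
      fix M assume M: "M \<in> packs"
      have "local_pot j a M \<le> real k"
        using card_loops_le[OF M, of a] card_edges_le[OF M a, of "layer M j"] kpos by (simp add: local_pot_def)
      thus "of_bool (a \<in> layer M j) * local_pot j a M \<le> real k * of_bool (a \<in> layer M j)" by simp
    qed (use assms a in auto)
  qed
  also have "\<dots> = real k * (\<Sum>a\<in>A. E (\<lambda>M. of_bool (a \<in> layer M j)))"
    by (simp only: E_cmult sum_distrib_left)
  finally show ?thesis using pot_excess[OF assms] by simp
qed

definition hub_mass :: "nat \<Rightarrow> real" where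
  "hub_mass h = (\<Sum>a\<in>A. E (\<lambda>M. of_bool (hub h M a)))"

text \<open>A vertex surviving \<open>h + 1\<close> rounds is a hub, or it has a loop and a hub as
  neighbour. Charging it to that neighbour costs a factor \<open>k\<close>. The charge is introduced
  locally at \<open>a\<close> and bounded locally at \<open>b\<close>.\<close>

lemma layer_hub_mass: assumes "Suc (Suc h) \<le> N"
  shows "(\<Sum>a\<in>A. E (\<lambda>M. of_bool (a \<in> layer M (Suc h)))) \<le> (real k + 1) * hub_mass h"
proof -
  define Q where "Q a b M \<longleftrightarrow> loops M a \<noteq> {} \<and> hub h M b \<and> a \<noteq> b \<and> (\<exists>S\<in>M. vs S = {a, b})" for a b M
  have locQ: "loc {a} (Suc h) (\<lambda>M. Q a b M)" for a b
  proof (rule locI)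
    fix M M' assume M: "M \<in> packs" "M' \<in> packs" and ag: "agree M M' (ball M {a} (Suc h))"
    have st: "star M' a = star M a" using locD[OF loc_star M ag] by simp
    have ex: "(\<exists>S\<in>K. vs S = {a, b}) \<longleftrightarrow> (\<exists>S\<in>star K a. vs S = {a, b})" for K by (auto simp: star_def)
    have hb: "hub h M' b = hub h M b" if S: "S \<in> star M a" "vs S = {a, b}" for S
    proof (rule hub_agree[OF agree_sub[OF ag]])
      have "b \<in> ball M {a} (Suc 0)" by (rule ball_step[OF _ S(1)]) (use S in auto)
      thus "ball M {b} h \<subseteq> ball M {a} (Suc h)" by (rule ball_sub) simp
    qed
    show "Q a b M' = Q a b M"
    proof (cases "\<exists>S\<in>star M a. vs S = {a, b}")
      case True
      then obtain S where "S \<in> star M a" "vs S = {a, b}" by blast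
      hence hb': "hub h M' b = hub h M b" by (rule hb)
      show ?thesis unfolding Q_def ex[of M] ex[of M'] st loops_cong[OF st] hb' by (rule refl)
    next
      case False
      thus ?thesis unfolding Q_def ex[of M] ex[of M'] st by (intro iffI; elim conjE; rule notE)
    qed
  qed
  have "(\<Sum>a\<in>A. E (\<lambda>M. of_bool (a \<in> layer M (Suc h)))) \<le>
      (\<Sum>a\<in>A. E (\<lambda>M. of_bool (hub h M a) + (\<Sum>b\<in>A. of_bool (Q a b M))))"
  proof (rule sum_mono)
    fix a assume a: "a \<in> A"
    show "E (\<lambda>M. of_bool (a \<in> layer M (Suc h))) \<le> E (\<lambda>M. of_bool (hub h M a) + (\<Sum>b\<in>A. of_bool (Q a b M)))"
    proof (rule E_le1[where n = "Suc h" and a = a])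
      show "loc {a} (Suc h) (\<lambda>M. of_bool (a \<in> layer M (Suc h)) :: real)" by (rule loc_comp[OF loc_layer])
      have "loc {a} (Suc h) (\<lambda>M. of_bool (hub h M a) :: real)"
        by (rule loc_comp[OF loc_mono[OF loc_hub]]) auto
      moreover have "loc {a} (Suc h) (\<lambda>M. \<Sum>b\<in>A. of_bool (Q a b M) :: real)"
        by (intro loc_sum loc_comp[OF locQ])
      ultimately show "loc {a} (Suc h) (\<lambda>M. of_bool (hub h M a) + (\<Sum>b\<in>A. of_bool (Q a b M)) :: real)"
        by (rule loc_comp2)
      fix M assume M: "M \<in> packs"
      have S0: "0 \<le> (\<Sum>b\<in>A. of_bool (Q a b M) :: real)" by (intro sum_nonneg) simp
      show "of_bool (a \<in> layer M (Suc h)) \<le> of_bool (hub h M a) + (\<Sum>b\<in>A. of_bool (Q a b M) :: real)"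
      proof (cases "a \<in> layer M (Suc h)")
        case True
        show ?thesis
        proof (cases "loops M a = {}")
          case nl: True
          have "hub h M a" using True nl layer_antimono[of h "Suc h" M] by (auto simp: hub_def)
          thus ?thesis using True S0 by simp
        next
          case False
          then obtain b where b: "b \<in> A" "Q a b M" using loop_neighbour[OF M True] by (auto simp: Q_def)
          have "of_bool (Q a b M) \<le> (\<Sum>b\<in>A. of_bool (Q a b M) :: real)"
            by (rule member_le_sum[OF b(1)]) (use fin_A in auto)
          thus ?thesis using b True by simp
        qed
      qed (use S0 in simp)
    qed (use assms a in auto)
  qed
  also have "\<dots> = hub_mass h + (\<Sum>a\<in>A. \<Sum>b\<in>A. E (\<lambda>M. of_bool (Q a b M)))"
    by (simp only: E_add E_sum sum.distrib hub_mass_def)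
  also have "(\<Sum>a\<in>A. \<Sum>b\<in>A. E (\<lambda>M. of_bool (Q a b M))) = (\<Sum>b\<in>A. E (\<lambda>M. \<Sum>a\<in>A. of_bool (Q a b M)))"
    by (subst sum.swap) (simp only: E_sum)
  also have "(\<Sum>b\<in>A. E (\<lambda>M. \<Sum>a\<in>A. of_bool (Q a b M))) \<le> (\<Sum>b\<in>A. E (\<lambda>M. real k * of_bool (hub h M b)))"
  proof (rule sum_mono)
    fix b assume b: "b \<in> A"
    show "E (\<lambda>M. \<Sum>a\<in>A. of_bool (Q a b M)) \<le> E (\<lambda>M. real k * of_bool (hub h M b))"
    proof (rule E_le1[where n = "Suc (Suc h)" and a = b])
      have "loc {b} (Suc 0 + Suc h) (\<lambda>M. \<Sum>a\<in>A. of_bool (Q a b M) :: real)"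
      proof (rule loc_near_sum)
        show "loc {a} (Suc h) (\<lambda>M. of_bool (Q a b M) :: real)" for a by (rule loc_comp[OF locQ])
        fix M a assume far: "a \<notin> ball M {b} (Suc 0)"
        have "\<not> Q a b M"
        proof
          assume "Q a b M"
          then obtain S where "S \<in> M" "vs S = {a, b}" by (auto simp: Q_def)
          thus False using far ball_step[of b M "{b}" 0 S a] by (auto simp: star_def)
        qed
        thus "of_bool (Q a b M) = (0 :: real)" by simp
      qed auto
      thus "loc {b} (Suc (Suc h)) (\<lambda>M. \<Sum>a\<in>A. of_bool (Q a b M) :: real)" by simp
      show "loc {b} (Suc (Suc h)) (\<lambda>M. real k * of_bool (hub h M b))"
        by (rule loc_comp[OF loc_mono[OF loc_hub]]) auto
      fix M assume M: "M \<in> packs"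
      have "card (A \<inter> {a. Q a b M}) \<le> (if hub h M b then k else 0)"
      proof (cases "hub h M b")
        case True
        \<comment> \<open>The map sends an edge at \<open>b\<close> to its other end, so
          \<open>b\<close> is charged at most once per set at \<open>b\<close>.\<close>
        have "A \<inter> {a. Q a b M} \<subseteq> (\<lambda>S. SOME a. a \<noteq> b \<and> vs S = {a, b}) ` star M b"
        proof
          fix a assume "a \<in> A \<inter> {a. Q a b M}"
          then obtain S where S: "S \<in> M" "vs S = {a, b}" "a \<noteq> b" by (auto simp: Q_def)
          have "(SOME a. a \<noteq> b \<and> vs S = {a, b}) = a"
            by (rule some_equality) (use S in \<open>auto simp: doubleton_eq_iff\<close>)
          moreover have "S \<in> star M b" using S by (simp add: star_def)
          ultimately show "a \<in> (\<lambda>S. SOME a. a \<noteq> b \<and> vs S = {a, b}) ` star M b"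
            by (rule image_eqI[OF sym])
        qed
        hence "card (A \<inter> {a. Q a b M}) \<le> card (star M b)" by (rule surj_card_le[OF fin_star[OF M]])
        thus ?thesis using card_star_le[OF M b] True by simp
      next
        case False
        hence "A \<inter> {a. Q a b M} = {}" by (auto simp: Q_def)
        thus ?thesis by simp
      qed
      thus "(\<Sum>a\<in>A. of_bool (Q a b M)) \<le> real k * of_bool (hub h M b)"
        using fin_A by (simp add: sum_of_bool_eq split: if_splits)
    qed (use assms b in auto)
  qed
  also have "(\<Sum>b\<in>A. E (\<lambda>M. real k * of_bool (hub h M b))) = real k * hub_mass h"
    by (simp only: E_cmult sum_distrib_left hub_mass_def)
  finally show ?thesis by (simp add: algebra_simps)
qed

lemma hub_mass_ge: assumes "Suc (Suc h) \<le> N"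
  shows "excess \<le> real k * (real k + 1) * hub_mass h"
proof -
  have "excess \<le> real k * (\<Sum>a\<in>A. E (\<lambda>M. of_bool (a \<in> layer M (Suc h))))"
    using layer_mass[OF assms] .
  also have "\<dots> \<le> real k * ((real k + 1) * hub_mass h)"
    using layer_hub_mass[OF assms] by (rule mult_left_mono) simp
  finally show ?thesis by (simp add: mult_ac)
qed

end


section \<open>Intersecting walks\<close>

definition hit :: "nat set set \<Rightarrow> nat set set \<Rightarrow> bool" where
  "hit Q Q' \<longleftrightarrow> (\<exists>S\<in>Q. \<exists>S'\<in>Q'. S \<inter> S' \<noteq> {})"

lemma hit_commute: "hit Q Q' = hit Q' Q"
  unfolding hit_def by (metis inf_commute)

lemma sum_swap_nested:
  "(\<Sum>u\<in>L. \<Sum>p\<in>P. \<Sum>v\<in>Q p. g u p v) = (\<Sum>p\<in>P. \<Sum>v\<in>Q p. \<Sum>u\<in>L. (g u p v :: real))"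
proof -
  have "(\<Sum>u\<in>L. \<Sum>p\<in>P. \<Sum>v\<in>Q p. g u p v) = (\<Sum>p\<in>P. \<Sum>u\<in>L. \<Sum>v\<in>Q p. g u p v)" by (rule sum.swap)
  also have "\<dots> = (\<Sum>p\<in>P. \<Sum>v\<in>Q p. \<Sum>u\<in>L. g u p v)" by (intro sum.cong refl) (rule sum.swap)
  finally show ?thesis .
qed

lemma sum_swap_nested2:
  "(\<Sum>u\<in>L. \<Sum>u'\<in>L'. \<Sum>p\<in>P. \<Sum>v\<in>Q p. g u u' p v) =
   (\<Sum>p\<in>P. \<Sum>v\<in>Q p. \<Sum>u\<in>L. \<Sum>u'\<in>L'. (g u u' p v :: real))"
proof -
  have "(\<Sum>u\<in>L. \<Sum>u'\<in>L'. \<Sum>p\<in>P. \<Sum>v\<in>Q p. g u u' p v) =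
      (\<Sum>u\<in>L. \<Sum>p\<in>P. \<Sum>v\<in>Q p. \<Sum>u'\<in>L'. g u u' p v)"
    by (intro sum.cong refl) (rule sum_swap_nested)
  also have "\<dots> = (\<Sum>p\<in>P. \<Sum>v\<in>Q p. \<Sum>u\<in>L. \<Sum>u'\<in>L'. g u u' p v)" by (rule sum_swap_nested)
  finally show ?thesis .
qed

lemma sum_product_const:
  "(\<Sum>u\<in>L. \<Sum>u'\<in>L'. X u * Y u' * (c :: real)) = (\<Sum>u\<in>L. X u) * (\<Sum>u'\<in>L'. Y u') * c"
  by (simp only: sum_product) (simp only: sum_distrib_right)

lemma geometric_two_thirds: "(\<Sum>t<n. (2/3 :: real) ^ t) \<le> 3"
proof -
  have "(\<Sum>t<n. (2/3 :: real) ^ t) = 3 - 3 * (2/3) ^ n" by (induction n) simp_all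
  thus ?thesis by simp
qed

context hub_tree
begin

lemma leaves_R: "leaves h M w J \<chi> i \<subseteq> R h" and fin_leaves: "finite (leaves h M w J \<chi> i)"
proof -
  show "leaves h M w J \<chi> i \<subseteq> R h" by (auto simp: leaves_def)
  thus "finite (leaves h M w J \<chi> i)" by (rule finite_subset[OF _ fin_R])
qed

lemma leaf_wt_nonneg: "u \<in> leaves h M w J \<chi> i \<Longrightarrow> 0 \<le> W h u"
  using wt_nonneg[of u h] subsetD[OF leaves_R] by simp

text \<open>Only one vertex at one depth has \<open>ups t v\<close> as its parent edge, so the union
  bound of \<open>path_mass\<close> collapses to one term.\<close>

lemma node_mass: assumes v: "v \<in> R (Suc t)" and t: "t < h"
  shows "(\<Sum>u\<in>R h. W h u * of_bool (ups t v \<in> pth h u)) \<le> W (Suc t) v"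
proof -
  have "(\<Sum>u\<in>R h. W h u * of_bool (ups t v \<in> pth h u)) \<le>
     (\<Sum>s<h. \<Sum>z\<in>R (Suc s). W (Suc s) z * of_bool (ups s z = ups t v))" by (rule path_mass) simp
  also have "\<dots> = (\<Sum>s<h. if s = t then W (Suc t) v else 0)"
  proof (rule sum.cong[OF refl])
    fix s
    show "(\<Sum>z\<in>R (Suc s). W (Suc s) z * of_bool (ups s z = ups t v)) = (if s = t then W (Suc t) v else 0)"
    proof (cases "s = t")
      case True
      have "(\<Sum>z\<in>R (Suc s). W (Suc s) z * of_bool (ups s z = ups t v)) = (\<Sum>z\<in>R (Suc t). if z = v then W (Suc t) v else 0)"
      proof (unfold True, rule sum.cong[OF refl])
        fix z assume z: "z \<in> R (Suc t)"
        show "W (Suc t) z * of_bool (ups t z = ups t v) = (if z = v then W (Suc t) v else 0)"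
          using ups_inj[OF z v] by (cases "z = v") auto
      qed
      thus ?thesis using True v fin_R by (simp add: sum.delta)
    next
      case False
      have "W (Suc s) z * of_bool (ups s z = ups t v) = 0" if z: "z \<in> R (Suc s)" for z
        using ups_inj[OF z v] False by auto
      thus ?thesis using False by (simp add: sum.neutral)
    qed
  qed
  also have "\<dots> = W (Suc t) v" using t by (simp add: sum.delta)
  finally show ?thesis .
qed

text \<open>At most \<open>card X\<close> members of the packing meet \<open>X\<close>, and each is
  the parent edge of at most one vertex of the level.\<close>

lemma node_hit: assumes X: "finite X" and t: "t < h"
  shows "(\<Sum>v\<in>R (Suc t). W (Suc t) v * of_bool (ups t v \<inter> X \<noteq> {})) \<le> real (card X) * (9 * (1/3) ^ Suc t)"
proof -
  let ?V = "{v \<in> R (Suc t). ups t v \<inter> X \<noteq> {}}"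
  have "(\<Sum>v\<in>R (Suc t). W (Suc t) v * of_bool (ups t v \<inter> X \<noteq> {})) = (\<Sum>v\<in>?V. W (Suc t) v)"
    using fin_R by (intro sum.mono_neutral_cong_right) auto
  also have "\<dots> \<le> (\<Sum>v\<in>?V. 9 * (1/3) ^ Suc t)"
    by (intro sum_mono wt_le_power) (use t in auto)
  also have "\<dots> = real (card ?V) * (9 * (1/3) ^ Suc t)" by simp
  also have "\<dots> \<le> real (card X) * (9 * (1/3) ^ Suc t)"
  proof -
    have "inj_on (ups t) ?V"
    proof (rule inj_onI)
      fix x y assume "x \<in> ?V" "y \<in> ?V" "ups t x = ups t y"
      thus "x = y" using ups_inj[of x t y t] by simp
    qed
    moreover have "ups t ` ?V \<subseteq> {S \<in> M. S \<inter> X \<noteq> {}}" using ups(1) by auto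
    moreover have "finite {S \<in> M. S \<inter> X \<noteq> {}}" using packsD(3)[OF M] by simp
    ultimately have "card ?V \<le> card {S \<in> M. S \<inter> X \<noteq> {}}" by (rule card_inj_on_le)
    hence "card ?V \<le> card X" using card_hitting_le[OF M X] by simp
    thus ?thesis by (intro mult_right_mono) auto
  qed
  finally show ?thesis .
qed

lemma up_C: "u \<in> R (Suc t) \<Longrightarrow> ups t u \<in> C"
  using ups(1) packsD(1)[OF M] by auto

lemma leaves_ge:
  assumes b: "b \<in> R (Suc 0)" and col: "coloured h M w J \<chi> i b"
  shows "1 / 3 \<le> (\<Sum>u\<in>leaves h M w J \<chi> i. W h u)"
proof -
  have "1 / 3 \<le> bmass h b" by (rule bmass_bounds(1)[OF b])
  also have "bmass h b = (\<Sum>u\<in>{u \<in> R h. br h u = b}. W h u)"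
    unfolding bmass_def using fin_R by (intro sum.mono_neutral_cong_right) auto
  also have "\<dots> \<le> (\<Sum>u\<in>leaves h M w J \<chi> i. W h u)"
    using col by (intro sum_mono2 fin_leaves leaf_wt_nonneg) (auto simp: leaves_def)
  finally show ?thesis .
qed

end

context packing_graph
begin

text \<open>The trees may come from different packings, so their sets can intersect freely. For
  fixed \<open>v'\<close> there are \<open>k\<close> elements to be hit, and the weights of the
  \<open>v'\<close> sum to at most \<open>k\<close>.\<close>

lemma node_pair:
  assumes T: "hub_tree k U C A h M w" and T': "hub_tree k U C A h M' w'" and t: "t < h" "t' < h"
  shows "(\<Sum>v\<in>level h M w (Suc t). \<Sum>v'\<in>level h M' w' (Suc t'). wt h M w (Suc t) v * wt h M' w' (Suc t') v' *
      of_bool (up h M w t v \<inter> up h M' w' t' v' \<noteq> {})) \<le> real k * real k * (9 * (1/3) ^ Suc t)"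
proof -
  interpret T: hub_tree k U C A h M w by (rule T)
  interpret T': hub_tree k U C A h M' w' by (rule T')
  have "(\<Sum>v\<in>level h M w (Suc t). \<Sum>v'\<in>level h M' w' (Suc t'). wt h M w (Suc t) v * wt h M' w' (Suc t') v' *
      of_bool (up h M w t v \<inter> up h M' w' t' v' \<noteq> {})) =
     (\<Sum>v'\<in>level h M' w' (Suc t'). wt h M' w' (Suc t') v' *
        (\<Sum>v\<in>level h M w (Suc t). wt h M w (Suc t) v * of_bool (up h M w t v \<inter> up h M' w' t' v' \<noteq> {})))"
    by (subst sum.swap) (simp add: sum_distrib_left mult_ac)
  also have "\<dots> \<le> (\<Sum>v'\<in>level h M' w' (Suc t'). wt h M' w' (Suc t') v' * (real k * (9 * (1/3) ^ Suc t)))"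
  proof (intro sum_mono mult_left_mono)
    fix v' assume v': "v' \<in> level h M' w' (Suc t')"
    have "up h M' w' t' v' \<in> C" by (rule T'.up_C[OF v'])
    thus "(\<Sum>v\<in>level h M w (Suc t). wt h M w (Suc t) v * of_bool (up h M w t v \<inter> up h M' w' t' v' \<noteq> {})) \<le> real k * (9 * (1/3) ^ Suc t)"
      using T.node_hit[OF fin_S t(1), of "up h M' w' t' v'"] card_C by simp
    show "0 \<le> wt h M' w' (Suc t') v'" using T'.wt_nonneg[OF v'] t by simp
  qed
  also have "\<dots> = (\<Sum>v'\<in>level h M' w' (Suc t'). wt h M' w' (Suc t') v') * (real k * (9 * (1/3) ^ Suc t))"
    by (rule sum_distrib_right[symmetric])
  also have "\<dots> \<le> real k * (real k * (9 * (1/3) ^ Suc t))"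
    using T'.level_mass[of "Suc t'"] t by (intro mult_right_mono) auto
  finally show ?thesis by (simp only: mult.assoc)
qed

text \<open>Sets within the first \<open>J\<close> levels have different colours, so an intersection
  needs depth at least \<open>J\<close> on one side. The union bound over pairs of depths converges
  because the weights decay exponentially in the larger depth.\<close>

lemma own_hub_hits:
  assumes T: "hub_tree k U C A h M w" and T': "hub_tree k U C A h M' w'" and i: "i \<noteq> i'"
  shows "(\<Sum>u\<in>leaves h M w J \<chi> i. \<Sum>u'\<in>leaves h M' w' J \<chi> i'. wt h M w h u * wt h M' w' h u' *
      of_bool (hit (path h M w h u) (path h M' w' h u'))) \<le> 27 * real k ^ 2 * (3/4) ^ J"
proof -
  interpret T: hub_tree k U C A h M w by (rule T)
  interpret T': hub_tree k U C A h M' w' by (rule T')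
  define far where "far t t' = (of_bool (J \<le> t \<or> J \<le> t') :: real)" for t t'
  define F where "F t v t' v' = far t t' * of_bool (up h M w t v \<inter> up h M' w' t' v' \<noteq> {})" for t v t' v'
  have F0: "0 \<le> F t v t' v'" for t v t' v' by (simp add: F_def far_def)
  have point: "of_bool (hit (path h M w h u) (path h M' w' h u')) \<le>
      (\<Sum>t<h. \<Sum>v\<in>T.R (Suc t). \<Sum>t'<h. \<Sum>v'\<in>T'.R (Suc t').
         of_bool (up h M w t v \<in> path h M w h u) * of_bool (up h M' w' t' v' \<in> path h M' w' h u') * F t v t' v')"
    (is "_ \<le> ?rhs") if u: "u \<in> leaves h M w J \<chi> i" and u': "u' \<in> leaves h M' w' J \<chi> i'" for u u'
  proof (cases "hit (path h M w h u) (path h M' w' h u')")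
    case False
    have "0 \<le> ?rhs" by (intro sum_nonneg mult_nonneg_nonneg F0) auto
    thus ?thesis using False by simp
  next
    case True
    then obtain S S' where S: "S \<in> path h M w h u" "S' \<in> path h M' w' h u'" "S \<inter> S' \<noteq> {}"
      by (auto simp: hit_def)
    have uR: "u \<in> T.R h" "u' \<in> T'.R h" using u u' by (auto simp: leaves_def)
    from T.path_node[OF S(1) uR(1)] obtain t v where
      t: "t < h" "v \<in> T.R (Suc t)" "S = up h M w t v" "branch h M w (Suc t) v = branch h M w h u" by blast
    from T'.path_node[OF S(2) uR(2)] obtain t' v' where
      t': "t' < h" "v' \<in> T'.R (Suc t')" "S' = up h M' w' t' v'" "branch h M' w' (Suc t') v' = branch h M' w' h u'" by blast
    have "J \<le> t \<or> J \<le> t'"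
    proof (rule ccontr)
      assume "\<not> (J \<le> t \<or> J \<le> t')"
      hence J: "t < J" "t' < J" by auto
      obtain x where x: "x \<in> S" "x \<in> S'" using S(3) by auto
      have "\<chi> x = i" using u J(1) t x(1) unfolding leaves_def coloured_def by blast
      moreover have "\<chi> x = i'" using u' J(2) t' x(2) unfolding leaves_def coloured_def by blast
      ultimately show False using i by simp
    qed
    hence one: "F t v t' v' = 1" using S(3) t(3) t'(3) by (simp add: F_def far_def)
    let ?g = "\<lambda>t v t' v'. of_bool (up h M w t v \<in> path h M w h u) * of_bool (up h M' w' t' v' \<in> path h M' w' h u') * F t v t' v'"
    have g0: "0 \<le> ?g t v t' v'" for t v t' v' by (intro mult_nonneg_nonneg F0) auto
    have "1 = ?g t v t' v'" using one S t(3) t'(3) by simp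
    also have "\<dots> \<le> (\<Sum>v'\<in>T'.R (Suc t'). ?g t v t' v')"
      by (rule member_le_sum[OF t'(2)]) (intro g0 T'.fin_R)+
    also have "\<dots> \<le> (\<Sum>t'<h. \<Sum>v'\<in>T'.R (Suc t'). ?g t v t' v')"
      by (rule member_le_sum[OF lessThan_iff[THEN iffD2, OF t'(1)], where f = "\<lambda>t'. \<Sum>v'\<in>T'.R (Suc t'). ?g t v t' v'"])
         (intro sum_nonneg g0 finite_lessThan)+
    also have "\<dots> \<le> (\<Sum>v\<in>T.R (Suc t). \<Sum>t'<h. \<Sum>v'\<in>T'.R (Suc t'). ?g t v t' v')"
      by (rule member_le_sum[OF t(2), where f = "\<lambda>v. \<Sum>t'<h. \<Sum>v'\<in>T'.R (Suc t'). ?g t v t' v'"])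
         (intro sum_nonneg g0 T.fin_R)+
    also have "\<dots> \<le> ?rhs"
      by (rule member_le_sum[OF lessThan_iff[THEN iffD2, OF t(1)], where f = "\<lambda>t. \<Sum>v\<in>T.R (Suc t). \<Sum>t'<h. \<Sum>v'\<in>T'.R (Suc t'). ?g t v t' v'"])
         (intro sum_nonneg g0 finite_lessThan)+
    finally show ?thesis using True by simp
  qed
  define L where "L = leaves h M w J \<chi> i"
  define L' where "L' = leaves h M' w' J \<chi> i'"
  define a where "a t v = (\<Sum>u\<in>L. wt h M w h u * of_bool (up h M w t v \<in> path h M w h u))" for t v
  define a' where "a' t v = (\<Sum>u\<in>L'. wt h M' w' h u * of_bool (up h M' w' t v \<in> path h M' w' h u))" for t v
  have a: "0 \<le> a t v" "a t v \<le> wt h M w (Suc t) v" if "v \<in> T.R (Suc t)" "t < h" for t v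
  proof -
    show "0 \<le> a t v" unfolding a_def L_def by (intro sum_nonneg mult_nonneg_nonneg T.leaf_wt_nonneg) auto
    have "a t v \<le> (\<Sum>u\<in>T.R h. wt h M w h u * of_bool (up h M w t v \<in> path h M w h u))"
      unfolding a_def L_def using T.fin_R T.leaves_R T.wt_nonneg by (intro sum_mono2) auto
    thus "a t v \<le> wt h M w (Suc t) v" using T.node_mass[OF that] by simp
  qed
  have a': "0 \<le> a' t v" "a' t v \<le> wt h M' w' (Suc t) v" if "v \<in> T'.R (Suc t)" "t < h" for t v
  proof -
    show "0 \<le> a' t v" unfolding a'_def L'_def by (intro sum_nonneg mult_nonneg_nonneg T'.leaf_wt_nonneg) auto
    have "a' t v \<le> (\<Sum>u\<in>T'.R h. wt h M' w' h u * of_bool (up h M' w' t v \<in> path h M' w' h u))"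
      unfolding a'_def L'_def using T'.fin_R T'.leaves_R T'.wt_nonneg by (intro sum_mono2) auto
    thus "a' t v \<le> wt h M' w' (Suc t) v" using T'.node_mass[OF that] by simp
  qed
  have "(\<Sum>u\<in>L. \<Sum>u'\<in>L'. wt h M w h u * wt h M' w' h u' * of_bool (hit (path h M w h u) (path h M' w' h u'))) \<le>
     (\<Sum>u\<in>L. \<Sum>u'\<in>L'. wt h M w h u * wt h M' w' h u' * (\<Sum>t<h. \<Sum>v\<in>T.R (Suc t). \<Sum>t'<h. \<Sum>v'\<in>T'.R (Suc t').
         of_bool (up h M w t v \<in> path h M w h u) * of_bool (up h M' w' t' v' \<in> path h M' w' h u') * F t v t' v'))"
    unfolding L_def L'_def
    by (intro sum_mono mult_left_mono point mult_nonneg_nonneg T.leaf_wt_nonneg T'.leaf_wt_nonneg)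
  also have "\<dots> = (\<Sum>t<h. \<Sum>v\<in>T.R (Suc t). \<Sum>t'<h. \<Sum>v'\<in>T'.R (Suc t'). a t v * a' t' v' * F t v t' v')"
  proof -
    define x where "x u t v = wt h M w h u * of_bool (up h M w t v \<in> path h M w h u)" for u t v
    define y where "y u' t' v' = wt h M' w' h u' * of_bool (up h M' w' t' v' \<in> path h M' w' h u')" for u' t' v'
    have "(\<Sum>u\<in>L. \<Sum>u'\<in>L'. wt h M w h u * wt h M' w' h u' * (\<Sum>t<h. \<Sum>v\<in>T.R (Suc t). \<Sum>t'<h. \<Sum>v'\<in>T'.R (Suc t').
         of_bool (up h M w t v \<in> path h M w h u) * of_bool (up h M' w' t' v' \<in> path h M' w' h u') * F t v t' v')) =
      (\<Sum>u\<in>L. \<Sum>u'\<in>L'. \<Sum>t<h. \<Sum>v\<in>T.R (Suc t). \<Sum>t'<h. \<Sum>v'\<in>T'.R (Suc t'). x u t v * y u' t' v' * F t v t' v')"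
      unfolding sum_distrib_left x_def y_def by (simp only: mult_ac)
    also have "\<dots> = (\<Sum>t<h. \<Sum>v\<in>T.R (Suc t). \<Sum>u\<in>L. \<Sum>u'\<in>L'. \<Sum>t'<h. \<Sum>v'\<in>T'.R (Suc t'). x u t v * y u' t' v' * F t v t' v')"
      by (rule sum_swap_nested2)
    also have "\<dots> = (\<Sum>t<h. \<Sum>v\<in>T.R (Suc t). \<Sum>t'<h. \<Sum>v'\<in>T'.R (Suc t'). \<Sum>u\<in>L. \<Sum>u'\<in>L'. x u t v * y u' t' v' * F t v t' v')"
      by (intro sum.cong refl) (rule sum_swap_nested2)
    also have "\<dots> = (\<Sum>t<h. \<Sum>v\<in>T.R (Suc t). \<Sum>t'<h. \<Sum>v'\<in>T'.R (Suc t'). a t v * a' t' v' * F t v t' v')"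
      by (intro sum.cong refl, unfold a_def a'_def x_def y_def, rule sum_product_const)
    finally show ?thesis .
  qed
  also have "\<dots> \<le> (\<Sum>t<h. \<Sum>v\<in>T.R (Suc t). \<Sum>t'<h. \<Sum>v'\<in>T'.R (Suc t'). wt h M w (Suc t) v * wt h M' w' (Suc t') v' * F t v t' v')"
  proof (intro sum_mono mult_right_mono F0)
    fix t v t' v' assume "t \<in> {..<h}" "v \<in> T.R (Suc t)" "t' \<in> {..<h}" "v' \<in> T'.R (Suc t')"
    thus "a t v * a' t' v' \<le> wt h M w (Suc t) v * wt h M' w' (Suc t') v'"
      using a[of v t] a'[of v' t'] by (intro mult_mono) auto
  qed
  also have "\<dots> = (\<Sum>t<h. \<Sum>t'<h. far t t' * (\<Sum>v\<in>T.R (Suc t). \<Sum>v'\<in>T'.R (Suc t'). wt h M w (Suc t) v * wt h M' w' (Suc t') v' *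
      of_bool (up h M w t v \<inter> up h M' w' t' v' \<noteq> {})))"
    unfolding F_def by (intro sum.cong refl, subst sum.swap) (simp add: sum_distrib_left mult_ac)
  also have "\<dots> \<le> (\<Sum>t<h. \<Sum>t'<h. 3 * real k ^ 2 * (3/4) ^ J * (2/3) ^ t * (2/3) ^ t')"
  proof (intro sum_mono)
    fix t t' assume t: "t \<in> {..<h}" "t' \<in> {..<h}"
    let ?B = "\<Sum>v\<in>T.R (Suc t). \<Sum>v'\<in>T'.R (Suc t'). wt h M w (Suc t) v * wt h M' w' (Suc t') v' *
      of_bool (up h M w t v \<inter> up h M' w' t' v' \<noteq> {})"
    have B1: "?B \<le> real k * real k * (9 * (1/3) ^ Suc t)" using node_pair[OF T T'] t by simp
    \<comment> \<open>By symmetry the decay may be taken at the depth in either tree.\<close>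
    have "?B = (\<Sum>v'\<in>T'.R (Suc t'). \<Sum>v\<in>T.R (Suc t). wt h M' w' (Suc t') v' * wt h M w (Suc t) v *
      of_bool (up h M' w' t' v' \<inter> up h M w t v \<noteq> {}))"
      by (subst sum.swap) (simp add: Int_commute mult_ac)
    hence B2: "?B \<le> real k * real k * (9 * (1/3) ^ Suc t')" using node_pair[OF T' T] t by simp
    \<comment> \<open>Splitting \<open>1/3 = 3/4 * 2/3 * 2/3\<close> turns decay in the larger depth
      into a factor for \<open>J\<close> and one geometric factor per depth. Each geometric sum is
      at most 3, which yields 27 in total.\<close>
    have pow: "real k * real k * (9 * (1/3) ^ Suc m) \<le> 3 * real k ^ 2 * (3/4) ^ J * (2/3) ^ t * (2/3) ^ t'"
      if m: "J \<le> m" "t \<le> m" "t' \<le> m" for m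
    proof -
      have "(1/3 :: real) ^ m = ((3/4) * ((2/3) * (2/3))) ^ m" by (simp add: power_divide)
      also have "\<dots> = (3/4) ^ m * ((2/3) ^ m * (2/3) ^ m)" by (simp only: power_mult_distrib)
      also have "\<dots> \<le> (3/4) ^ J * ((2/3) ^ t * (2/3) ^ t')"
        using m by (intro mult_mono power_decreasing) auto
      finally have "3 * real k ^ 2 * (1/3) ^ m \<le> 3 * real k ^ 2 * ((3/4) ^ J * ((2/3) ^ t * (2/3) ^ t'))"
        by (rule mult_left_mono) simp
      thus ?thesis by (simp add: power2_eq_square mult_ac)
    qed
    have rhs0: "0 \<le> 3 * real k ^ 2 * (3/4) ^ J * (2/3) ^ t * (2/3) ^ t'" by simp
    show "far t t' * ?B \<le> 3 * real k ^ 2 * (3/4) ^ J * (2/3) ^ t * (2/3) ^ t'"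
    proof (cases "J \<le> t \<or> J \<le> t'")
      case True
      hence "?B \<le> 3 * real k ^ 2 * (3/4) ^ J * (2/3) ^ t * (2/3) ^ t'"
        using order_trans[OF B1 pow[of t]] order_trans[OF B2 pow[of t']] by (cases "t \<le> t'") auto
      thus ?thesis using True by (simp add: far_def)
    next
      case False
      thus ?thesis using rhs0 by (simp add: far_def)
    qed
  qed
  also have "\<dots> = 3 * real k ^ 2 * (3/4) ^ J * ((\<Sum>t<h. (2/3) ^ t) * (\<Sum>t'<h. (2/3) ^ t'))"
    by (simp add: sum_product sum_distrib_left mult_ac)
  also have "\<dots> \<le> 3 * real k ^ 2 * (3/4) ^ J * (3 * 3)"
    by (intro mult_left_mono mult_mono geometric_two_thirds sum_nonneg) auto
  finally show ?thesis unfolding L_def L'_def by simp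
qed

end


section \<open>Colours and slots\<close>

locale slot_setup = gap +
  fixes h J :: nat
  assumes h0: "0 < h" and J: "1 \<le> J" "J \<le> h" and hN: "3 * h + 3 \<le> N"
begin

declare branch.simps(2) [simp del] path.simps(2) [simp del]

definition rainbow :: "(nat \<Rightarrow> nat) \<Rightarrow> nat set \<Rightarrow> nat set set \<Rightarrow> bool" where
  "rainbow \<chi> w M \<longleftrightarrow> hub h M w \<and> (\<forall>i<3. \<exists>b\<in>level h M w (Suc 0). coloured h M w J \<chi> i b)"

text \<open>Bounds the number of elements covered by the first \<open>J\<close> levels of a tree.\<close>

definition near_bound :: nat where
  "near_bound = k * (\<Sum>t<J. k ^ Suc t)"

definition colourings :: "(nat \<Rightarrow> nat) set" where
  "colourings = U \<rightarrow>\<^sub>E {..<3}"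

lemma loc_rainbow: "loc {w} h (rainbow \<chi> w)"
proof (rule locI)
  fix M M' assume ag: "agree M M' (ball M {w} h)"
  have "level h M' w (Suc 0) = level h M w (Suc 0)" using tree_agree[OF ag, of "Suc 0"] h0 by simp
  thus "rainbow \<chi> w M' = rainbow \<chi> w M"
    unfolding rainbow_def hub_agree[OF ag] coloured_agree[OF ag J(2)] by simp
qed

lemma fin_colourings: "finite colourings" and card_colourings: "card colourings = 3 ^ card U"
  unfolding colourings_def using fin_U by (auto intro: finite_PiE simp: card_funcsetE)

text \<open>Sets in different branches are different members of a packing, hence disjoint, so
  colours can be prescribed on three branches without conflict. The remaining elements stay
  free.\<close>

lemma colour_count:
  assumes M: "M \<in> packs" and hb: "hub h M w"
  shows "3 ^ card U \<le> 3 ^ near_bound * card {\<chi> \<in> colourings. rainbow \<chi> w M}"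
proof -
  interpret T: hub_tree k U C A h M w using tree_locale[OF M hb h0] .
  obtain b where b: "b ` {..<3::nat} \<subseteq> T.R (Suc 0)" "inj_on b {..<3}"
    using card_le_inj[of "{..<3::nat}" "T.R (Suc 0)"] T.card_branches T.fin_R by auto
  define X where "X i = {x. \<exists>t<J. \<exists>v\<in>T.R (Suc t). branch h M w (Suc t) v = b i \<and> x \<in> up h M w t v}" for i
  define Y where "Y = (\<Union>i\<in>{..<3::nat}. X i)"
  define g where "g x = (SOME i. i < 3 \<and> x \<in> X i)" for x
  have same: "i = j" if ij: "i < 3" "j < 3" "x \<in> X i" "x \<in> X j" for i j x
  proof -
    obtain t v where v: "v \<in> T.R (Suc t)" "branch h M w (Suc t) v = b i" "x \<in> up h M w t v"
      using ij(3) unfolding X_def by blast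
    obtain s z where z: "z \<in> T.R (Suc s)" "branch h M w (Suc s) z = b j" "x \<in> up h M w s z"
      using ij(4) unfolding X_def by blast
    have "up h M w t v = up h M w s z"
    proof (rule ccontr)
      assume "up h M w t v \<noteq> up h M w s z"
      hence "up h M w t v \<inter> up h M w s z = {}"
        using packsD(2)[OF M] T.ups(1)[OF v(1)] T.ups(1)[OF z(1)] unfolding disjoint_def by simp
      thus False using v(3) z(3) by auto
    qed
    hence "v = z \<and> t = s" by (rule T.ups_inj[OF v(1) z(1)])
    hence "b i = b j" using v(2) z(2) by simp
    thus ?thesis using inj_onD[OF b(2)] ij(1,2) by simp
  qed
  have g: "g x = i" if "i < 3" "x \<in> X i" for i x
    unfolding g_def
  proof (rule some_equality)
    show "i < 3 \<and> x \<in> X i" using that ..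
    fix j assume "j < 3 \<and> x \<in> X j"
    thus "j = i" using same[of j i x] that by simp
  qed
  have Ysub: "Y \<subseteq> (\<Union>t<J. \<Union>v\<in>T.R (Suc t). up h M w t v)" by (auto simp: Y_def X_def)
  have upU: "up h M w t v \<subseteq> U" "card (up h M w t v) = k" if "v \<in> T.R (Suc t)" for t v
    using C_sub[OF T.up_C[OF that]] card_C[OF T.up_C[OF that]] by auto
  have YU: "Y \<subseteq> U"
  proof -
    have "(\<Union>t<J. \<Union>v\<in>T.R (Suc t). up h M w t v) \<subseteq> U" using upU(1) by (intro UN_least)
    thus ?thesis using Ysub by (rule order_trans[rotated])
  qed
  have fY: "finite Y" using finite_subset[OF YU fin_U] .
  have "card Y \<le> card (\<Union>t<J. \<Union>v\<in>T.R (Suc t). up h M w t v)"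
    by (rule card_mono[OF finite_subset[OF _ fin_U] Ysub]) (use upU(1) in blast)
  also have "\<dots> \<le> (\<Sum>t<J. card (\<Union>v\<in>T.R (Suc t). up h M w t v))" by (rule card_UN_le) simp
  also have "\<dots> \<le> (\<Sum>t<J. k ^ Suc t * k)"
  proof (rule sum_mono)
    fix t assume t: "t \<in> {..<J}"
    have "card (\<Union>v\<in>T.R (Suc t). up h M w t v) \<le> (\<Sum>v\<in>T.R (Suc t). card (up h M w t v))"
      by (rule card_UN_le[OF T.fin_R])
    also have "\<dots> = card (T.R (Suc t)) * k" using upU(2) by simp
    also have "\<dots> \<le> k ^ Suc t * k"
      using T.card_level[of "Suc t"] t J by (intro mult_right_mono) auto
    finally show "card (\<Union>v\<in>T.R (Suc t). up h M w t v) \<le> k ^ Suc t * k" .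
  qed
  also have "\<dots> = near_bound" by (simp add: near_bound_def sum_distrib_left mult_ac)
  finally have cY: "card Y \<le> near_bound" .
  let ?P = "PiE U (\<lambda>x. if x \<in> Y then {g x} else {..<3::nat})"
  have sub: "?P \<subseteq> {\<chi> \<in> colourings. rainbow \<chi> w M}"
  proof
    fix \<chi> assume \<chi>: "\<chi> \<in> ?P"
    have val: "\<chi> x = i" if "i < 3" "x \<in> X i" for x i
    proof -
      have "x \<in> Y" using that by (auto simp: Y_def)
      thus ?thesis using PiE_mem[OF \<chi>, of x] YU g[OF that] by auto
    qed
    have "g x < 3" if "x \<in> Y" for x
      using that g by (auto simp: Y_def)
    hence "\<chi> \<in> colourings" unfolding colourings_def using \<chi>
      by (intro PiE_I) (auto simp: PiE_iff extensional_def split: if_splits)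
    moreover have "rainbow \<chi> w M"
      unfolding rainbow_def
    proof (intro conjI allI impI hb)
      fix i :: nat assume i: "i < 3"
      have "b i \<in> T.R (Suc 0)" using b(1) i by auto
      moreover have "coloured h M w J \<chi> i (b i)"
        unfolding coloured_def using val[OF i] by (auto simp: X_def)
      ultimately show "\<exists>b\<in>T.R (Suc 0). coloured h M w J \<chi> i b" by blast
    qed
    ultimately show "\<chi> \<in> {\<chi> \<in> colourings. rainbow \<chi> w M}" by simp
  qed
  have "card ?P = (\<Prod>x\<in>U. if x \<in> Y then 1 else 3)"
    unfolding card_PiE[OF fin_U] by (intro prod.cong) auto
  also have "\<dots> = (\<Prod>x\<in>U - Y. 3)"
    using fin_U by (intro prod.mono_neutral_cong_right) auto
  also have "\<dots> = 3 ^ (card U - card Y)" using YU fY by (simp add: card_Diff_subset)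
  finally have "card ?P = 3 ^ (card U - card Y)" .
  hence ge: "3 ^ (card U - card Y) \<le> card {\<chi> \<in> colourings. rainbow \<chi> w M}"
    using card_mono[OF _ sub] fin_colourings by simp
  have "(3::nat) ^ card U = 3 ^ card Y * 3 ^ (card U - card Y)"
    using card_mono[OF fin_U YU] by (simp flip: power_add)
  also have "\<dots> \<le> 3 ^ near_bound * card {\<chi> \<in> colourings. rainbow \<chi> w M}"
    using ge cY by (intro mult_le_mono power_increasing) auto
  finally show ?thesis .
qed

text \<open>An average over all colourings of the universe: for every packing and hub at least the
  fraction \<open>3^-near_bound\<close> of them is rainbow, so one colouring, the same for all
  packings, attains the average.\<close>

lemma exists_colouring:
  "\<exists>\<chi>. hub_mass h / 3 ^ near_bound \<le> (\<Sum>w\<in>A. E (\<lambda>M. of_bool (rainbow \<chi> w M)))"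
proof (rule ccontr)
  assume neg: "\<nexists>\<chi>. hub_mass h / 3 ^ near_bound \<le> (\<Sum>w\<in>A. E (\<lambda>M. of_bool (rainbow \<chi> w M)))"
  let ?c = "(3::real) ^ card U / 3 ^ near_bound"
  have "?c * hub_mass h \<le> (\<Sum>w\<in>A. E (\<lambda>M. \<Sum>\<chi>\<in>colourings. of_bool (rainbow \<chi> w M)))"
    unfolding hub_mass_def sum_distrib_left E_cmult[symmetric]
  proof (rule sum_mono)
    fix w assume w: "w \<in> A"
    show "E (\<lambda>M. ?c * of_bool (hub h M w)) \<le> E (\<lambda>M. \<Sum>\<chi>\<in>colourings. of_bool (rainbow \<chi> w M))"
    proof (rule E_le1[OF _ _ _ w])
      show "loc {w} h (\<lambda>M. ?c * of_bool (hub h M w))" by (rule loc_comp[OF loc_hub])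
      show "loc {w} h (\<lambda>M. \<Sum>\<chi>\<in>colourings. of_bool (rainbow \<chi> w M) :: real)"
        by (intro loc_sum loc_comp[OF loc_rainbow])
      fix M assume M: "M \<in> packs"
      have cnt: "(\<Sum>\<chi>\<in>colourings. of_bool (rainbow \<chi> w M) :: real) = real (card {\<chi> \<in> colourings. rainbow \<chi> w M})"
        using fin_colourings by (simp add: sum_of_bool_eq Int_def)
      show "?c * of_bool (hub h M w) \<le> (\<Sum>\<chi>\<in>colourings. of_bool (rainbow \<chi> w M) :: real)"
      proof (cases "hub h M w")
        case True
        have "real (3 ^ card U) \<le> real (3 ^ near_bound * card {\<chi> \<in> colourings. rainbow \<chi> w M})"
          using colour_count[OF M True] by (simp only: of_nat_le_iff)
        hence "?c \<le> real (card {\<chi> \<in> colourings. rainbow \<chi> w M})" by (simp add: field_simps)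
        thus ?thesis unfolding cnt using True by simp
      qed (simp add: sum_nonneg)
    qed (use hN in simp)
  qed
  also have "\<dots> = (\<Sum>\<chi>\<in>colourings. \<Sum>w\<in>A. E (\<lambda>M. of_bool (rainbow \<chi> w M)))"
    unfolding E_sum by (rule sum.swap)
  also have "\<dots> < (\<Sum>\<chi>\<in>colourings. hub_mass h / 3 ^ near_bound)"
  proof (rule sum_strict_mono[OF fin_colourings])
    have "card colourings \<noteq> 0" unfolding card_colourings by simp
    thus "colourings \<noteq> {}" by auto
    show "(\<Sum>w\<in>A. E (\<lambda>M. of_bool (rainbow \<chi> w M))) < hub_mass h / 3 ^ near_bound" for \<chi>
      using neg by (meson not_le)
  qed
  also have "\<dots> = ?c * hub_mass h" by (simp add: card_colourings)
  finally show False by simp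
qed

end

section \<open>Conditioned walks and their pairwise intersections\<close>

locale slots = slot_setup +
  fixes \<chi> :: "nat \<Rightarrow> nat" and \<delta> :: real
  assumes \<delta>: "0 < \<delta>"
begin

text \<open>Here all three slots have mass bounded below, so that conditioning on a slot loses only
  a constant factor.\<close>

definition good :: "nat set set" where
  "good = {w \<in> A. \<delta> \<le> E (\<lambda>M. of_bool (rainbow \<chi> w M))}"

abbreviation sl :: "nat set \<times> nat \<Rightarrow> (nat set \<Rightarrow> nat set set \<Rightarrow> real) \<Rightarrow> nat set set \<Rightarrow> real" where
  "sl \<sigma> \<equiv> slot_sum h J \<chi> (fst \<sigma>) (snd \<sigma>)"

definition slot_mass :: "nat set \<times> nat \<Rightarrow> real" where
  "slot_mass \<sigma> = E (sl \<sigma> (\<lambda>_ _. 1))"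

text \<open>A conditional pseudo-expectation: a packing from \<open>t\<close>, then a leaf of the
  slot by weight.\<close>

definition Pr :: "nat set \<times> nat \<Rightarrow> (nat set \<Rightarrow> nat set set \<Rightarrow> real) \<Rightarrow> real" where
  "Pr \<sigma> F = E (sl \<sigma> F) / slot_mass \<sigma>"

definition slotset :: "(nat set \<times> nat) set" where
  "slotset = good \<times> {..<3}"

lemma good_A: "good \<subseteq> A" and fin_good: "finite good"
  using fin_A by (auto simp: good_def)

lemma slotD: "\<sigma> \<in> slotset \<Longrightarrow> fst \<sigma> \<in> good" "\<sigma> \<in> slotset \<Longrightarrow> fst \<sigma> \<in> A" "\<sigma> \<in> slotset \<Longrightarrow> snd \<sigma> < 3"
  using good_A by (auto simp: slotset_def)

lemma loc_sl: "loc {fst \<sigma>} h (sl \<sigma> F)"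
  by (rule loc_slot_sum[OF h0 J(2)])

lemma hle: "h \<le> N"
  using hN by simp

lemma sl_add: "sl \<sigma> (\<lambda>u Q. F u Q + F' u Q) M = sl \<sigma> F M + sl \<sigma> F' M"
  by (simp add: slot_sum_def distrib_left sum.distrib)

lemma sl_cmult: "sl \<sigma> (\<lambda>u Q. c * F u Q) M = c * sl \<sigma> F M"
  by (simp add: slot_sum_def sum_distrib_left mult_ac)

lemma sl_sum: "sl \<sigma> (\<lambda>u Q. \<Sum>i\<in>I. F i u Q) M = (\<Sum>i\<in>I. sl \<sigma> (F i) M)"
  unfolding slot_sum_def sum_distrib_left by (subst sum.swap) (rule refl)

lemma sl_mono:
  assumes M: "M \<in> packs" and le: "\<And>u Q. Q \<in> packs \<Longrightarrow> Q \<subseteq> M \<Longrightarrow> card Q \<le> h \<Longrightarrow> F u Q \<le> F' u Q"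
  shows "sl \<sigma> F M \<le> sl \<sigma> F' M"
proof (cases "hub h M (fst \<sigma>)")
  case True
  interpret T: hub_tree k U C A h M "fst \<sigma>" using tree_locale[OF M True h0] .
  have le1: "T.W h u * F u (T.pth h u) \<le> T.W h u * F' u (T.pth h u)" if u: "u \<in> leaves h M (fst \<sigma>) J \<chi> (snd \<sigma>)" for u
  proof (rule mult_left_mono[OF le T.leaf_wt_nonneg[OF u]])
    show "T.pth h u \<subseteq> M" using T.path_M u T.leaves_R by blast
    thus "T.pth h u \<in> packs" by (rule packs_sub[OF M])
    show "card (T.pth h u) \<le> h" by (rule T.card_path)
  qed
  show ?thesis unfolding slot_sum_def by (rule mult_left_mono[OF sum_mono[OF le1]]) simp_all
qed (simp add: slot_sum_def)

lemma sl_nonneg: "M \<in> packs \<Longrightarrow> (\<And>u Q. Q \<in> packs \<Longrightarrow> Q \<subseteq> M \<Longrightarrow> card Q \<le> h \<Longrightarrow> 0 \<le> F u Q) \<Longrightarrow> 0 \<le> sl \<sigma> F M"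
  using sl_mono[of M "\<lambda>_ _. 0" F \<sigma>] by (simp add: slot_sum_def)

lemma sl_coloured:
  assumes M: "M \<in> packs" and hb: "hub h M (fst \<sigma>)"
    and b: "b \<in> level h M (fst \<sigma>) (Suc 0)" "coloured h M (fst \<sigma>) J \<chi> (snd \<sigma>) b"
  shows "1 / 3 \<le> sl \<sigma> (\<lambda>_ _. 1) M"
proof -
  interpret T: hub_tree k U C A h M "fst \<sigma>" using tree_locale[OF M hb h0] .
  show ?thesis using T.leaves_ge[OF b] hb by (simp add: slot_sum_def)
qed

text \<open>A rainbow packing has a branch of the required colour, whose leaves carry at least
  1/3.\<close>

lemma slot_mass_ge: assumes "\<sigma> \<in> slotset" shows "\<delta> / 3 \<le> slot_mass \<sigma>"
proof -
  note s = slotD[OF assms]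
  have "\<delta> / 3 \<le> (1/3) * E (\<lambda>M. of_bool (rainbow \<chi> (fst \<sigma>) M))" using s(1) by (simp add: good_def)
  also have "\<dots> = E (\<lambda>M. (1/3) * of_bool (rainbow \<chi> (fst \<sigma>) M))" by (rule E_cmult[symmetric])
  also have "\<dots> \<le> slot_mass \<sigma>"
    unfolding slot_mass_def
  proof (rule E_le1[OF _ loc_sl hle s(2)])
    show "loc {fst \<sigma>} h (\<lambda>M. (1/3) * of_bool (rainbow \<chi> (fst \<sigma>) M) :: real)" by (rule loc_comp[OF loc_rainbow])
    fix M assume M: "M \<in> packs"
    show "(1/3) * of_bool (rainbow \<chi> (fst \<sigma>) M) \<le> sl \<sigma> (\<lambda>_ _. 1) M"
    proof (cases "rainbow \<chi> (fst \<sigma>) M")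
      case True
      then obtain b where b: "b \<in> level h M (fst \<sigma>) (Suc 0)" "coloured h M (fst \<sigma>) J \<chi> (snd \<sigma>) b"
        using s(3) unfolding rainbow_def by blast
      have "hub h M (fst \<sigma>)" using True by (simp add: rainbow_def)
      thus ?thesis using sl_coloured[OF M _ b] True by simp
    next
      case False
      thus ?thesis using sl_nonneg[OF M] by simp
    qed
  qed
  finally show ?thesis .
qed

lemma slot_mass_pos: "\<sigma> \<in> slotset \<Longrightarrow> 0 < slot_mass \<sigma>"
  using slot_mass_ge[of \<sigma>] \<delta> by linarith

lemma Pr_add: "Pr \<sigma> (\<lambda>u Q. F u Q + F' u Q) = Pr \<sigma> F + Pr \<sigma> F'"
proof -
  have "E (sl \<sigma> (\<lambda>u Q. F u Q + F' u Q)) = E (sl \<sigma> F) + E (sl \<sigma> F')"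
    unfolding E_add[symmetric] by (rule E_cong) (rule sl_add)
  thus ?thesis by (simp add: Pr_def add_divide_distrib)
qed

lemma Pr_cmult: "Pr \<sigma> (\<lambda>u Q. c * F u Q) = c * Pr \<sigma> F"
proof -
  have "E (sl \<sigma> (\<lambda>u Q. c * F u Q)) = c * E (sl \<sigma> F)"
    unfolding E_cmult[symmetric] by (rule E_cong) (rule sl_cmult)
  thus ?thesis by (simp add: Pr_def)
qed

lemma Pr_sum: "Pr \<sigma> (\<lambda>u Q. \<Sum>i\<in>I. F i u Q) = (\<Sum>i\<in>I. Pr \<sigma> (F i))"
proof -
  have "E (sl \<sigma> (\<lambda>u Q. \<Sum>i\<in>I. F i u Q)) = (\<Sum>i\<in>I. E (sl \<sigma> (F i)))"
    unfolding E_sum[symmetric] by (rule E_cong) (rule sl_sum)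
  thus ?thesis by (simp add: Pr_def sum_divide_distrib)
qed

lemma Pr_const: "\<sigma> \<in> slotset \<Longrightarrow> Pr \<sigma> (\<lambda>_ _. c) = c"
  using Pr_cmult[of \<sigma> c "\<lambda>_ _. 1"] slot_mass_pos[of \<sigma>] by (simp add: Pr_def slot_mass_def)

lemma Pr_mono:
  assumes "\<sigma> \<in> slotset" "\<And>u Q. Q \<in> packs \<Longrightarrow> card Q \<le> h \<Longrightarrow> F u Q \<le> F' u Q"
  shows "Pr \<sigma> F \<le> Pr \<sigma> F'"
proof -
  have "E (sl \<sigma> F) \<le> E (sl \<sigma> F')"
    by (rule E_le1[OF loc_sl loc_sl hle slotD(2)[OF assms(1)]]) (rule sl_mono, assumption, rule assms(2))
  thus ?thesis unfolding Pr_def using slot_mass_pos[OF assms(1)] by (intro divide_right_mono) auto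
qed

lemma Pr_nonneg: "\<sigma> \<in> slotset \<Longrightarrow> (\<And>u Q. Q \<in> packs \<Longrightarrow> card Q \<le> h \<Longrightarrow> 0 \<le> F u Q) \<Longrightarrow> 0 \<le> Pr \<sigma> F"
  using Pr_mono[of \<sigma> "\<lambda>_ _. 0" F] Pr_const[of \<sigma> 0] by simp

text \<open>On each packing this is \<open>path_inflow\<close>. Walks through \<open>S\<close> start
  near \<open>S\<close>, which makes the sum over all hubs local.\<close>

lemma through_mass: assumes S: "S \<in> C"
  shows "(\<Sum>w\<in>A. E (sl (w, i) (\<lambda>_ Q. of_bool (S \<in> Q)))) \<le> real h * real k * mass S"
proof -
  have "(\<Sum>w\<in>A. E (sl (w, i) (\<lambda>_ Q. of_bool (S \<in> Q)))) = E (\<lambda>M. \<Sum>w\<in>A. sl (w, i) (\<lambda>_ Q. of_bool (S \<in> Q)) M)"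
    by (rule E_sum[symmetric])
  also have "\<dots> \<le> E (\<lambda>M. real h * real k * of_bool (S \<in> M))"
  proof (rule E_le[where n = "h + h" and X = "vs S"])
    have zero: "sl (w, i) (\<lambda>_ Q. of_bool (S \<in> Q)) M = 0" if M: "M \<in> packs" and far: "S \<notin> M \<or> w \<notin> ball M (vs S) h" for M w
    proof (cases "hub h M w")
      case True
      interpret T: hub_tree k U C A h M w using tree_locale[OF M True h0] .
      have "S \<notin> T.pth h u" if u: "u \<in> leaves h M w J \<chi> i" for u
      proof
        assume Sp: "S \<in> T.pth h u"
        have uR: "u \<in> T.R h" using u by (simp add: leaves_def)
        hence SM: "S \<in> M" using Sp T.path_M by blast
        from T.path_node[OF Sp uR] obtain t v where t: "t < h" "v \<in> T.R (Suc t)" "S = up h M w t v" by blast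
        have "w \<in> ball M {v} (Suc t)" by (rule level_adj_back[OF M True h0 t(2)])
        moreover have "v \<in> ball M (vs S) 0" using T.ups(3)[OF t(2)] t(3) by simp
        hence "ball M {v} (Suc t) \<subseteq> ball M (vs S) h" by (rule ball_sub) (use t(1) in simp)
        ultimately show False using far SM by blast
      qed
      thus ?thesis by (simp add: slot_sum_def)
    qed (simp add: slot_sum_def)
    show "loc (vs S) (h + h) (\<lambda>M. \<Sum>w\<in>A. sl (w, i) (\<lambda>_ Q. of_bool (S \<in> Q)) M)"
    proof (rule loc_near_sum)
      show "loc {w} h (sl (w, i) (\<lambda>_ Q. of_bool (S \<in> Q)))" for w using loc_sl[of "(w, i)"] by simp
    qed (use zero in auto)
    show "loc (vs S) (h + h) (\<lambda>M. real h * real k * of_bool (S \<in> M))"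
      by (rule loc_comp[OF loc_mem[OF S]])
    fix M assume M: "M \<in> packs"
    show "(\<Sum>w\<in>A. sl (w, i) (\<lambda>_ Q. of_bool (S \<in> Q)) M) \<le> real h * real k * of_bool (S \<in> M)"
    proof (cases "S \<in> M")
      case False
      thus ?thesis using zero[OF M] by simp
    next
      case True
      have "(\<Sum>w\<in>A. sl (w, i) (\<lambda>_ Q. of_bool (S \<in> Q)) M) =
          (\<Sum>w\<in>hubs h M. \<Sum>u\<in>leaves h M w J \<chi> i. wt h M w h u * of_bool (S \<in> path h M w h u))"
        using fin_A by (intro sum.mono_neutral_cong_right) (auto simp: hubs_def slot_sum_def)
      also have "\<dots> \<le> (\<Sum>w\<in>hubs h M. \<Sum>u\<in>level h M w h. wt h M w h u * of_bool (S \<in> path h M w h u))"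
      proof (rule sum_mono)
        fix w assume w: "w \<in> hubs h M"
        interpret T: hub_tree k U C A h M w using tree_locale[OF M _ h0] w by (simp add: hubs_def)
        show "(\<Sum>u\<in>leaves h M w J \<chi> i. wt h M w h u * of_bool (S \<in> path h M w h u)) \<le>
           (\<Sum>u\<in>level h M w h. wt h M w h u * of_bool (S \<in> path h M w h u))"
          using T.leaves_R T.fin_R T.wt_nonneg by (intro sum_mono2) auto
      qed
      also have "\<dots> \<le> real h * real k" by (rule path_inflow[OF M h0 S])
      finally show ?thesis using True by simp
    qed
  qed (use hN vs_A card_vs_le[OF S] in auto)
  also have "\<dots> = real h * real k * mass S" by (simp only: E_cmult mass_def)
  finally show ?thesis .
qed

text \<open>The factors: \<open>h k\<close> for the mass of the sets that meet a path of
  \<open>h\<close> sets, \<open>h k\<close> from \<open>through_mass\<close>, 3 slots at a hub, and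
  \<open>3 / \<delta>\<close> from the normalisation.\<close>

definition \<tau> :: real where
  "\<tau> = 9 * real h ^ 2 * real k ^ 2 / \<delta>"

lemma hit_le_sum: assumes "Q \<in> packs" "Q' \<in> packs"
  shows "of_bool (hit Q Q') \<le> (\<Sum>S\<in>Q. \<Sum>S'\<in>{S'\<in>C. S' \<inter> S \<noteq> {}}. (of_bool (S' \<in> Q') :: real))"
proof (cases "hit Q Q'")
  case True
  then obtain S S' where S: "S \<in> Q" "S' \<in> Q'" "S' \<inter> S \<noteq> {}" unfolding hit_def by blast
  have S'C: "S' \<in> {S'\<in>C. S' \<inter> S \<noteq> {}}" using S packsD(1)[OF assms(2)] by auto
  have "1 = (of_bool (S' \<in> Q') :: real)" using S by simp
  also have "\<dots> \<le> (\<Sum>S'\<in>{S'\<in>C. S' \<inter> S \<noteq> {}}. (of_bool (S' \<in> Q') :: real))"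
    by (rule member_le_sum[OF S'C]) (use fin_C in auto)
  also have "\<dots> \<le> (\<Sum>S\<in>Q. \<Sum>S'\<in>{S'\<in>C. S' \<inter> S \<noteq> {}}. (of_bool (S' \<in> Q') :: real))"
    by (rule member_le_sum[OF S(1), where f = "\<lambda>S. \<Sum>S'\<in>{S'\<in>C. S' \<inter> S \<noteq> {}}. (of_bool (S' \<in> Q') :: real)"])
       (use packsD(3)[OF assms(1)] in \<open>auto intro: sum_nonneg\<close>)
  finally show ?thesis by simp
qed (simp add: sum_nonneg)

lemma total_damage: assumes Q: "Q \<in> packs" "card Q \<le> h"
  shows "(\<Sum>\<sigma>\<in>slotset. Pr \<sigma> (\<lambda>_ Q'. of_bool (hit Q Q'))) \<le> \<tau>"
proof -
  have fQ: "finite Q" "Q \<subseteq> C" using packsD[OF Q(1)] by auto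
  let ?N = "\<lambda>S. {S'\<in>C. S' \<inter> S \<noteq> {}}"
  let ?e = "\<lambda>\<sigma> S'. E (sl \<sigma> (\<lambda>_ Q'. of_bool (S' \<in> Q')))"
  have "(\<Sum>\<sigma>\<in>slotset. Pr \<sigma> (\<lambda>_ Q'. of_bool (hit Q Q'))) \<le> (\<Sum>\<sigma>\<in>slotset. \<Sum>S\<in>Q. \<Sum>S'\<in>?N S. 3 / \<delta> * ?e \<sigma> S')"
  proof (rule sum_mono)
    fix \<sigma> assume \<sigma>: "\<sigma> \<in> slotset"
    have "Pr \<sigma> (\<lambda>_ Q'. of_bool (hit Q Q')) \<le> Pr \<sigma> (\<lambda>_ Q'. \<Sum>S\<in>Q. \<Sum>S'\<in>?N S. of_bool (S' \<in> Q'))"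
      by (rule Pr_mono[OF \<sigma>]) (rule hit_le_sum[OF Q(1)])
    also have "\<dots> = (\<Sum>S\<in>Q. \<Sum>S'\<in>?N S. Pr \<sigma> (\<lambda>_ Q'. of_bool (S' \<in> Q')))"
      by (simp only: Pr_sum)
    also have "\<dots> \<le> (\<Sum>S\<in>Q. \<Sum>S'\<in>?N S. 3 / \<delta> * ?e \<sigma> S')"
    proof (intro sum_mono)
      fix S S'
      have e0: "0 \<le> ?e \<sigma> S'"
        by (rule E_pos1[OF loc_sl hle slotD(2)[OF \<sigma>]]) (rule sl_nonneg, assumption, simp)
      have "?e \<sigma> S' / slot_mass \<sigma> \<le> ?e \<sigma> S' / (\<delta> / 3)"
        using slot_mass_ge[OF \<sigma>] e0 \<delta> by (intro divide_left_mono) auto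
      thus "Pr \<sigma> (\<lambda>_ Q'. of_bool (S' \<in> Q')) \<le> 3 / \<delta> * ?e \<sigma> S'" by (simp add: Pr_def mult.commute)
    qed
    finally show "Pr \<sigma> (\<lambda>_ Q'. of_bool (hit Q Q')) \<le> (\<Sum>S\<in>Q. \<Sum>S'\<in>?N S. 3 / \<delta> * ?e \<sigma> S')" .
  qed
  also have "\<dots> = (\<Sum>S\<in>Q. \<Sum>S'\<in>?N S. \<Sum>\<sigma>\<in>slotset. 3 / \<delta> * ?e \<sigma> S')"
    by (rule sum_swap_nested)
  also have "\<dots> \<le> (\<Sum>S\<in>Q. \<Sum>S'\<in>?N S. 9 / \<delta> * (real h * real k) * mass S')"
  proof (intro sum_mono)
    fix S S' assume "S \<in> Q" "S' \<in> ?N S"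
    hence S': "S' \<in> C" by simp
    have e0: "0 \<le> ?e (w, i) S'" if "w \<in> A" for w i
      by (rule E_pos1[OF loc_sl hle]) (use that in simp, rule sl_nonneg, assumption, simp)
    have "(\<Sum>\<sigma>\<in>slotset. ?e \<sigma> S') = (\<Sum>w\<in>good. \<Sum>i<3. ?e (w, i) S')"
      unfolding slotset_def by (subst sum.cartesian_product) (simp add: case_prod_beta)
    also have "\<dots> = (\<Sum>i<3. \<Sum>w\<in>good. ?e (w, i) S')" by (rule sum.swap)
    also have "\<dots> \<le> (\<Sum>i<(3::nat). real h * real k * mass S')"
    proof (rule sum_mono)
      fix i :: nat
      have "(\<Sum>w\<in>good. ?e (w, i) S') \<le> (\<Sum>w\<in>A. ?e (w, i) S')"
        using fin_A good_A e0 by (intro sum_mono2) auto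
      also have "\<dots> \<le> real h * real k * mass S'" by (rule through_mass[OF S'])
      finally show "(\<Sum>w\<in>good. ?e (w, i) S') \<le> real h * real k * mass S'" .
    qed
    also have "\<dots> = 3 * (real h * real k * mass S')" by simp
    finally have "3 / \<delta> * (\<Sum>\<sigma>\<in>slotset. ?e \<sigma> S') \<le> 3 / \<delta> * (3 * (real h * real k * mass S'))"
      using \<delta> by (intro mult_left_mono) auto
    also have "3 / \<delta> * (3 * (real h * real k * mass S')) = 9 / \<delta> * (real h * real k) * mass S'" by simp
    finally show "(\<Sum>\<sigma>\<in>slotset. 3 / \<delta> * ?e \<sigma> S') \<le> 9 / \<delta> * (real h * real k) * mass S'"
      unfolding sum_distrib_left .
  qed
  also have "\<dots> = 9 / \<delta> * (real h * real k) * (\<Sum>S\<in>Q. \<Sum>S'\<in>?N S. mass S')"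
    by (simp only: sum_distrib_left)
  also have "\<dots> \<le> 9 / \<delta> * (real h * real k) * (real h * real k)"
  proof (rule mult_left_mono)
    have "(\<Sum>S\<in>Q. \<Sum>S'\<in>?N S. mass S') \<le> (\<Sum>S\<in>Q. real k)"
    proof (rule sum_mono)
      fix S assume "S \<in> Q"
      hence "S \<in> C" using fQ by auto
      thus "(\<Sum>S'\<in>?N S. mass S') \<le> real k" using mass_hit[OF fin_S C_sub, of S] card_C[of S] by simp
    qed
    also have "\<dots> = real (card Q) * real k" by simp
    also have "\<dots> \<le> real h * real k" using Q(2) by (intro mult_right_mono) auto
    finally show "(\<Sum>S\<in>Q. \<Sum>S'\<in>?N S. mass S') \<le> real h * real k" .
  qed (use \<delta> in auto)
  also have "\<dots> = \<tau>" by (simp add: \<tau>_def power2_eq_square)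
  finally show ?thesis .
qed

text \<open>The two walks come from two independent copies of the pseudo-distribution, so each
  expectation is taken of a function local in its own packing.\<close>

definition pair :: "nat set \<times> nat \<Rightarrow> nat set \<times> nat \<Rightarrow> real" where
  "pair \<sigma> \<sigma>' = Pr \<sigma> (\<lambda>_ Q. Pr \<sigma>' (\<lambda>_ Q'. of_bool (hit Q Q')))"

definition slot2 :: "nat set \<times> nat \<Rightarrow> nat set \<times> nat \<Rightarrow> nat set set \<Rightarrow> nat set set \<Rightarrow> real" where
  "slot2 \<sigma> \<sigma>' M M' = sl \<sigma> (\<lambda>_ Q. sl \<sigma>' (\<lambda>_ Q'. of_bool (hit Q Q')) M') M"

lemma slot2_sum: "slot2 \<sigma> \<sigma>' M M' = of_bool (hub h M (fst \<sigma>)) * of_bool (hub h M' (fst \<sigma>')) *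
   (\<Sum>u\<in>leaves h M (fst \<sigma>) J \<chi> (snd \<sigma>). \<Sum>u'\<in>leaves h M' (fst \<sigma>') J \<chi> (snd \<sigma>').
     wt h M (fst \<sigma>) h u * wt h M' (fst \<sigma>') h u' * of_bool (hit (path h M (fst \<sigma>) h u) (path h M' (fst \<sigma>') h u')))"
  unfolding slot2_def slot_sum_def sum_distrib_left by (intro sum.cong refl) (simp add: mult_ac)

lemma slot2_commute: "slot2 \<sigma> \<sigma>' M M' = slot2 \<sigma>' \<sigma> M' M"
  unfolding slot2_sum by (subst sum.swap) (simp add: hit_commute mult_ac)

lemma pair_E: "pair \<sigma> \<sigma>' = E (\<lambda>M. E (\<lambda>M'. slot2 \<sigma> \<sigma>' M M')) / (slot_mass \<sigma> * slot_mass \<sigma>')"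
proof -
  have "sl \<sigma> (\<lambda>_ Q. Pr \<sigma>' (\<lambda>_ Q'. of_bool (hit Q Q'))) M = (1 / slot_mass \<sigma>') * E (\<lambda>M'. slot2 \<sigma> \<sigma>' M M')" for M
  proof -
    have "sl \<sigma> (\<lambda>_ Q. Pr \<sigma>' (\<lambda>_ Q'. of_bool (hit Q Q'))) M =
       sl \<sigma> (\<lambda>_ Q. (1 / slot_mass \<sigma>') * (\<Sum>M'\<in>packs. t M' * sl \<sigma>' (\<lambda>_ Q'. of_bool (hit Q Q')) M')) M"
      by (simp add: Pr_def E_def)
    also have "\<dots> = (1 / slot_mass \<sigma>') * (\<Sum>M'\<in>packs. t M' * slot2 \<sigma> \<sigma>' M M')"
      by (simp only: sl_cmult sl_sum slot2_def)
    finally show ?thesis by (simp add: E_def)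
  qed
  hence "E (sl \<sigma> (\<lambda>_ Q. Pr \<sigma>' (\<lambda>_ Q'. of_bool (hit Q Q')))) = (1 / slot_mass \<sigma>') * E (\<lambda>M. E (\<lambda>M'. slot2 \<sigma> \<sigma>' M M'))"
    unfolding E_cmult[symmetric] by (intro E_cong)
  thus ?thesis by (simp add: pair_def Pr_def mult.commute)
qed

lemma pair_commute: "pair \<sigma> \<sigma>' = pair \<sigma>' \<sigma>"
proof -
  have "E (\<lambda>M. E (\<lambda>M'. slot2 \<sigma> \<sigma>' M M')) = E (\<lambda>M'. E (\<lambda>M. slot2 \<sigma> \<sigma>' M M'))"
    unfolding E_def sum_distrib_left by (subst sum.swap) (simp add: mult_ac)
  also have "\<dots> = E (\<lambda>M'. E (\<lambda>M. slot2 \<sigma>' \<sigma> M' M))" by (simp only: slot2_commute[of \<sigma>])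
  finally show ?thesis unfolding pair_E by (simp add: mult.commute)
qed

lemma pair_nonneg: "\<sigma> \<in> slotset \<Longrightarrow> \<sigma>' \<in> slotset \<Longrightarrow> 0 \<le> pair \<sigma> \<sigma>'"
  unfolding pair_def by (intro Pr_nonneg) auto

definition \<kappa> :: real where
  "\<kappa> = 27 * real k ^ 2 * (3/4) ^ J"

text \<open>For each two packings the walks meet with weight at most \<open>\<kappa>\<close>, and
  wherever both slots occur their leaf sums are at least 1/3. So \<open>9 * \<kappa>\<close> times
  the product of the leaf sums is a pointwise bound, and it survives the normalisation.\<close>

lemma pair_own: assumes s: "(w, i) \<in> slotset" "(w, i') \<in> slotset" and i: "i \<noteq> i'"
  shows "pair (w, i) (w, i') \<le> 9 * \<kappa>"
proof -
  let ?s = "(w, i)" and ?s' = "(w, i')"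
  have wA: "w \<in> A" using slotD(2)[OF s(1)] by simp
  have k0: "0 \<le> \<kappa>" by (simp add: \<kappa>_def)
  have point: "slot2 ?s ?s' M M' \<le> 9 * \<kappa> * sl ?s (\<lambda>_ _. 1) M * sl ?s' (\<lambda>_ _. 1) M'" if M: "M \<in> packs" "M' \<in> packs" for M M'
  proof -
    let ?a = "sl ?s (\<lambda>_ _. 1) M" and ?b = "sl ?s' (\<lambda>_ _. 1) M'"
    have ab0: "0 \<le> ?a" "0 \<le> ?b" by (rule sl_nonneg[OF M(1)], simp, rule sl_nonneg[OF M(2)], simp)
    hence rhs0: "0 \<le> 9 * \<kappa> * ?a * ?b" using k0 by simp
    show ?thesis
    proof (cases "hub h M w \<and> hub h M' w \<and> leaves h M w J \<chi> i \<noteq> {} \<and> leaves h M' w J \<chi> i' \<noteq> {}")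
      case False
      hence "slot2 ?s ?s' M M' = 0" unfolding slot2_sum by auto
      thus ?thesis using rhs0 by simp
    next
      case True
      have T: "hub_tree k U C A h M w" "hub_tree k U C A h M' w" using tree_locale[OF M(1) _ h0] tree_locale[OF M(2) _ h0] True by auto
      interpret T: hub_tree k U C A h M w by (rule T)
      interpret T': hub_tree k U C A h M' w by (rule T)
      have "1/3 \<le> ?a"
      proof -
        obtain u where u: "u \<in> T.R h" "coloured h M w J \<chi> i (branch h M w h u)" using True by (auto simp: leaves_def)
        obtain h' where h': "h = Suc h'" using h0 by (cases h) auto
        have "branch h M w h u \<in> T.R (Suc 0)" using T.branch_level[of u h'] u(1) unfolding h' by simp
        thus ?thesis using sl_coloured[OF M(1), of ?s] u(2) True by simp
      qed
      moreover have "1/3 \<le> ?b"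
      proof -
        obtain u where u: "u \<in> T'.R h" "coloured h M' w J \<chi> i' (branch h M' w h u)" using True by (auto simp: leaves_def)
        obtain h' where h': "h = Suc h'" using h0 by (cases h) auto
        have "branch h M' w h u \<in> T'.R (Suc 0)" using T'.branch_level[of u h'] u(1) unfolding h' by simp
        thus ?thesis using sl_coloured[OF M(2), of ?s'] u(2) True by simp
      qed
      ultimately have "1/3 * (1/3) \<le> ?a * ?b" by (intro mult_mono) auto
      hence "9 * \<kappa> * (1/3 * (1/3)) \<le> 9 * \<kappa> * (?a * ?b)" using k0 by (intro mult_left_mono) auto
      moreover have "slot2 ?s ?s' M M' \<le> \<kappa>"
        unfolding slot2_sum \<kappa>_def using own_hub_hits[OF T i] True by simp
      ultimately show ?thesis by (simp add: mult.assoc)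
    qed
  qed
  have "E (\<lambda>M. E (\<lambda>M'. slot2 ?s ?s' M M')) \<le> E (\<lambda>M. 9 * \<kappa> * slot_mass ?s' * sl ?s (\<lambda>_ _. 1) M)"
  proof (rule E_le1[OF _ _ hle wA])
    show "loc {w} h (\<lambda>M. E (\<lambda>M'. slot2 ?s ?s' M M'))"
    proof (rule locI)
      fix M1 M2 assume M: "M1 \<in> packs" "M2 \<in> packs" and ag: "agree M1 M2 (ball M1 {w} h)"
      have "slot2 ?s ?s' M2 M' = slot2 ?s ?s' M1 M'" for M'
        unfolding slot2_def by (rule slot_sum_agree[OF _ M(1) h0 J(2)]) (use ag in simp)
      thus "E (\<lambda>M'. slot2 ?s ?s' M2 M') = E (\<lambda>M'. slot2 ?s ?s' M1 M')" by simp
    qed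
    show "loc {w} h (\<lambda>M. 9 * \<kappa> * slot_mass ?s' * sl ?s (\<lambda>_ _. 1) M)"
      using loc_comp[OF loc_sl[of ?s "\<lambda>_ _. 1"], of "\<lambda>x. 9 * \<kappa> * slot_mass ?s' * x"] by simp
    fix M assume M: "M \<in> packs"
    have "E (\<lambda>M'. slot2 ?s ?s' M M') \<le> E (\<lambda>M'. 9 * \<kappa> * sl ?s (\<lambda>_ _. 1) M * sl ?s' (\<lambda>_ _. 1) M')"
    proof (rule E_le1[OF _ _ hle wA])
      \<comment> \<open>By symmetry \<open>slot2\<close> is local in its second packing as
        well.\<close>
      have "slot2 ?s ?s' M = (\<lambda>M'. slot2 ?s' ?s M' M)" by (rule ext) (rule slot2_commute)
      thus "loc {w} h (slot2 ?s ?s' M)" unfolding slot2_def using loc_sl[of ?s'] by simp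
      show "loc {w} h (\<lambda>M'. 9 * \<kappa> * sl ?s (\<lambda>_ _. 1) M * sl ?s' (\<lambda>_ _. 1) M')"
        using loc_comp[OF loc_sl[of ?s' "\<lambda>_ _. 1"], of "\<lambda>x. 9 * \<kappa> * sl ?s (\<lambda>_ _. 1) M * x"] by simp
    qed (rule point[OF M])
    also have "\<dots> = 9 * \<kappa> * slot_mass ?s' * sl ?s (\<lambda>_ _. 1) M" by (simp only: E_cmult slot_mass_def mult_ac)
    finally show "E (\<lambda>M'. slot2 ?s ?s' M M') \<le> 9 * \<kappa> * slot_mass ?s' * sl ?s (\<lambda>_ _. 1) M" .
  qed
  also have "\<dots> = 9 * \<kappa> * (slot_mass ?s * slot_mass ?s')" by (simp only: E_cmult slot_mass_def[of ?s] mult_ac)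
  finally have "pair ?s ?s' \<le> 9 * \<kappa> * (slot_mass ?s * slot_mass ?s') / (slot_mass ?s * slot_mass ?s')"
    unfolding pair_E using slot_mass_pos[OF s(1)] slot_mass_pos[OF s(2)] by (intro divide_right_mono) auto
  thus ?thesis using slot_mass_pos[OF s(1)] slot_mass_pos[OF s(2)] by simp
qed

end


section \<open>Joining arms greedily\<close>

text \<open>Take a partition into \<open>q\<close> classes with least total interaction inside the
  classes. Moving \<open>x\<close> elsewhere does not help, so its own class costs it no more than
  the average class. A largest class then serves as \<open>W\<close>.\<close>

lemma sparse_class:
  fixes s :: "'a \<Rightarrow> 'a \<Rightarrow> real"
  assumes fin: "finite G" and q: "0 < q" and sym: "\<And>x y. s x y = s y x"
    and nonneg: "\<And>x y. x \<in> G \<Longrightarrow> y \<in> G \<Longrightarrow> 0 \<le> s x y"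
    and row: "\<And>x. x \<in> G \<Longrightarrow> (\<Sum>y\<in>G. s x y) \<le> T"
  shows "\<exists>W\<subseteq>G. card G \<le> q * card W \<and> (\<forall>x\<in>W. (\<Sum>y\<in>W - {x}. s x y) \<le> T / real q)"
proof -
  \<comment> \<open>The diagonal is dropped because \<open>x\<close> shares a class with itself in
    every partition.\<close>
  define s' where "s' x y = (if x = y then 0 else s x y)" for x y
  define cost where "cost c = (\<Sum>x\<in>G. \<Sum>y\<in>G. s' x y * of_bool (c x = c y))" for c :: "'a \<Rightarrow> nat"
  let ?F = "G \<rightarrow>\<^sub>E {..<q}"
  have fF: "finite ?F" using fin by (intro finite_PiE) auto
  have "?F \<noteq> {}" using q by (simp add: PiE_eq_empty_iff lessThan_empty_iff)
  then obtain c where c: "c \<in> ?F" and cmin: "\<And>c'. c' \<in> ?F \<Longrightarrow> cost c \<le> cost c'"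
    using arg_min_if_finite[OF fF, of cost] by (metis not_le)
  have own: "real q * (\<Sum>y\<in>G - {x}. s x y * of_bool (c y = c x)) \<le> T" if x: "x \<in> G" for x
  proof -
    let ?G = "G - {x}"
    let ?col = "\<lambda>j. \<Sum>y\<in>?G. s x y * of_bool (c y = j)"
    \<comment> \<open>Isolates the part of the cost that depends on the class of \<open>x\<close>;
      the factor 2 is the symmetry of \<open>s\<close>.\<close>
    have dec: "cost d = (\<Sum>z\<in>?G. \<Sum>y\<in>?G. s' z y * of_bool (d z = d y)) + 2 * (\<Sum>y\<in>?G. s x y * of_bool (d y = d x))"
      for d
    proof -
      define f where "f z y = s' z y * of_bool (d z = d y)" for z y
      have own: "f x x = 0" by (simp add: f_def s'_def)
      have "cost d = (\<Sum>z\<in>G. \<Sum>y\<in>G. f z y)" by (simp only: cost_def f_def)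
      also have "\<dots> = (\<Sum>y\<in>G. f x y) + (\<Sum>z\<in>?G. \<Sum>y\<in>G. f z y)"
        by (rule sum.remove[OF fin x])
      also have "(\<Sum>z\<in>?G. \<Sum>y\<in>G. f z y) = (\<Sum>z\<in>?G. f z x + (\<Sum>y\<in>?G. f z y))"
        by (intro sum.cong refl sum.remove[OF fin x])
      also have "\<dots> = (\<Sum>z\<in>?G. f z x) + (\<Sum>z\<in>?G. \<Sum>y\<in>?G. f z y)" by (rule sum.distrib)
      also have "(\<Sum>y\<in>G. f x y) = f x x + (\<Sum>y\<in>?G. f x y)" by (rule sum.remove[OF fin x])
      also have "(\<Sum>y\<in>?G. f x y) = (\<Sum>y\<in>?G. s x y * of_bool (d y = d x))"
        by (intro sum.cong refl) (auto simp: s'_def f_def)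
      also have "(\<Sum>z\<in>?G. f z x) = (\<Sum>y\<in>?G. s x y * of_bool (d y = d x))"
        using sym by (intro sum.cong refl) (auto simp: s'_def f_def)
      finally have "cost d = 2 * (\<Sum>y\<in>?G. s x y * of_bool (d y = d x)) + (\<Sum>z\<in>?G. \<Sum>y\<in>?G. f z y)"
        using own by linarith
      thus ?thesis by (simp add: f_def)
    qed
    have le: "?col (c x) \<le> ?col j" if j: "j < q" for j
    proof -
      let ?d = "c(x := j)"
      have "?d \<in> ?F" using c x j by (auto simp: PiE_iff extensional_def)
      hence "cost c \<le> cost ?d" by (rule cmin)
      moreover have "(\<Sum>z\<in>?G. \<Sum>y\<in>?G. s' z y * of_bool (?d z = ?d y)) = (\<Sum>z\<in>?G. \<Sum>y\<in>?G. s' z y * of_bool (c z = c y))"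
        by (intro sum.cong refl) auto
      moreover have "(\<Sum>y\<in>?G. s x y * of_bool (?d y = ?d x)) = ?col j" by (intro sum.cong refl) auto
      ultimately show ?thesis unfolding dec by simp
    qed
    have "real q * ?col (c x) = (\<Sum>j<q. ?col (c x))" by simp
    also have "\<dots> \<le> (\<Sum>j<q. ?col j)" by (intro sum_mono le) simp
    also have "\<dots> = (\<Sum>y\<in>?G. \<Sum>j<q. s x y * of_bool (c y = j))" by (rule sum.swap)
    also have "\<dots> = (\<Sum>y\<in>?G. s x y)"
    proof (rule sum.cong[OF refl])
      fix y assume "y \<in> ?G"
      hence "c y < q" using PiE_mem[OF c, of y] by auto
      hence "(\<Sum>j<q. of_bool (c y = j)) = (1 :: real)" by (simp add: of_bool_def sum.delta)
      thus "(\<Sum>j<q. s x y * of_bool (c y = j)) = s x y" by (simp add: sum_distrib_left[symmetric])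
    qed
    also have "\<dots> \<le> (\<Sum>y\<in>G. s x y)" using x nonneg fin by (intro sum_mono2) auto
    finally show ?thesis using row[OF x] by simp
  qed
  have "\<exists>j<q. card G \<le> q * card {x \<in> G. c x = j}"
  proof (rule ccontr)
    assume "\<not> (\<exists>j<q. card G \<le> q * card {x \<in> G. c x = j})"
    hence lt: "q * card {x \<in> G. c x = j} < card G" if "j < q" for j using that by (meson not_le)
    have "(\<Sum>j<q. q * card {x \<in> G. c x = j}) < (\<Sum>j<q. card G)"
      by (rule sum_strict_mono) (use lt q in auto)
    moreover have "(\<Sum>j<q. card {x \<in> G. c x = j}) = card G"
    proof -
      have "(\<Sum>j<q. sum (\<lambda>_. 1 :: nat) {x \<in> G. c x = j}) = sum (\<lambda>_. 1) G"
        by (rule sum.group[OF fin]) (use c in \<open>auto simp: PiE_iff\<close>)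
      thus ?thesis by simp
    qed
    hence "(\<Sum>j<q. q * card {x \<in> G. c x = j}) = q * card G" by (simp flip: sum_distrib_left)
    ultimately show False by simp
  qed
  then obtain j where j: "j < q" "card G \<le> q * card {x \<in> G. c x = j}" by blast
  let ?W = "{x \<in> G. c x = j}"
  have "(\<Sum>y\<in>?W - {x}. s x y) \<le> T / real q" if x: "x \<in> ?W" for x
  proof -
    have "(\<Sum>y\<in>?W - {x}. s x y) = (\<Sum>y\<in>G - {x}. s x y * of_bool (c y = c x))"
      using fin x by (intro sum.mono_neutral_cong_left) auto
    thus ?thesis using own[of x] x q by (simp add: field_simps)
  qed
  hence "\<forall>x\<in>?W. (\<Sum>y\<in>?W - {x}. s x y) \<le> T / real q" by (intro ballI)
  moreover have "?W \<subseteq> G" by (rule Collect_restrict)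
  ultimately show ?thesis using j(2) by (intro exI[of _ ?W] conjI)
qed

lemma sum_at_most_one:
  fixes f :: "'a \<Rightarrow> real"
  assumes "finite I" "0 \<le> B" "\<And>i. i \<in> I \<Longrightarrow> f i \<le> B"
    "\<And>i j. i \<in> I \<Longrightarrow> j \<in> I \<Longrightarrow> f i \<noteq> 0 \<Longrightarrow> f j \<noteq> 0 \<Longrightarrow> i = j"
  shows "sum f I \<le> B"
proof (cases "\<exists>i\<in>I. f i \<noteq> 0")
  case True
  then obtain i where i: "i \<in> I" "f i \<noteq> 0" by blast
  have "sum f I = sum f {i}"
    using assms(1,4) i by (intro sum.mono_neutral_right) auto
  thus ?thesis using assms(3)[OF i(1)] by simp
next
  case False
  hence "sum f I = 0" by (intro sum.neutral) auto
  thus ?thesis using assms(2) by simp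
qed

context hub_tree
begin

text \<open>Each edge on the way to the root hangs on a vertex already present and adds at most its
  parent. Sets shared with \<open>X\<close> add nothing. The vertex \<open>a\<close> allows a start
  from empty \<open>X\<close>.\<close>

lemma path_connected:
  assumes "finite X" "card (\<Union>(vs ` X) \<union> {a}) \<le> card X + 1" "u \<in> R t" "u \<in> \<Union>(vs ` X) \<union> {a}"
  shows "card (\<Union>(vs ` (X \<union> pth t u)) \<union> {a}) \<le> card (X \<union> pth t u) + 1"
  using assms
proof (induction t arbitrary: u X)
  case 0 thus ?case by simp
next
  case (Suc t)
  note up = ups[OF Suc.prems(3)]
  let ?S = "ups t u"
  let ?X = "insert ?S X"
  have fV: "finite (\<Union>(vs ` X) \<union> {a})" using Suc.prems(1) fin_vs by simp
  have V: "\<Union>(vs ` ?X) \<union> {a} = insert (pr t u) (\<Union>(vs ` X) \<union> {a})"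
    using up(3) Suc.prems(4) by auto
  have "card (\<Union>(vs ` ?X) \<union> {a}) \<le> card ?X + 1"
  proof (cases "?S \<in> X")
    case True
    hence "?X = X" by blast
    thus ?thesis using Suc.prems(2) by simp
  next
    case False
    have "card (\<Union>(vs ` ?X) \<union> {a}) \<le> Suc (card (\<Union>(vs ` X) \<union> {a}))"
      unfolding V using card_insert_le_m1 fV by (simp add: card_insert_if)
    thus ?thesis using Suc.prems(1,2) False by simp
  qed
  moreover have "pr t u \<in> \<Union>(vs ` ?X) \<union> {a}" unfolding V by simp
  ultimately have "card (\<Union>(vs ` (?X \<union> pth t (pr t u))) \<union> {a}) \<le> card (?X \<union> pth t (pr t u)) + 1"
    using Suc.IH[of ?X "pr t u"] up(2) Suc.prems(1) by simp
  moreover have "?X \<union> pth t (pr t u) = X \<union> pth (Suc t) u" by (simp add: path.simps)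
  ultimately show ?case by simp
qed

lemma path_ends: "u \<in> R (Suc t) \<Longrightarrow> u \<in> \<Union>(vs ` pth (Suc t) u) \<and> w \<in> \<Union>(vs ` pth (Suc t) u)"
proof (induction t arbitrary: u)
  case 0
  note up = ups[OF 0]
  have "pr 0 u = w" using up(2) by (simp add: level_0)
  thus ?case using up(3) by (simp add: path.simps)
next
  case (Suc t)
  note up = ups[OF Suc.prems]
  have "w \<in> \<Union>(vs ` pth (Suc t) (pr (Suc t) u))" using Suc.IH[OF up(2)] by simp
  moreover have "pth (Suc (Suc t)) u = insert (ups (Suc t) u) (pth (Suc t) (pr (Suc t) u))" by (simp only: path.simps)
  ultimately show ?case using up(3) by simp
qed

end

context slots
begin

text \<open>Sorts the walks by their final vertex, for the pigeonhole argument over leaves.\<close>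

lemma sl_split: assumes M: "M \<in> packs"
  shows "sl \<sigma> F M = (\<Sum>a\<in>A. sl \<sigma> (\<lambda>u Q. of_bool (u = a) * F u Q) M)"
proof -
  have "sl \<sigma> F M = sl \<sigma> (\<lambda>u Q. \<Sum>a\<in>A. of_bool (u = a) * F u Q) M"
  proof (cases "hub h M (fst \<sigma>)")
    case True
    interpret T: hub_tree k U C A h M "fst \<sigma>" using tree_locale[OF M True h0] .
    show ?thesis unfolding slot_sum_def
    proof (intro arg_cong2[where f="(*)"] refl sum.cong)
      fix u assume u: "u \<in> leaves h M (fst \<sigma>) J \<chi> (snd \<sigma>)"
      have uA: "u \<in> A" using u T.leaves_R T.R_A by blast
      have "(\<Sum>a\<in>A. of_bool (u = a) * F u (T.pth h u)) = (\<Sum>a\<in>A. if u = a then F u (T.pth h u) else 0)"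
        by (intro sum.cong refl) auto
      also have "\<dots> = F u (T.pth h u)" using uA fin_A by simp
      finally show "F u (T.pth h u) = (\<Sum>a\<in>A. of_bool (u = a) * F u (T.pth h u))" by (rule sym)
    qed
  qed (simp add: slot_sum_def)
  thus ?thesis by (simp only: sl_sum)
qed

lemma sl_at: "sl (w, i) (\<lambda>u Q. of_bool (u = a) * F Q) M =
    (if hub h M w \<and> a \<in> leaves h M w J \<chi> i then wt h M w h a * F (path h M w h a) else 0)" if M: "M \<in> packs"
proof (cases "hub h M w")
  case True
  interpret T: hub_tree k U C A h M w using tree_locale[OF M True h0] .
  have "sl (w, i) (\<lambda>u Q. of_bool (u = a) * F Q) M = (\<Sum>u\<in>leaves h M w J \<chi> i. if u = a then wt h M w h a * F (path h M w h a) else 0)"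
    unfolding slot_sum_def using True by (simp, intro sum.cong refl) auto
  thus ?thesis using True T.fin_leaves by (simp add: sum.delta)
qed (simp add: slot_sum_def)

end

text \<open>\<open>pairs\<close> makes the walks of the chosen hubs almost disjoint.
  \<open>large\<close> says that one normalised leaf weight at every member of \<open>A\<close>
  cannot account for the free slots.\<close>

locale greedy = slots +
  fixes W :: "nat set set" and \<zeta> :: real
  assumes W: "W \<subseteq> good" and \<zeta>: "0 < \<zeta>" "128 * \<zeta> \<le> 1"
    and pairs: "\<And>\<sigma>. \<sigma> \<in> W \<times> {..<3} \<Longrightarrow> (\<Sum>\<sigma>'\<in>W \<times> {..<3} - {\<sigma>}. pair \<sigma> \<sigma>') \<le> \<zeta>"
    and large: "real (card A) * (9 * (1/3) ^ h * (3 / \<delta>)) < 3 / 4 * real (card W)"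
begin

definition Slots :: "(nat set \<times> nat) set" where
  "Slots = W \<times> {..<3}"

text \<open>The expected number of other slots that the path \<open>Q\<close> blocks.\<close>

definition damage :: "nat set \<times> nat \<Rightarrow> nat set set \<Rightarrow> real" where
  "damage \<sigma> Q = (\<Sum>\<sigma>'\<in>Slots - {\<sigma>}. Pr \<sigma>' (\<lambda>_ Q'. of_bool (hit Q Q')))"

text \<open>
  After \<open>n\<close> arms, \<open>Us\<close> are the used slots and \<open>Y\<close> is the union of the arms; the last condition bounds the
  expected number of free slots blocked by \<open>Y\<close>.
\<close>

definition state :: "nat \<Rightarrow> (nat set \<times> nat) set \<Rightarrow> nat set set \<Rightarrow> bool" where
  "state n Us Y \<longleftrightarrow> Us \<subseteq> Slots \<and> card Us = 2 * n \<and> Y \<in> packs \<and>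
     card (\<Union>(vs ` Y) \<union> W) + n \<le> card Y + card W \<and>
     (\<Sum>\<sigma>\<in>Slots - Us. Pr \<sigma> (\<lambda>_ Q. of_bool (hit Y Q))) \<le> 16 * \<zeta> * real n"

lemma Slots_sub: "Slots \<subseteq> slotset" and fin_Slots: "finite Slots" and fin_W: "finite W" and card_Slots: "card Slots = 3 * card W"
proof -
  show "Slots \<subseteq> slotset" using W by (auto simp: Slots_def slotset_def)
  show "finite W" using finite_subset[OF W fin_good] .
  thus "finite Slots" "card Slots = 3 * card W" by (simp_all add: Slots_def)
qed

lemma Pr_damage: assumes "\<sigma> \<in> Slots" shows "Pr \<sigma> (\<lambda>_ Q. damage \<sigma> Q) \<le> \<zeta>"
proof -
  have "Pr \<sigma> (\<lambda>_ Q. damage \<sigma> Q) = (\<Sum>\<sigma>'\<in>Slots - {\<sigma>}. pair \<sigma> \<sigma>')"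
    unfolding damage_def pair_def by (rule Pr_sum)
  thus ?thesis using pairs[of \<sigma>] assms by (simp add: Slots_def)
qed

lemma damage_nonneg: "Q \<in> packs \<Longrightarrow> 0 \<le> damage \<sigma> Q"
  unfolding damage_def using Slots_sub by (intro sum_nonneg Pr_nonneg) auto

definition nice :: "nat set set \<Rightarrow> nat set \<times> nat \<Rightarrow> nat set set \<Rightarrow> bool" where
  "nice Y \<sigma> Q \<longleftrightarrow> \<not> hit Y Q \<and> damage \<sigma> Q \<le> 8 * \<zeta>"

text \<open>Markov's inequality: the mean damage is at most \<open>\<zeta>\<close>, so damage above
  \<open>8 * \<zeta>\<close> has weight at most 1/8.\<close>

lemma nice_mass: assumes "\<sigma> \<in> Slots"
  shows "7 / 8 - Pr \<sigma> (\<lambda>_ Q. of_bool (hit Y Q)) \<le> Pr \<sigma> (\<lambda>_ Q. of_bool (nice Y \<sigma> Q))"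
proof -
  have s: "\<sigma> \<in> slotset" using assms Slots_sub by blast
  have "Pr \<sigma> (\<lambda>_ Q. 1) \<le> Pr \<sigma> (\<lambda>_ Q. (of_bool (nice Y \<sigma> Q) + of_bool (hit Y Q)) + (1 / (8 * \<zeta>)) * damage \<sigma> Q)"
  proof (rule Pr_mono[OF s])
    fix Q assume Q: "Q \<in> packs"
    have d0: "0 \<le> (1 / (8 * \<zeta>)) * damage \<sigma> Q" using damage_nonneg[OF Q] \<zeta>(1) by simp
    show "1 \<le> of_bool (nice Y \<sigma> Q) + of_bool (hit Y Q) + (1 / (8 * \<zeta>)) * damage \<sigma> Q"
    proof (cases "nice Y \<sigma> Q \<or> hit Y Q")
      case True
      thus ?thesis using d0 by auto
    next
      case False
      hence "8 * \<zeta> < damage \<sigma> Q" unfolding nice_def by linarith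
      hence "1 \<le> (1 / (8 * \<zeta>)) * damage \<sigma> Q" using \<zeta>(1) by (simp add: field_simps)
      thus ?thesis by simp
    qed
  qed
  also have "\<dots> = Pr \<sigma> (\<lambda>_ Q. of_bool (nice Y \<sigma> Q)) + Pr \<sigma> (\<lambda>_ Q. of_bool (hit Y Q)) + (1 / (8 * \<zeta>)) * Pr \<sigma> (\<lambda>_ Q. damage \<sigma> Q)"
    by (simp only: Pr_add Pr_cmult)
  also have "\<dots> \<le> Pr \<sigma> (\<lambda>_ Q. of_bool (nice Y \<sigma> Q)) + Pr \<sigma> (\<lambda>_ Q. of_bool (hit Y Q)) + (1 / (8 * \<zeta>)) * \<zeta>"
    using Pr_damage[OF assms] \<zeta>(1) by (intro add_left_mono mult_left_mono) auto
  finally show ?thesis using Pr_const[OF s, of 1] \<zeta>(1) by simp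
qed

text \<open>Both paths lie in the same packing \<open>M\<close>, so their union is a packing even if
  they share sets, and it is connected through \<open>a\<close>. Two of its vertices are hubs
  counted in \<open>W\<close> already, so the sets gain one on the vertices.\<close>

lemma extend:
  assumes st: "state n Us Y" and M: "M \<in> packs"
    and s1: "\<sigma>1 \<in> Slots - Us" and s2: "\<sigma>2 \<in> Slots - Us" and ne: "\<sigma>1 \<noteq> \<sigma>2"
    and hub: "hub h M (fst \<sigma>1)" "hub h M (fst \<sigma>2)"
    and leaf: "a \<in> leaves h M (fst \<sigma>1) J \<chi> (snd \<sigma>1)" "a \<in> leaves h M (fst \<sigma>2) J \<chi> (snd \<sigma>2)"
    and nice: "nice Y \<sigma>1 (path h M (fst \<sigma>1) h a)" "nice Y \<sigma>2 (path h M (fst \<sigma>2) h a)"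
  shows "\<exists>Us' Y'. state (Suc n) Us' Y'"
proof -
  interpret T1: hub_tree k U C A h M "fst \<sigma>1" using tree_locale[OF M hub(1) h0] .
  interpret T2: hub_tree k U C A h M "fst \<sigma>2" using tree_locale[OF M hub(2) h0] .
  define Q1 where "Q1 = path h M (fst \<sigma>1) h a"
  define Q2 where "Q2 = path h M (fst \<sigma>2) h a"
  define T where "T = Q1 \<union> Q2"
  obtain h' where h': "h = Suc h'" using h0 by (cases h) auto
  have aR: "a \<in> T1.R h" "a \<in> T2.R h" using leaf by (auto simp: leaves_def)
  \<comment> \<open>At a single hub, a common leaf would give one branch two colours. The first set
    of the branch refutes this: it is nonempty and, as \<open>J >= 1\<close>, among the coloured
    ones.\<close>
  have wne: "fst \<sigma>1 \<noteq> fst \<sigma>2"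
  proof
    assume eq: "fst \<sigma>1 = fst \<sigma>2"
    define b where "b = branch h M (fst \<sigma>1) h a"
    have b: "b \<in> T1.R (Suc 0)" using T1.branch_level[of a h'] aR(1) unfolding b_def h' by simp
    have c1: "coloured h M (fst \<sigma>1) J \<chi> (snd \<sigma>1) b" "coloured h M (fst \<sigma>1) J \<chi> (snd \<sigma>2) b"
      using leaf eq by (auto simp: leaves_def b_def)
    have "T1.ups 0 b \<noteq> {}" using S_nonempty[OF T1.up_C[OF b]] .
    then obtain x where x: "x \<in> T1.ups 0 b" by blast
    have bb: "branch h M (fst \<sigma>1) (Suc 0) b = b" by (simp add: branch.simps)
    have J0: "0 < J" using J by simp
    have "\<chi> x = snd \<sigma>1" "\<chi> x = snd \<sigma>2"
      using c1 x b bb J0 unfolding coloured_def by blast+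
    thus False using eq ne by (simp add: prod_eq_iff)
  qed
  have QM: "Q1 \<subseteq> M" "Q2 \<subseteq> M" using T1.path_M[OF aR(1)] T2.path_M[OF aR(2)] by (auto simp: Q1_def Q2_def)
  have packsQ: "Q1 \<in> packs" "Q2 \<in> packs" "T \<in> packs"
    using packs_sub[OF M QM(1)] packs_sub[OF M QM(2)] packs_sub[OF M, of T] QM by (auto simp: T_def)
  have Yp: "Y \<in> packs" using st by (simp add: state_def)
  have nohit: "\<not> hit Y T" using nice unfolding nice_def T_def Q1_def Q2_def hit_def by blast
  have finT: "finite T" "finite Y" using packsD(3) packsQ(3) Yp by auto
  have disj: "Y \<inter> T = {}"
  proof (rule ccontr)
    assume "Y \<inter> T \<noteq> {}"
    then obtain S where S: "S \<in> Y" "S \<in> T" by blast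
    hence "S \<inter> S \<noteq> {}" using S_nonempty packsD(1)[OF Yp] by auto
    thus False using nohit S unfolding hit_def by blast
  qed
  have Y'p: "Y \<union> T \<in> packs"
  proof -
    have "S \<inter> S' = {}" if "S \<in> Y \<union> T" "S' \<in> Y \<union> T" "S \<noteq> S'" for S S'
      using that(1,2)
    proof (elim UnE)
      assume "S \<in> Y" "S' \<in> Y" thus ?thesis using packsD(2)[OF Yp] that(3) unfolding disjoint_def by blast
    next
      assume "S \<in> T" "S' \<in> T" thus ?thesis using packsD(2)[OF packsQ(3)] that(3) unfolding disjoint_def by blast
    next
      assume "S \<in> Y" "S' \<in> T" thus ?thesis using nohit unfolding hit_def by blast
    next
      assume "S \<in> T" "S' \<in> Y" thus ?thesis using nohit unfolding hit_def by blast
    qed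
    thus ?thesis using packsD(1)[OF Yp] packsD(1)[OF packsQ(3)] unfolding packs_def is_packing_def disjoint_def by blast
  qed
  have ends: "a \<in> \<Union>(vs ` Q1)" "fst \<sigma>1 \<in> \<Union>(vs ` Q1)" "fst \<sigma>2 \<in> \<Union>(vs ` Q2)"
    using T1.path_ends[of a h'] T2.path_ends[of a h'] aR unfolding Q1_def Q2_def h' by auto
  have cT: "card (\<Union>(vs ` T)) \<le> card T + 1"
  proof -
    have "card (\<Union>(vs ` ({} \<union> Q1)) \<union> {a}) \<le> card ({} \<union> Q1) + 1"
      unfolding Q1_def by (rule T1.path_connected[OF _ _ aR(1)]) simp_all
    hence 1: "card (\<Union>(vs ` Q1) \<union> {a}) \<le> card Q1 + 1" by simp
    have "card (\<Union>(vs ` (Q1 \<union> Q2)) \<union> {a}) \<le> card (Q1 \<union> Q2) + 1"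
      unfolding Q2_def by (rule T2.path_connected[OF _ 1 aR(2)]) (use packsD(3)[OF packsQ(1)] in auto)
    moreover have "\<Union>(vs ` T) \<union> {a} = \<Union>(vs ` T)" using ends(1) by (auto simp: T_def)
    ultimately show ?thesis by (simp add: T_def)
  qed
  let ?Us = "insert \<sigma>1 (insert \<sigma>2 Us)"
  have UsS: "Us \<subseteq> Slots" "card Us = 2 * n" "finite Us"
    using st finite_subset[OF _ fin_Slots] by (auto simp: state_def)
  have "state (Suc n) ?Us (Y \<union> T)"
    unfolding state_def
  proof (intro conjI)
    show "?Us \<subseteq> Slots" using s1 s2 UsS by auto
    show "card ?Us = 2 * Suc n" using s1 s2 ne UsS by simp
    show "Y \<union> T \<in> packs" by (rule Y'p)
    have fV: "finite (\<Union>(vs ` T))" "finite (\<Union>(vs ` Y))" using finT fin_vs by auto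
    have wW: "fst \<sigma>1 \<in> W" "fst \<sigma>2 \<in> W" using s1 s2 by (auto simp: Slots_def)
    have "card (\<Union>(vs ` (Y \<union> T)) \<union> W) \<le> card ((\<Union>(vs ` Y) \<union> W) \<union> (\<Union>(vs ` T) - {fst \<sigma>1, fst \<sigma>2}))"
      by (rule card_mono) (use fV fin_W wW in auto)
    also have "\<dots> \<le> card (\<Union>(vs ` Y) \<union> W) + card (\<Union>(vs ` T) - {fst \<sigma>1, fst \<sigma>2})" by (rule card_Un_le)
    finally have le: "card (\<Union>(vs ` (Y \<union> T)) \<union> W) \<le> card (\<Union>(vs ` Y) \<union> W) + card (\<Union>(vs ` T) - {fst \<sigma>1, fst \<sigma>2})" .
    have sub: "{fst \<sigma>1, fst \<sigma>2} \<subseteq> \<Union>(vs ` T)" using ends by (auto simp: T_def)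
    have "card (\<Union>(vs ` T) - {fst \<sigma>1, fst \<sigma>2}) = card (\<Union>(vs ` T)) - 2"
      using card_Diff_subset[OF _ sub] wne by simp
    moreover have "2 \<le> card (\<Union>(vs ` T))" using card_mono[OF fV(1) sub] wne by simp
    ultimately have "card (\<Union>(vs ` T) - {fst \<sigma>1, fst \<sigma>2}) + 1 \<le> card T" using cT by linarith
    moreover have "card (Y \<union> T) = card Y + card T" using disj finT by (simp add: card_Un_disjoint)
    moreover have "card (\<Union>(vs ` Y) \<union> W) + n \<le> card Y + card W" using st by (simp add: state_def)
    ultimately show "card (\<Union>(vs ` (Y \<union> T)) \<union> W) + Suc n \<le> card (Y \<union> T) + card W" using le by linarith
    have "(\<Sum>\<sigma>\<in>Slots - ?Us. Pr \<sigma> (\<lambda>_ Q. of_bool (hit (Y \<union> T) Q))) \<le>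
        (\<Sum>\<sigma>\<in>Slots - ?Us. Pr \<sigma> (\<lambda>_ Q. of_bool (hit Y Q)) + Pr \<sigma> (\<lambda>_ Q. of_bool (hit Q1 Q)) + Pr \<sigma> (\<lambda>_ Q. of_bool (hit Q2 Q)))"
    proof (rule sum_mono)
      fix \<sigma> assume "\<sigma> \<in> Slots - ?Us"
      hence s: "\<sigma> \<in> slotset" using Slots_sub by blast
      have "Pr \<sigma> (\<lambda>_ Q. of_bool (hit (Y \<union> T) Q)) \<le> Pr \<sigma> (\<lambda>_ Q. of_bool (hit Y Q) + of_bool (hit Q1 Q) + of_bool (hit Q2 Q))"
      proof (rule Pr_mono[OF s])
        fix Q
        have "hit (Y \<union> T) Q \<longleftrightarrow> hit Y Q \<or> hit Q1 Q \<or> hit Q2 Q" unfolding hit_def T_def by blast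
        thus "of_bool (hit (Y \<union> T) Q) \<le> (of_bool (hit Y Q) + of_bool (hit Q1 Q) + of_bool (hit Q2 Q) :: real)" by simp
      qed
      thus "Pr \<sigma> (\<lambda>_ Q. of_bool (hit (Y \<union> T) Q)) \<le> Pr \<sigma> (\<lambda>_ Q. of_bool (hit Y Q)) + Pr \<sigma> (\<lambda>_ Q. of_bool (hit Q1 Q)) + Pr \<sigma> (\<lambda>_ Q. of_bool (hit Q2 Q))"
        by (simp only: Pr_add)
    qed
    also have "\<dots> = (\<Sum>\<sigma>\<in>Slots - ?Us. Pr \<sigma> (\<lambda>_ Q. of_bool (hit Y Q))) + (\<Sum>\<sigma>\<in>Slots - ?Us. Pr \<sigma> (\<lambda>_ Q. of_bool (hit Q1 Q)))
        + (\<Sum>\<sigma>\<in>Slots - ?Us. Pr \<sigma> (\<lambda>_ Q. of_bool (hit Q2 Q)))"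
      by (simp only: sum.distrib)
    also have "\<dots> \<le> 16 * \<zeta> * real n + 8 * \<zeta> + 8 * \<zeta>"
    proof (intro add_mono)
      have nn: "0 \<le> Pr \<sigma> (\<lambda>_ Q. of_bool (hit X Q))" if "\<sigma> \<in> Slots" for \<sigma> X
        using that Slots_sub by (intro Pr_nonneg) auto
      have "(\<Sum>\<sigma>\<in>Slots - ?Us. Pr \<sigma> (\<lambda>_ Q. of_bool (hit Y Q))) \<le> (\<Sum>\<sigma>\<in>Slots - Us. Pr \<sigma> (\<lambda>_ Q. of_bool (hit Y Q)))"
        using fin_Slots nn by (intro sum_mono2) auto
      thus "(\<Sum>\<sigma>\<in>Slots - ?Us. Pr \<sigma> (\<lambda>_ Q. of_bool (hit Y Q))) \<le> 16 * \<zeta> * real n" using st by (simp add: state_def)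
      have "(\<Sum>\<sigma>\<in>Slots - ?Us. Pr \<sigma> (\<lambda>_ Q. of_bool (hit Q1 Q))) \<le> damage \<sigma>1 Q1"
        unfolding damage_def using fin_Slots nn by (intro sum_mono2) auto
      thus "(\<Sum>\<sigma>\<in>Slots - ?Us. Pr \<sigma> (\<lambda>_ Q. of_bool (hit Q1 Q))) \<le> 8 * \<zeta>" using nice(1) by (simp add: nice_def Q1_def)
      have "(\<Sum>\<sigma>\<in>Slots - ?Us. Pr \<sigma> (\<lambda>_ Q. of_bool (hit Q2 Q))) \<le> damage \<sigma>2 Q2"
        unfolding damage_def using fin_Slots nn by (intro sum_mono2) auto
      thus "(\<Sum>\<sigma>\<in>Slots - ?Us. Pr \<sigma> (\<lambda>_ Q. of_bool (hit Q2 Q))) \<le> 8 * \<zeta>" using nice(2) by (simp add: nice_def Q2_def)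
    qed
    finally show "(\<Sum>\<sigma>\<in>Slots - ?Us. Pr \<sigma> (\<lambda>_ Q. of_bool (hit (Y \<union> T) Q))) \<le> 16 * \<zeta> * real (Suc n)"
      by (simp add: algebra_simps)
  qed
  thus ?thesis by blast
qed

text \<open>Without an extension, each vertex would in every packing be the end of a nice walk from
  at most one free slot, so all nice walks together would weigh at most one normalised leaf weight
  per member of \<open>A\<close>. But they weigh at least \<open>3/4 card W\<close>.\<close>

lemma state_Suc: assumes st: "state n Us Y" and n: "n \<le> card W"
  shows "\<exists>Us' Y'. state (Suc n) Us' Y'"
proof (rule ccontr)
  assume neg: "\<not> (\<exists>Us' Y'. state (Suc n) Us' Y')"
  define F where "F = Slots - Us"
  have UsS: "Us \<subseteq> Slots" "card Us = 2 * n" using st by (auto simp: state_def)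
  have fF: "finite F" "F \<subseteq> Slots" using fin_Slots by (auto simp: F_def)
  have "card F = 3 * card W - 2 * n"
    unfolding F_def using card_Diff_subset[OF finite_subset[OF UsS(1) fin_Slots] UsS(1)] card_Slots UsS(2) by simp
  \<comment> \<open>Three slots per hub minus two per arm.\<close>
  hence cF: "card W \<le> card F" using n by simp
  define f where "f a \<sigma> M = (1 / slot_mass \<sigma>) * sl \<sigma> (\<lambda>u Q. of_bool (u = a) * of_bool (nice Y \<sigma> Q)) M" for a \<sigma> M
  have FS: "\<sigma> \<in> slotset" if "\<sigma> \<in> F" for \<sigma> using that fF(2) Slots_sub by blast
  have B0: "0 \<le> 9 * (1/3) ^ h * (3 / \<delta>)" using \<delta> by simp
  have bound: "(\<Sum>\<sigma>\<in>F. f a \<sigma> M) \<le> 9 * (1/3) ^ h * (3 / \<delta>)" if M: "M \<in> packs" for a M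
  proof (rule sum_at_most_one[OF fF(1) B0])
    have f_eq: "f a \<sigma> M = (if hub h M (fst \<sigma>) \<and> a \<in> leaves h M (fst \<sigma>) J \<chi> (snd \<sigma>)
       then (1 / slot_mass \<sigma>) * (wt h M (fst \<sigma>) h a * of_bool (nice Y \<sigma> (path h M (fst \<sigma>) h a))) else 0)" for \<sigma>
      unfolding f_def using sl_at[OF M, of "fst \<sigma>" "snd \<sigma>" a "\<lambda>Q. of_bool (nice Y \<sigma> Q)"] by simp
    fix \<sigma> assume \<sigma>: "\<sigma> \<in> F"
    show "f a \<sigma> M \<le> 9 * (1/3) ^ h * (3 / \<delta>)"
    proof (cases "hub h M (fst \<sigma>) \<and> a \<in> leaves h M (fst \<sigma>) J \<chi> (snd \<sigma>)")
      case True
      interpret T: hub_tree k U C A h M "fst \<sigma>" using tree_locale[OF M _ h0] True by blast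
      have aR: "a \<in> T.R h" using True T.leaves_R by blast
      have "wt h M (fst \<sigma>) h a \<le> 9 * (1/3) ^ h" using T.wt_le_power[OF aR h0] by simp
      moreover have w0: "0 \<le> wt h M (fst \<sigma>) h a" using T.wt_nonneg[OF aR] by simp
      ultimately have "wt h M (fst \<sigma>) h a * of_bool (nice Y \<sigma> (path h M (fst \<sigma>) h a)) \<le> 9 * (1/3) ^ h"
        by (cases "nice Y \<sigma> (path h M (fst \<sigma>) h a)") auto
      moreover have sm: "1 / slot_mass \<sigma> \<le> 3 / \<delta>"
        using slot_mass_ge[OF FS[OF \<sigma>]] slot_mass_pos[OF FS[OF \<sigma>]] \<delta> by (simp add: field_simps)
      moreover have "0 \<le> wt h M (fst \<sigma>) h a * of_bool (nice Y \<sigma> (path h M (fst \<sigma>) h a))"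
        by (rule mult_nonneg_nonneg[OF w0]) simp
      moreover have "0 \<le> 3 / \<delta>" using \<delta> by simp
      ultimately have "(1 / slot_mass \<sigma>) * (wt h M (fst \<sigma>) h a * of_bool (nice Y \<sigma> (path h M (fst \<sigma>) h a))) \<le> 3 / \<delta> * (9 * (1/3) ^ h)"
        using mult_mono by blast
      hence "f a \<sigma> M \<le> 3 / \<delta> * (9 * (1/3) ^ h)" unfolding f_eq if_P[OF True] .
      thus ?thesis by (simp only: mult.commute[of "3 / \<delta>"])
    next
      case False
      hence "f a \<sigma> M = 0" unfolding f_eq by auto
      thus ?thesis using B0 by simp
    qed
    fix \<sigma>' assume \<sigma>': "\<sigma>' \<in> F" and nz: "f a \<sigma> M \<noteq> 0" "f a \<sigma>' M \<noteq> 0"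
    have 1: "hub h M (fst \<sigma>)" "a \<in> leaves h M (fst \<sigma>) J \<chi> (snd \<sigma>)" "nice Y \<sigma> (path h M (fst \<sigma>) h a)"
      using nz(1) unfolding f_eq by (auto split: if_splits)
    have 2: "hub h M (fst \<sigma>')" "a \<in> leaves h M (fst \<sigma>') J \<chi> (snd \<sigma>')" "nice Y \<sigma>' (path h M (fst \<sigma>') h a)"
      using nz(2) unfolding f_eq by (auto split: if_splits)
    show "\<sigma> = \<sigma>'"
      using extend[OF st M _ _ _ 1(1) 2(1) 1(2) 2(2) 1(3) 2(3)] \<sigma> \<sigma>' neg unfolding F_def by blast
  qed
  have nonneg: "0 \<le> Pr \<sigma> (\<lambda>_ Q. of_bool (hit Y Q))" if "\<sigma> \<in> F" for \<sigma>
    by (rule Pr_nonneg[OF FS[OF that]]) simp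
  have "3 / 4 * real (card W) \<le> 7 / 8 * real (card F) - 16 * \<zeta> * real n"
  proof -
    \<comment> \<open>Thus the blocked weight \<open>16 * \<zeta> * n\<close> is at most
      \<open>card W / 8\<close>, and 7/8 drops to 3/4.\<close>
    have "128 * \<zeta> * real n \<le> 1 * real (card W)" using \<zeta> n by (intro mult_mono) auto
    thus ?thesis using cF by simp
  qed
  also have "\<dots> \<le> (\<Sum>\<sigma>\<in>F. 7 / 8 - Pr \<sigma> (\<lambda>_ Q. of_bool (hit Y Q)))"
    using st by (simp add: sum_subtractf state_def F_def)
  also have "\<dots> \<le> (\<Sum>\<sigma>\<in>F. Pr \<sigma> (\<lambda>_ Q. of_bool (nice Y \<sigma> Q)))"
    by (intro sum_mono nice_mass) (use fF in auto)
  also have "\<dots> = (\<Sum>\<sigma>\<in>F. E (\<lambda>M. \<Sum>a\<in>A. f a \<sigma> M))"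
  proof (rule sum.cong[OF refl])
    fix \<sigma>
    have "E (\<lambda>M. \<Sum>a\<in>A. f a \<sigma> M) = E (\<lambda>M. (1 / slot_mass \<sigma>) * sl \<sigma> (\<lambda>u Q. of_bool (nice Y \<sigma> Q)) M)"
      by (rule E_cong) (simp only: f_def sum_distrib_left[symmetric] sl_split[where F = "\<lambda>u Q. of_bool (nice Y \<sigma> Q)"])
    thus "Pr \<sigma> (\<lambda>_ Q. of_bool (nice Y \<sigma> Q)) = E (\<lambda>M. \<Sum>a\<in>A. f a \<sigma> M)"
      by (simp only: E_cmult Pr_def) simp
  qed
  also have "\<dots> = (\<Sum>a\<in>A. E (\<lambda>M. \<Sum>\<sigma>\<in>F. f a \<sigma> M))"
    unfolding E_sum by (rule sum.swap)
  also have "\<dots> \<le> (\<Sum>a\<in>A. E (\<lambda>M. 9 * (1/3) ^ h * (3 / \<delta>)))"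
  proof (rule sum_mono)
    fix a assume a: "a \<in> A"
    show "E (\<lambda>M. \<Sum>\<sigma>\<in>F. f a \<sigma> M) \<le> E (\<lambda>M. 9 * (1/3) ^ h * (3 / \<delta>))"
    proof (rule E_le1[OF _ loc_const _ a bound])
      \<comment> \<open>The sum over free slots is spread over all of \<open>A\<close> so that
        \<open>loc_near_sum\<close> applies around the common end \<open>a\<close>.\<close>
      have nest: "(\<Sum>\<sigma>\<in>F. f a \<sigma> M) = (\<Sum>w\<in>A. \<Sum>i<3. of_bool ((w, i) \<in> F) * f a (w, i) M)" for M
      proof -
        have "F \<subseteq> A \<times> {..<3}" using fF(2) W good_A by (auto simp: Slots_def)
        hence "(\<Sum>\<sigma>\<in>F. f a \<sigma> M) = (\<Sum>\<sigma>\<in>A \<times> {..<3}. of_bool (\<sigma> \<in> F) * f a \<sigma> M)"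
          using fin_A by (intro sum.mono_neutral_cong_left) auto
        also have "\<dots> = (\<Sum>(w, i)\<in>A \<times> {..<3}. of_bool ((w, i) \<in> F) * f a (w, i) M)"
          by (rule sum.cong[OF refl]) (simp add: case_prod_beta)
        also have "\<dots> = (\<Sum>w\<in>A. \<Sum>i<3. of_bool ((w, i) \<in> F) * f a (w, i) M)"
          by (rule sum.cartesian_product[symmetric])
        finally show ?thesis .
      qed
      have "loc {a} (h + h) (\<lambda>M. \<Sum>w\<in>A. \<Sum>i<3. of_bool ((w, i) \<in> F) * f a (w, i) M)"
      proof (rule loc_near_sum)
        fix w
        have "loc {w} h (f a (w, i))" for i
          unfolding f_def by (rule loc_comp[where F = "\<lambda>x. 1 / slot_mass (w, i) * x"]) (simp only: fst_conv snd_conv, rule loc_slot_sum[OF h0 J(2)])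
        hence "loc {w} h (\<lambda>M. of_bool ((w, i) \<in> F) * f a (w, i) M)" for i
          by (rule loc_comp)
        thus "loc {w} h (\<lambda>M. \<Sum>i<3. of_bool ((w, i) \<in> F) * f a (w, i) M)" by (intro loc_sum)
      next
        fix M w assume M: "M \<in> packs" and far: "w \<notin> ball M {a} h"
        have "f a (w, i) M = 0" for i
        proof (cases "hub h M w")
          case True
          have "a \<notin> leaves h M w J \<chi> i"
            using level_adj_back[OF M True h0, of a h] far by (auto simp: leaves_def)
          thus ?thesis unfolding f_def sl_at[OF M] by simp
        next
          case False thus ?thesis unfolding f_def sl_at[OF M] by simp
        qed
        thus "(\<Sum>i<3. of_bool ((w, i) \<in> F) * f a (w, i) M) = 0" by simp
      qed simp
      thus "loc {a} (h + h) (\<lambda>M. \<Sum>\<sigma>\<in>F. f a \<sigma> M)" unfolding nest .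
    qed (use hN in simp)
  qed
  also have "\<dots> = real (card A) * (9 * (1/3) ^ h * (3 / \<delta>))" by (simp add: E_const)
  finally show False using large by simp
qed

lemma contradiction: False
proof -
  have "n \<le> card W + 1 \<Longrightarrow> \<exists>Us Y. state n Us Y" for n
  proof (induction n)
    case 0
    have "{} \<in> packs" by (simp add: packs_def is_packing_def disjoint_def)
    moreover have "(\<Sum>\<sigma>\<in>Slots. Pr \<sigma> (\<lambda>_ Q. 0)) = 0"
      using Slots_sub by (intro sum.neutral ballI Pr_const) auto
    ultimately have "state 0 {} {}" by (simp add: state_def hit_def)
    thus ?case by blast
  next
    case (Suc n)
    thus ?case using state_Suc[of n] by auto
  qed
  then obtain Us Y where st: "state (card W + 1) Us Y" by blast
  hence Y: "Y \<in> packs" and "card (\<Union>(vs ` Y) \<union> W) + (card W + 1) \<le> card Y + card W" by (auto simp: state_def)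
  hence "card (\<Union>(vs ` Y) \<union> W) < card Y" by linarith
  moreover have "card (\<Union>(vs ` Y)) \<le> card (\<Union>(vs ` Y) \<union> W)"
    using packsD(3)[OF Y] fin_vs fin_W by (intro card_mono) auto
  ultimately show False using gain[OF Y] by simp
qed

end


section \<open>Density of good hubs and choice of the constants\<close>

context slots
begin

text \<open>A vertex outside \<open>good\<close> contributes at most \<open>\<delta>\<close>, so at
  least half of the assumed sum comes from \<open>good\<close>, where each term is at most
  1.\<close>

lemma good_ge:
  assumes "2 * \<delta> * real (card A) \<le> (\<Sum>w\<in>A. E (\<lambda>M. of_bool (rainbow \<chi> w M)))"
  shows "\<delta> * real (card A) \<le> real (card good)"
proof -
  have "(\<Sum>w\<in>A. E (\<lambda>M. of_bool (rainbow \<chi> w M))) \<le> (\<Sum>w\<in>A. \<delta> + of_bool (w \<in> good))"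
  proof (rule sum_mono)
    fix w assume w: "w \<in> A"
    have "E (\<lambda>M. of_bool (rainbow \<chi> w M)) \<le> E (\<lambda>M. 1)"
      by (rule E_le1[OF loc_comp[OF loc_rainbow] loc_const hle w]) simp
    thus "E (\<lambda>M. of_bool (rainbow \<chi> w M)) \<le> \<delta> + of_bool (w \<in> good)"
      using w \<delta> by (cases "w \<in> good") (auto simp: E_const good_def)
  qed
  also have "\<dots> = \<delta> * real (card A) + (\<Sum>w\<in>A. of_bool (w \<in> good))"
    by (simp only: sum.distrib sum_constant mult.commute)
  also have "(\<Sum>w\<in>A. of_bool (w \<in> good)) = real (card good)"
  proof -
    have "A \<inter> good = good" using good_A by blast
    thus ?thesis using fin_A by simp
  qed
  finally show ?thesis using assms by simp
qed

lemma pair_row: assumes "\<sigma> \<in> slotset" shows "(\<Sum>\<sigma>'\<in>slotset. pair \<sigma> \<sigma>') \<le> \<tau>"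
proof -
  have "(\<Sum>\<sigma>'\<in>slotset. pair \<sigma> \<sigma>') = Pr \<sigma> (\<lambda>_ Q. \<Sum>\<sigma>'\<in>slotset. Pr \<sigma>' (\<lambda>_ Q'. of_bool (hit Q Q')))"
    unfolding pair_def by (rule Pr_sum[symmetric])
  also have "\<dots> \<le> Pr \<sigma> (\<lambda>_ _. \<tau>)" by (rule Pr_mono[OF assms]) (rule total_damage)
  finally show ?thesis using Pr_const[OF assms] by simp
qed

text \<open>The budget 1/128 is split: 1/256 for the two other slots of the same hub, at
  \<open>9 * \<kappa>\<close> each, and 1/256 for the other hubs, after thinning \<open>good\<close>
  with \<open>sparse_class\<close>.\<close>

lemma dense_good_False:
  assumes q: "0 < q" and A0: "A \<noteq> {}" and dense: "\<delta> * real (card A) \<le> real (card good)"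
    and small: "18 * \<kappa> \<le> 1/256" "768 * \<tau> \<le> real q"
    and large: "9 * (1/3) ^ h * (3 / \<delta>) * real q < 3/4 * \<delta>"
  shows False
proof -
  define s where "s w w' = (\<Sum>i<3. \<Sum>i'<3. pair (w, i) (w', i'))" for w w'
  have slot: "(w, i) \<in> slotset" if "w \<in> good" "i < 3" for w i using that by (simp add: slotset_def)
  have sym: "s w w' = s w' w" for w w'
    unfolding s_def by (subst sum.swap) (simp only: pair_commute)
  have nonneg: "0 \<le> s w w'" if "w \<in> good" "w' \<in> good" for w w'
    unfolding s_def using that slot by (intro sum_nonneg pair_nonneg) auto
  have row: "(\<Sum>w'\<in>good. s w w') \<le> 3 * \<tau>" if w: "w \<in> good" for w
  proof -
    have "(\<Sum>w'\<in>good. s w w') = (\<Sum>i<3. \<Sum>w'\<in>good. \<Sum>i'<3. pair (w, i) (w', i'))"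
      unfolding s_def by (rule sum.swap)
    also have "\<dots> = (\<Sum>i<3. \<Sum>\<sigma>'\<in>slotset. pair (w, i) \<sigma>')"
      unfolding slotset_def sum.cartesian_product by (simp add: case_prod_beta)
    also have "\<dots> \<le> (\<Sum>i<(3::nat). \<tau>)" using w slot by (intro sum_mono pair_row) auto
    finally show ?thesis by simp
  qed
  obtain W where W: "W \<subseteq> good" "card good \<le> q * card W"
      "\<And>w. w \<in> W \<Longrightarrow> (\<Sum>w'\<in>W - {w}. s w w') \<le> 3 * \<tau> / real q"
    using sparse_class[of good q s "3 * \<tau>", OF fin_good q sym nonneg row] by metis
  have fW: "finite W" using finite_subset[OF W(1) fin_good] .
  interpret greedy k U C A r t N h J \<chi> \<delta> W "1/128"
  proof
    show "W \<subseteq> good" by (rule W(1))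
    show "(0::real) < 1/128" "128 * (1/128) \<le> (1::real)" by simp_all
    fix \<sigma> assume \<sigma>: "\<sigma> \<in> W \<times> {..<3::nat}"
    obtain w i where wi: "\<sigma> = (w, i)" "w \<in> W" "i < 3" using \<sigma> by auto
    have wg: "w \<in> good" using wi W by blast
    have eq: "W \<times> {..<3} - {\<sigma>} = {w} \<times> ({..<3} - {i}) \<union> (W - {w}) \<times> {..<3}"
      using wi by auto
    have "(\<Sum>\<sigma>'\<in>W \<times> {..<3} - {\<sigma>}. pair \<sigma> \<sigma>') =
        (\<Sum>\<sigma>'\<in>{w} \<times> ({..<3} - {i}). pair \<sigma> \<sigma>') + (\<Sum>\<sigma>'\<in>(W - {w}) \<times> {..<3}. pair \<sigma> \<sigma>')"
      unfolding eq by (rule sum.union_disjoint) (use fW in auto)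
    also have "(\<Sum>\<sigma>'\<in>{w} \<times> ({..<3} - {i}). pair \<sigma> \<sigma>') \<le> real (card ({w} \<times> ({..<3} - {i}))) * (9 * \<kappa>)"
    proof (rule sum_bounded_above)
      fix \<sigma>' assume "\<sigma>' \<in> {w} \<times> ({..<3} - {i})"
      then obtain i' where i': "\<sigma>' = (w, i')" "i' < 3" "i \<noteq> i'" by auto
      show "pair \<sigma> \<sigma>' \<le> 9 * \<kappa>"
        unfolding i'(1) wi(1) by (rule pair_own[OF slot[OF wg wi(3)] slot[OF wg i'(2)] i'(3)])
    qed
    also have "card ({w} \<times> ({..<3} - {i})) = 2" using wi by (simp add: card_cartesian_product)
    also have "(\<Sum>\<sigma>'\<in>(W - {w}) \<times> {..<3}. pair \<sigma> \<sigma>') = (\<Sum>w'\<in>W - {w}. \<Sum>i'<3. pair \<sigma> (w', i'))"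
      by (simp add: sum.cartesian_product case_prod_beta)
    also have "\<dots> \<le> (\<Sum>w'\<in>W - {w}. s w w')"
    proof (rule sum_mono)
      fix w' assume w': "w' \<in> W - {w}"
      have "(\<lambda>i. \<Sum>i'<3. pair (w, i) (w', i')) i \<le> s w w'"
        unfolding s_def using wi wg w' W(1) slot
        by (intro member_le_sum sum_nonneg pair_nonneg) auto
      thus "(\<Sum>i'<3. pair \<sigma> (w', i')) \<le> s w w'" by (simp only: wi(1))
    qed
    also have "\<dots> \<le> 3 * \<tau> / real q" by (rule W(3)[OF wi(2)])
    also have "\<dots> \<le> 1/256" using small(2) q by (simp add: field_simps)
    finally show "(\<Sum>\<sigma>'\<in>W \<times> {..<3} - {\<sigma>}. pair \<sigma> \<sigma>') \<le> 1/128" using small(1) by simp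
  next
    let ?x = "9 * (1/3) ^ h * (3 / \<delta>)"
    have n0: "0 < real (card A)" using A0 fin_A by (simp add: card_gt_0_iff)
    have "real (card A) * ?x * real q = real (card A) * (?x * real q)" by simp
    also have "\<dots> < real (card A) * (3/4 * \<delta>)" by (rule mult_strict_left_mono[OF large n0])
    also have "\<dots> \<le> 3/4 * real (card good)" using dense by simp
    also have "\<dots> \<le> 3/4 * real (q * card W)" using of_nat_mono[OF W(2), where 'a = real] by linarith
    also have "\<dots> = 3/4 * real (card W) * real q" by simp
    finally have "real (card A) * ?x * real q < 3/4 * real (card W) * real q" .
    thus "real (card A) * ?x < 3/4 * real (card W)" by (rule mult_right_less_imp_less) simp
  qed
  show False by (rule contradiction)
qed

end

text \<open>The order of choice avoids a circle: \<open>J\<close> depends on \<open>k\<close>, and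
  \<open>\<delta>\<close> on \<open>k\<close>, \<open>J\<close> and \<open>\<gamma>\<close>. Then
  \<open>q\<close> is quadratic in \<open>h\<close>, so a large \<open>h\<close> settles the last
  inequality by exponential decay.\<close>

lemma exists_constants:
  fixes \<gamma> :: real and k :: nat
  assumes "0 < \<gamma>"
  shows "\<exists>J h q :: nat. \<exists>\<delta>>0. 1 \<le> J \<and> J \<le> h \<and> 0 < q \<and> 2 * \<delta> * 3 ^ (k * (\<Sum>t<J. k ^ Suc t)) = \<gamma> \<and>
     18 * (27 * real k ^ 2 * (3/4) ^ J) \<le> 1/256 \<and> 768 * (9 * real h ^ 2 * real k ^ 2 / \<delta>) \<le> real q \<and>
     9 * (1/3) ^ h * (3 / \<delta>) * real q < 3/4 * \<delta>"
proof -
  \<comment> \<open>\<open>256 * 18 * 27\<close> comes from the condition on \<open>J\<close>; the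
    \<open>+ 1\<close> keeps the denominator positive for \<open>k = 0\<close>.\<close>
  let ?y = "1 / (256 * 18 * 27 * (real k ^ 2 + 1))"
  have y0: "0 < ?y" by (simp add: add_nonneg_pos)
  obtain J0 where "(3/4 :: real) ^ J0 < ?y" using real_arch_pow_inv[OF y0, of "3/4"] by auto
  define J where "J = Suc J0"
  have "(3/4 :: real) ^ J \<le> (3/4) ^ J0" by (simp add: J_def)
  hence "(3/4 :: real) ^ J \<le> ?y" using \<open>(3/4 :: real) ^ J0 < ?y\<close> by linarith
  hence "(256 * 18 * 27 * (real k ^ 2 + 1)) * (3/4) ^ J \<le> 1"
    by (simp add: pos_le_divide_eq add_nonneg_pos mult.commute)
  hence "124416 * (real k ^ 2 * (3/4) ^ J) + 124416 * (3/4) ^ J \<le> 1" by (simp add: algebra_simps)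
  moreover have "0 \<le> (3/4 :: real) ^ J" by simp
  ultimately have "124416 * (real k ^ 2 * (3/4) ^ J) \<le> 1" by linarith
  hence J: "18 * (27 * real k ^ 2 * (3/4) ^ J) \<le> 1/256" by simp
  define \<delta> where "\<delta> = \<gamma> / (2 * 3 ^ (k * (\<Sum>t<J. k ^ Suc t)))"
  have \<delta>: "0 < \<delta>" using assms by (simp add: \<delta>_def)
  \<comment> \<open>\<open>6912 = 768 * 9\<close>, so \<open>c * h^2\<close> is the lower bound
    demanded of \<open>q\<close>; the \<open>+ 2\<close> below covers the rounding.\<close>
  define c where "c = 6912 * real k ^ 2 / \<delta>"
  have "((\<lambda>h. 9 * (1/3) ^ h * (3 / \<delta>) * (c * real h ^ 2 + 2)) \<longlongrightarrow> 0) sequentially"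
    by real_asymp
  hence "eventually (\<lambda>h. 9 * (1/3) ^ h * (3 / \<delta>) * (c * real h ^ 2 + 2) < 3/4 * \<delta>) sequentially"
    by (rule order_tendstoD) (use \<delta> in simp)
  then obtain h where h: "J \<le> h" "9 * (1/3) ^ h * (3 / \<delta>) * (c * real h ^ 2 + 2) < 3/4 * \<delta>"
    unfolding eventually_sequentially by (metis nle_le)
  define q where "q = nat \<lceil>c * real h ^ 2\<rceil> + 1"
  have c0: "0 \<le> c * real h ^ 2" using \<delta> by (simp add: c_def)
  have qle: "c * real h ^ 2 \<le> real q" "real q \<le> c * real h ^ 2 + 2" using c0 unfolding q_def by linarith+
  have "9 * (1/3) ^ h * (3 / \<delta>) * real q \<le> 9 * (1/3) ^ h * (3 / \<delta>) * (c * real h ^ 2 + 2)"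
    using qle(2) \<delta> by (intro mult_left_mono) auto
  hence "9 * (1/3) ^ h * (3 / \<delta>) * real q < 3/4 * \<delta>" using h(2) by linarith
  moreover have "768 * (9 * real h ^ 2 * real k ^ 2 / \<delta>) \<le> real q"
    using qle(1) by (simp add: c_def mult_ac)
  moreover have "2 * \<delta> * 3 ^ (k * (\<Sum>t<J. k ^ Suc t)) = \<gamma>" by (simp add: \<delta>_def)
  moreover have "1 \<le> J" "0 < q" by (simp_all add: J_def q_def)
  ultimately show ?thesis using J h(1) \<delta> by blast
qed

theorem pseudo_gap:
  fixes \<epsilon> :: real
  assumes k: "0 < k" and \<epsilon>: "0 < \<epsilon>"
  shows "\<exists>r\<ge>1. \<forall>U C A t. packing_graph k U C A \<longrightarrow> pseudo_dist r U C t \<longrightarrow>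
    (\<Sum>S\<in>C. \<Sum>M | is_packing C M \<and> S \<in> M. t M) \<le> (real k / 3 + 1 + \<epsilon>) * real (card A)"
proof -
  \<comment> \<open>A violated bound means \<open>excess > 3 \<epsilon> card A\<close>, and
    \<open>hub_mass_ge\<close> divides this by \<open>k (k + 1)\<close>.\<close>
  define \<gamma> where "\<gamma> = 3 * \<epsilon> / (real k * (real k + 1))"
  have \<gamma>: "0 < \<gamma>" using k \<epsilon> by (simp add: \<gamma>_def)
  obtain J h q :: nat and \<delta> :: real where c: "0 < \<delta>" "1 \<le> J" "J \<le> h" "0 < q"
      "2 * \<delta> * 3 ^ (k * (\<Sum>t<J. k ^ Suc t)) = \<gamma>" "18 * (27 * real k ^ 2 * (3/4) ^ J) \<le> 1/256"
      "768 * (9 * real h ^ 2 * real k ^ 2 / \<delta>) \<le> real q" "9 * (1/3) ^ h * (3 / \<delta>) * real q < 3/4 * \<delta>"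
    using exists_constants[OF \<gamma>, of k] by blast
  define N where "N = 3 * h + 3"
  define r where "r = k * (k * (1 + k * k) ^ N)"
  have "(\<Sum>S\<in>C. \<Sum>M | is_packing C M \<and> S \<in> M. t M) \<le> (real k / 3 + 1 + \<epsilon>) * real (card A)"
    if pg: "packing_graph k U C A" and pd: "pseudo_dist r U C t" for U C A t
  proof (rule ccontr)
    assume neg: "\<not> ?thesis"
    interpret packing_graph k U C A by (rule pg)
    interpret gap k U C A r t N by unfold_locales (rule pd, simp only: r_def order.refl)
    have mass: "mass S = (\<Sum>M | is_packing C M \<and> S \<in> M. t M)" for S
    proof -
      have "mass S = (\<Sum>M\<in>packs. if S \<in> M then t M else 0)"
        unfolding mass_def E_def by (intro sum.cong) auto
      also have "\<dots> = (\<Sum>M\<in>{M \<in> packs. S \<in> M}. t M)" by (rule sum.inter_filter[OF fin_packs, symmetric])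
      finally show ?thesis by (simp add: packs_def)
    qed
    have big: "3 * \<epsilon> * real (card A) < excess"
      using neg unfolding excess_def mass by (simp add: algebra_simps)
    \<comment> \<open>An empty maximum packing means an empty collection, where the bound reads
      \<open>0 <= 0\<close>.\<close>
    have A0: "A \<noteq> {}"
    proof
      assume A: "A = {}"
      have "C = {}"
      proof (rule ccontr)
        assume "C \<noteq> {}"
        then obtain S where "S \<in> C" by blast
        hence "is_packing C {S}" by (simp add: is_packing_def)
        thus False using A_max[of "{S}"] A by simp
      qed
      thus False using neg A by simp
    qed
    have h0: "0 < h" using c by simp
    interpret slot_setup k U C A r t N h J by unfold_locales (use c h0 in \<open>simp_all add: N_def\<close>)
    have "3 * \<epsilon> * real (card A) \<le> real k * (real k + 1) * hub_mass h"
      using big hub_mass_ge[of h] by (simp add: N_def)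
    hence hm: "\<gamma> * real (card A) \<le> hub_mass h"
      using k by (simp add: \<gamma>_def divide_le_eq mult_ac add_pos_pos)
    obtain \<chi> where \<chi>: "hub_mass h / 3 ^ near_bound \<le> (\<Sum>w\<in>A. E (\<lambda>M. of_bool (rainbow \<chi> w M)))"
      using exists_colouring by blast
    interpret slots k U C A r t N h J \<chi> \<delta> by unfold_locales (rule c(1))
    have "2 * \<delta> * 3 ^ near_bound * real (card A) \<le> hub_mass h" using hm c(5) by (simp add: near_bound_def)
    hence "2 * \<delta> * real (card A) \<le> hub_mass h / 3 ^ near_bound" by (simp add: le_divide_eq mult_ac)
    hence "\<delta> * real (card A) \<le> real (card good)" using \<chi> by (intro good_ge) linarith
    thus False
      by (rule dense_good_False[OF c(4) A0]) (use c in \<open>simp_all add: \<kappa>_def \<tau>_def\<close>)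
  qed
  moreover have "1 \<le> r" using k by (simp add: r_def Suc_le_eq)
  ultimately show ?thesis by blast
qed


section \<open>The semidefinite encoding\<close>

text \<open>Elimination coordinate by coordinate: if some \<open>p0\<close> is no longer represented
  after adding \<open>s\<close>, its residual at \<open>s\<close> is nonzero, and \<open>p0\<close>
  is the one new generator. So the number of generators is bounded by the number of coordinates, not
  by the size of \<open>P\<close>.\<close>

lemma spanning_family:
  fixes f :: "'p \<Rightarrow> 's \<Rightarrow> real"
  assumes "finite S"
  shows "\<exists>m B. m \<le> card S \<and> B ` {..<m} \<subseteq> P \<and> (\<forall>p\<in>P. \<exists>c. \<forall>s\<in>S. f p s = (\<Sum>i<m. c i * f (B i) s))"
  using assms
proof (induction S)
  case empty
  show ?case by (intro exI[of _ 0]) auto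
next
  case (insert s S)
  obtain m B where IH0: "m \<le> card S \<and> B ` {..<m} \<subseteq> P \<and>
      (\<forall>p\<in>P. \<exists>c. \<forall>s\<in>S. f p s = (\<Sum>i<m. c i * f (B i) s))" using insert.IH by (elim exE)
  note IH = conjunct1[OF IH0] conjunct1[OF conjunct2[OF IH0]] bspec[OF conjunct2[OF conjunct2[OF IH0]]]
  define rep where "rep p c x \<longleftrightarrow> f p x = (\<Sum>i<m. c i * f (B i) x)" for p c x
  show ?case
  proof (cases "\<forall>p\<in>P. \<exists>c. \<forall>x\<in>insert s S. rep p c x")
    case True
    moreover have "m \<le> card (insert s S)" using IH(1) insert.hyps by simp
    ultimately show ?thesis using IH(2) by (intro exI[of _ m] exI[of _ B] conjI) (simp_all only: rep_def)
  next
    case False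
    then obtain p0 where p0: "p0 \<in> P" "\<And>c. \<not> (\<forall>x\<in>insert s S. rep p0 c x)" by blast
    obtain c0 where c0: "\<forall>s\<in>S. f p0 s = (\<Sum>i<m. c0 i * f (B i) s)" using IH(3)[OF p0(1)] by (elim exE)
    define e0 where "e0 = f p0 s - (\<Sum>i<m. c0 i * f (B i) s)"
    have e0: "e0 \<noteq> 0" using p0(2)[of c0] c0 unfolding rep_def e0_def by simp
    define B' where "B' = B(m := p0)"
    have "\<exists>c. \<forall>x\<in>insert s S. f p x = (\<Sum>i<Suc m. c i * f (B' i) x)" if p: "p \<in> P" for p
    proof -
      obtain c where c: "\<forall>s\<in>S. f p s = (\<Sum>i<m. c i * f (B i) s)" using IH(3)[OF p] by (elim exE)
      define l where "l = (f p s - (\<Sum>i<m. c i * f (B i) s)) / e0"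
      have "f p x = (\<Sum>i<Suc m. (if i = m then l else c i - l * c0 i) * f (B' i) x)" if x: "x \<in> insert s S" for x
      proof -
        have "(\<Sum>i<Suc m. (if i = m then l else c i - l * c0 i) * f (B' i) x) =
            (\<Sum>i<m. c i * f (B i) x - l * (c0 i * f (B i) x)) + l * f p0 x"
          by (simp add: B'_def algebra_simps)
        also have "\<dots> = (\<Sum>i<m. c i * f (B i) x) + l * (f p0 x - (\<Sum>i<m. c0 i * f (B i) x))"
          by (simp add: sum_subtractf sum_distrib_left[symmetric] algebra_simps)
        also have "\<dots> = f p x"
        proof (cases "x = s")
          case True
          thus ?thesis using e0 by (simp add: l_def e0_def[symmetric])
        next
          case False
          hence "x \<in> S" using x by simp
          hence "f p x = (\<Sum>i<m. c i * f (B i) x)" "f p0 x = (\<Sum>i<m. c0 i * f (B i) x)"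
            using bspec[OF c] bspec[OF c0] by simp_all
          thus ?thesis by simp
        qed
        finally show ?thesis by simp
      qed
      thus ?thesis by (intro exI[of _ "\<lambda>i. if i = m then l else c i - l * c0 i"] ballI)
    qed
    moreover have "Suc m \<le> card (insert s S)" using IH(1) insert.hyps by simp
    moreover have "B' ` {..<Suc m} \<subseteq> P" using IH(2) p0(1) by (auto simp: B'_def less_Suc_eq)
    ultimately show ?thesis by (intro exI[of _ "Suc m"] exI[of _ B'] conjI ballI)
  qed
qed

lemma card_small_subsets:
  assumes "finite U"
  shows "card {V. V \<subseteq> U \<and> card V \<le> r} \<le> (card U + 1) ^ r"
proof (induction r)
  case 0
  have "{V. V \<subseteq> U \<and> card V \<le> 0} = {{}}" using assms by (auto dest: finite_subset)
  thus ?case by simp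
next
  case (Suc r)
  let ?P = "\<lambda>r. {V. V \<subseteq> U \<and> card V \<le> r}"
  have fin: "finite (?P r)" using assms by simp
  have "?P (Suc r) \<subseteq> ?P r \<union> (\<Union>x\<in>U. insert x ` ?P r)"
  proof
    fix V assume V: "V \<in> ?P (Suc r)"
    hence fV: "finite V" using assms finite_subset by blast
    show "V \<in> ?P r \<union> (\<Union>x\<in>U. insert x ` ?P r)"
    proof (cases "card V \<le> r")
      case False
      hence "V \<noteq> {}" by auto
      then obtain x where x: "x \<in> V" by blast
      hence "V - {x} \<in> ?P r" using V fV by auto
      moreover have "V = insert x (V - {x})" "x \<in> U" using x V by auto
      ultimately show ?thesis by blast
    qed (use V in simp)
  qed
  hence "card (?P (Suc r)) \<le> card (?P r \<union> (\<Union>x\<in>U. insert x ` ?P r))"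
    using fin assms by (intro card_mono) auto
  also have "\<dots> \<le> card (?P r) + card (\<Union>x\<in>U. insert x ` ?P r)" by (rule card_Un_le)
  also have "card (\<Union>x\<in>U. insert x ` ?P r) \<le> (\<Sum>x\<in>U. card (insert x ` ?P r))" by (rule card_UN_le[OF assms])
  also have "\<dots> \<le> (\<Sum>x\<in>U. card (?P r))" by (intro sum_mono card_image_le fin)
  also have "card (?P r) + \<dots> = (card U + 1) * card (?P r)" by simp
  also have "\<dots> \<le> (card U + 1) * (card U + 1) ^ r" by (rule mult_le_mono2[OF Suc.IH])
  finally show ?case by simp
qed

text \<open>At most \<open>card V\<close> members of a packing meet \<open>V\<close>, so larger
  \<open>N\<close> never occur and the number of events stays polynomial.\<close>

definition events :: "nat \<Rightarrow> nat set \<Rightarrow> nat set set \<Rightarrow> (nat set \<times> nat set set) set" where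
  "events r U C = {V. V \<subseteq> U \<and> card V \<le> r} \<times> {N. N \<subseteq> C \<and> card N \<le> r}"

definition occurs :: "nat set set \<Rightarrow> nat set \<times> nat set set \<Rightarrow> bool" where
  "occurs M s \<longleftrightarrow> restr M (fst s) = snd s"

definition spanning :: "nat \<Rightarrow> nat set \<Rightarrow> nat set set \<Rightarrow> nat \<times> (nat \<Rightarrow> nat set set) \<times> (nat set \<times> nat set set) list \<Rightarrow> bool" where
  "spanning r U C = (\<lambda>(m, B, es). m \<le> card (events r U C) \<and> (\<forall>i<m. is_packing C (B i)) \<and>
     (\<forall>M. is_packing C M \<longrightarrow>
       (\<exists>c. \<forall>s\<in>events r U C. of_bool (occurs M s) = (\<Sum>i<m. c i * of_bool (occurs (B i) s) :: real))) \<and>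
     set es = events r U C \<and> length es = card (events r U C))"

text \<open>
  A free variable \<open>\<tau>\<^sub>i\<close>, the measure of the packing \<open>B i\<close>, is the difference of the diagonal entries
  \<open>i\<close> and \<open>m + i\<close> of the positive semidefinite matrix.
\<close>

definition diagonal :: "nat \<Rightarrow> (nat \<Rightarrow> rat) \<Rightarrow> rat mat" where
  "diagonal m g = mat (2 * m) (2 * m) (\<lambda>(i, j). if i = j then (if i < m then g i else - g (i - m)) else 0)"

definition span_sdp :: "nat \<times> (nat \<Rightarrow> nat set set) \<times> (nat set \<times> nat set set) list \<Rightarrow> packing_sdp" where
  "span_sdp = (\<lambda>(m, B, es). \<lparr> sdp_dim = 2 * m,
     sdp_constraints = (diagonal m (\<lambda>_. 1), 1) # (diagonal m (\<lambda>_. - 1), - 1) #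
       map (\<lambda>s. (diagonal m (\<lambda>i. - of_bool (occurs (B i) s)), 0)) es,
     sdp_var = (\<lambda>S. diagonal m (\<lambda>i. of_bool (S \<in> B i))) \<rparr>)"

text \<open>The generators are chosen arbitrarily. By \<open>pseudo_sdp_region\<close> the feasible
  region does not depend on them, so programs of different instances can be compared.\<close>

definition pseudo_sdp :: "nat \<Rightarrow> nat set \<Rightarrow> nat set set \<Rightarrow> packing_sdp" where
  "pseudo_sdp r U C = span_sdp (SOME mB. spanning r U C mB)"

lemma finite_events: "finite U \<Longrightarrow> finite C \<Longrightarrow> finite (events r U C)"
  by (simp add: events_def)

lemma spanning_exists:
  assumes "finite U" "finite C"
  obtains m B es where "spanning r U C (m, B, es)" "pseudo_sdp r U C = span_sdp (m, B, es)"
proof -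
  note fin = finite_events[OF assms, of r]
  obtain m B where mB: "m \<le> card (events r U C)" "B ` {..<m} \<subseteq> {M. is_packing C M}"
    "\<forall>p\<in>{M. is_packing C M}. \<exists>c. \<forall>s\<in>events r U C. of_bool (occurs p s) = (\<Sum>i<m. c i * of_bool (occurs (B i) s) :: real)"
    using spanning_family[OF fin, where P = "{M. is_packing C M}" and f = "\<lambda>p s. of_bool (occurs p s)"] by blast
  obtain es where es: "set es = events r U C" "distinct es" using finite_distinct_list[OF fin] by blast
  have "spanning r U C (m, B, es)"
    unfolding spanning_def using mB es distinct_card[OF es(2)] by auto
  hence "spanning r U C (SOME mB. spanning r U C mB)" by (rule someI)
  thus thesis using that unfolding pseudo_sdp_def by (metis prod_cases3)
qed

lemma frob_diagonal:
  assumes "X \<in> carrier_mat (2 * m) (2 * m)"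
  shows "frob (diagonal m g) X = (\<Sum>i<m. of_rat (g i) * (X $$ (i, i) - X $$ (m + i, m + i)))"
proof -
  let ?h = "\<lambda>i. of_rat (if i < m then g i else - g (i - m)) * X $$ (i, i)"
  have "frob (diagonal m g) X = (\<Sum>i<2 * m. \<Sum>j<2 * m. if i = j then ?h i else 0)"
    unfolding frob_def using assms by (intro sum.cong) (auto simp: diagonal_def)
  also have "\<dots> = (\<Sum>i<2 * m. ?h i)" by (intro sum.cong) (auto simp: sum.delta)
  also have "\<dots> = (\<Sum>i<m. ?h i) + (\<Sum>i<m. ?h (m + i))"
    by (simp only: mult_2 lessThan_atLeast0 sum.atLeastLessThan_concat[of 0 m "m + m", symmetric] le0 le_add1
      sum.shift_bounds_nat_ivl[of _ 0 m m, simplified] add.commute)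
  also have "\<dots> = (\<Sum>i<m. of_rat (g i) * (X $$ (i, i) - X $$ (m + i, m + i)))"
    unfolding sum.distrib[symmetric] by (intro sum.cong) (auto simp: of_rat_minus algebra_simps)
  finally show ?thesis .
qed

lemma psd_diagonal:
  fixes d :: "nat \<Rightarrow> real"
  assumes "\<And>i. i < n \<Longrightarrow> 0 \<le> d i"
  shows "psd n (mat n n (\<lambda>(i, j). if i = j then d i else 0))"
  unfolding psd_def
proof (intro conjI ballI)
  let ?X = "mat n n (\<lambda>(i, j). if i = j then d i else 0)"
  show "?X \<in> carrier_mat n n" by simp
  show "?X\<^sup>T = ?X" by (rule eq_matI) auto
  fix v :: "real vec" assume v: "v \<in> carrier_vec n"
  have "(?X *\<^sub>v v) $ i = d i * v $ i" if "i < n" for i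
  proof -
    have "(?X *\<^sub>v v) $ i = (\<Sum>j\<in>{0..<n}. (if i = j then d i else 0) * v $ j)"
      using that v by (simp add: scalar_prod_def)
    also have "\<dots> = (\<Sum>j\<in>{0..<n}. if i = j then d i * v $ j else 0)" by (intro sum.cong) auto
    finally show ?thesis using that by (simp add: sum.delta)
  qed
  hence "v \<bullet> (?X *\<^sub>v v) = (\<Sum>i\<in>{0..<n}. v $ i * (d i * v $ i))"
    by (simp add: scalar_prod_def)
  also have "\<dots> \<ge> 0" using assms by (intro sum_nonneg) (simp add: mult.left_commute)
  finally show "0 \<le> v \<bullet> (?X *\<^sub>v v)" .
qed

text \<open>All functionals read only the differences of paired diagonal entries. Conversely a real
  \<open>\<tau>\<close> is realised by its positive and negative parts.\<close>

lemma span_sdp_region: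
  "x \<in> sdp_region C (span_sdp (m, B, es)) \<longleftrightarrow>
    (\<exists>\<tau>. (\<Sum>i<m. \<tau> i) = 1 \<and> (\<forall>s\<in>set es. 0 \<le> (\<Sum>i<m. of_bool (occurs (B i) s) * \<tau> i)) \<and>
      x = (\<lambda>S. if S \<in> C then (\<Sum>i<m. of_bool (S \<in> B i) * \<tau> i) else 0))" (is "_ \<longleftrightarrow> ?R")
proof
  have rat: "real_of_rat (- of_bool b) = - of_bool b" "real_of_rat (of_bool b) = of_bool b" for b
    by (cases b; simp)+
  have feas: "X \<in> sdp_feasible (span_sdp (m, B, es)) \<longleftrightarrow> psd (2 * m) X \<and>
      (\<Sum>i<m. X $$ (i, i) - X $$ (m + i, m + i)) = 1 \<and>
      (\<forall>s\<in>set es. 0 \<le> (\<Sum>i<m. of_bool (occurs (B i) s) * (X $$ (i, i) - X $$ (m + i, m + i))))" for X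
  proof (cases "X \<in> carrier_mat (2 * m) (2 * m)")
    case True
    note fd = frob_diagonal[OF True]
    have 1: "frob (diagonal m (\<lambda>_. 1)) X = (\<Sum>i<m. X $$ (i, i) - X $$ (m + i, m + i))"
      "frob (diagonal m (\<lambda>_. - 1)) X = - (\<Sum>i<m. X $$ (i, i) - X $$ (m + i, m + i))"
      unfolding fd by (simp_all add: sum_negf[symmetric] of_rat_minus)
    have 2: "frob (diagonal m (\<lambda>i. - of_bool (occurs (B i) s))) X =
        - (\<Sum>i<m. of_bool (occurs (B i) s) * (X $$ (i, i) - X $$ (m + i, m + i)))" for s
      unfolding fd rat by (simp only: sum_negf[symmetric] mult_minus_left)
    have "(\<forall>(A, b)\<in>set (sdp_constraints (span_sdp (m, B, es))). frob A X \<le> of_rat b) \<longleftrightarrow>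
      (frob (diagonal m (\<lambda>_. 1)) X \<le> 1 \<and> frob (diagonal m (\<lambda>_. - 1)) X \<le> - 1 \<and>
      (\<forall>s\<in>set es. frob (diagonal m (\<lambda>i. - of_bool (occurs (B i) s))) X \<le> 0))"
      by (simp add: span_sdp_def of_rat_minus)
    also have "\<dots> \<longleftrightarrow> (\<Sum>i<m. X $$ (i, i) - X $$ (m + i, m + i)) = 1 \<and>
      (\<forall>s\<in>set es. 0 \<le> (\<Sum>i<m. of_bool (occurs (B i) s) * (X $$ (i, i) - X $$ (m + i, m + i))))"
      unfolding 1 2 neg_le_iff_le neg_le_0_iff_le order.eq_iff[of _ "1 :: real"] conj_assoc by (rule refl)
    finally show ?thesis by (simp add: sdp_feasible_def span_sdp_def)
  next
    case False
    thus ?thesis by (simp add: sdp_feasible_def psd_def span_sdp_def)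
  qed
  have var: "frob (sdp_var (span_sdp (m, B, es)) S) X = (\<Sum>i<m. of_bool (S \<in> B i) * (X $$ (i, i) - X $$ (m + i, m + i)))"
    if "X \<in> carrier_mat (2 * m) (2 * m)" for X S
    using frob_diagonal[OF that] by (simp only: span_sdp_def rat prod.case packing_sdp.select_convs)
  {
    assume "x \<in> sdp_region C (span_sdp (m, B, es))"
    then obtain X where X: "X \<in> sdp_feasible (span_sdp (m, B, es))"
      "x = (\<lambda>S. if S \<in> C then frob (sdp_var (span_sdp (m, B, es)) S) X else 0)"
      by (auto simp: sdp_region_def)
    have c: "X \<in> carrier_mat (2 * m) (2 * m)" using X(1) feas by (simp add: psd_def)
    show ?R
      using X(1) unfolding X(2) var[OF c] feas
      by (intro exI[of _ "\<lambda>i. X $$ (i, i) - X $$ (m + i, m + i)"]) simp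
  }
  assume ?R
  then obtain \<tau> where \<tau>: "(\<Sum>i<m. \<tau> i) = 1" "\<forall>s\<in>set es. 0 \<le> (\<Sum>i<m. of_bool (occurs (B i) s) * \<tau> i)"
      "x = (\<lambda>S. if S \<in> C then (\<Sum>i<m. of_bool (S \<in> B i) * \<tau> i) else 0)" by blast
  define d where "d i = (if i < m then max (\<tau> i) 0 else max (- \<tau> (i - m)) 0)" for i
  define X where "X = mat (2 * m) (2 * m) (\<lambda>(i, j). if i = j then d i else 0)"
  have c: "X \<in> carrier_mat (2 * m) (2 * m)" by (simp add: X_def)
  have diff: "X $$ (i, i) - X $$ (m + i, m + i) = \<tau> i" if "i < m" for i
    using that by (auto simp: X_def d_def)
  have sum: "(\<Sum>i<m. g i * (X $$ (i, i) - X $$ (m + i, m + i))) = (\<Sum>i<m. g i * \<tau> i)" for g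
    using diff by (intro sum.cong) auto
  have "psd (2 * m) X" unfolding X_def by (rule psd_diagonal) (simp add: d_def)
  hence "X \<in> sdp_feasible (span_sdp (m, B, es))"
    unfolding feas using \<tau>(1,2) sum[of "\<lambda>_. 1"] by (simp add: sum)
  moreover have "x = (\<lambda>S. if S \<in> C then frob (sdp_var (span_sdp (m, B, es)) S) X else 0)"
    unfolding var[OF c] sum by (rule \<tau>(3))
  ultimately show "x \<in> sdp_region C (span_sdp (m, B, es))" by (auto simp: sdp_region_def)
qed


section \<open>Equivalence of the program with pseudo-distributions\<close>

lemma occurs_total: "occurs M ({}, {})"
  by (simp add: occurs_def restr_def)

lemma occurs_member: assumes "is_packing C M" "x \<in> S"
  shows "occurs M ({x}, {S}) \<longleftrightarrow> S \<in> M"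
proof
  assume "occurs M ({x}, {S})"
  hence "S \<in> restr M {x}" by (simp add: occurs_def)
  thus "S \<in> M" by (simp add: restr_def)
next
  assume S: "S \<in> M"
  have "S' = S" if "S' \<in> M" "x \<in> S'" for S'
    by (rule packing_meet[OF assms(1) that(1) S that(2) assms(2)])
  hence "restr M {x} = {S}" using S assms(2) unfolding restr_def by blast
  thus "occurs M ({x}, {S})" by (simp add: occurs_def)
qed

lemma restr_events:
  assumes M: "is_packing C M" and V: "V \<subseteq> U" "card V \<le> r" and U: "finite U"
  shows "(V, restr M V) \<in> events r U C"
proof -
  have "card (restr M V) \<le> r"
    using card_restr_le[OF M finite_subset[OF V(1) U]] V(2) by simp
  moreover have "restr M V \<subseteq> C" using M by (auto simp: is_packing_def restr_def)
  ultimately show ?thesis using V by (simp add: events_def)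
qed

text \<open>One direction places \<open>\<tau>\<close> on the packings \<open>B i\<close>, the other
  expands every packing in the generators; event masses are preserved both ways. The variables are
  event masses too: \<open>S \<in> M\<close> is the event of \<open>{y}\<close> and
  \<open>{S}\<close> for any \<open>y \<in> S\<close>.\<close>

lemma pseudo_sdp_region:
  assumes inst: "packing_instance k U C" and k: "0 < k" and r: "1 \<le> r"
  shows "x \<in> sdp_region C (pseudo_sdp r U C) \<longleftrightarrow>
    (\<exists>t. pseudo_dist r U C t \<and> x = (\<lambda>S. if S \<in> C then (\<Sum>M | is_packing C M \<and> S \<in> M. t M) else 0))"
proof -
  note fin = packing_finite[OF inst]
  have finP: "finite {M. is_packing C M}" using fin(3)[of "\<lambda>_. True"] by simp
  obtain m B es where sp: "spanning r U C (m, B, es)" and eq: "pseudo_sdp r U C = span_sdp (m, B, es)"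
    using spanning_exists[OF fin(1,2)] .
  have BP: "is_packing C (B i)" if "i < m" for i using sp that by (simp add: spanning_def)
  have es: "set es = events r U C" using sp by (simp add: spanning_def)
  show ?thesis unfolding eq span_sdp_region es
  proof
    assume "\<exists>\<tau>. (\<Sum>i<m. \<tau> i) = 1 \<and> (\<forall>s\<in>events r U C. 0 \<le> (\<Sum>i<m. of_bool (occurs (B i) s) * \<tau> i)) \<and>
      x = (\<lambda>S. if S \<in> C then (\<Sum>i<m. of_bool (S \<in> B i) * \<tau> i) else 0)"
    then obtain \<tau> where \<tau>: "(\<Sum>i<m. \<tau> i) = 1" "\<forall>s\<in>events r U C. 0 \<le> (\<Sum>i<m. of_bool (occurs (B i) s) * \<tau> i)"
      "x = (\<lambda>S. if S \<in> C then (\<Sum>i<m. of_bool (S \<in> B i) * \<tau> i) else 0)" by (elim exE conjE)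
    \<comment> \<open>\<open>B\<close> may list a packing several times, hence a sum.\<close>
    define t where "t M = (\<Sum>i<m. if M = B i then \<tau> i else 0)" for M
    have t: "(\<Sum>M | is_packing C M \<and> Q M. t M) = (\<Sum>i<m. of_bool (Q (B i)) * \<tau> i)" for Q
      unfolding t_def by (subst sum.swap) (intro sum.cong refl, use BP fin(3)[of Q] in \<open>auto simp: sum.delta\<close>)
    have "pseudo_dist r U C t" unfolding pseudo_dist_def
    proof (intro conjI allI impI)
      show "(\<Sum>M | is_packing C M. t M) = 1" using t[of "\<lambda>_. True"] \<tau>(1) by simp
      fix V N assume V: "V \<subseteq> U" "card V \<le> r"
      show "0 \<le> (\<Sum>M | is_packing C M \<and> restr M V = N. t M)"
      proof (cases "\<exists>M. is_packing C M \<and> restr M V = N")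
        case True
        hence "(V, N) \<in> events r U C" using restr_events[OF _ V fin(1)] by blast
        hence "0 \<le> (\<Sum>i<m. of_bool (occurs (B i) (V, N)) * \<tau> i)" using \<tau>(2) by (rule bspec[rotated])
        thus ?thesis unfolding t by (simp only: occurs_def fst_conv snd_conv)
      next
        case False
        hence "{M. is_packing C M \<and> restr M V = N} = {}" by blast
        thus ?thesis by (simp only: sum.empty)
      qed
    qed
    moreover have "x = (\<lambda>S. if S \<in> C then (\<Sum>M | is_packing C M \<and> S \<in> M. t M) else 0)"
      unfolding \<tau>(3) t by (rule refl)
    ultimately show "\<exists>t. pseudo_dist r U C t \<and> x = (\<lambda>S. if S \<in> C then (\<Sum>M | is_packing C M \<and> S \<in> M. t M) else 0)"
      by (intro exI[of _ t] conjI)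
  next
    assume "\<exists>t. pseudo_dist r U C t \<and> x = (\<lambda>S. if S \<in> C then (\<Sum>M | is_packing C M \<and> S \<in> M. t M) else 0)"
    then obtain t where t: "pseudo_dist r U C t" "x = (\<lambda>S. if S \<in> C then (\<Sum>M | is_packing C M \<and> S \<in> M. t M) else 0)"
      by (elim exE conjE)
    have "\<exists>c. \<forall>s\<in>events r U C. of_bool (occurs M s) = (\<Sum>i<m. c i * of_bool (occurs (B i) s) :: real)"
      if "is_packing C M" for M using sp that by (simp add: spanning_def)
    then obtain c where c: "\<And>M s. is_packing C M \<Longrightarrow> s \<in> events r U C \<Longrightarrow>
        of_bool (occurs M s) = (\<Sum>i<m. c M i * of_bool (occurs (B i) s) :: real)" by metis
    define \<tau> where "\<tau> i = (\<Sum>M | is_packing C M. t M * c M i)" for i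
    have \<tau>: "(\<Sum>i<m. of_bool (occurs (B i) s) * \<tau> i) = (\<Sum>M | is_packing C M \<and> occurs M s. t M)"
      if s: "s \<in> events r U C" for s
    proof -
      have "(\<Sum>i<m. of_bool (occurs (B i) s) * \<tau> i) =
          (\<Sum>M | is_packing C M. \<Sum>i<m. of_bool (occurs (B i) s) * (t M * c M i))"
        unfolding \<tau>_def sum_distrib_left by (rule sum.swap)
      also have "\<dots> = (\<Sum>M | is_packing C M. if occurs M s then t M else 0)"
      proof (rule sum.cong[OF refl])
        fix M assume M: "M \<in> {M. is_packing C M}"
        have "(\<Sum>i<m. of_bool (occurs (B i) s) * (t M * c M i)) = t M * (\<Sum>i<m. c M i * of_bool (occurs (B i) s))"
          unfolding sum_distrib_left by (intro sum.cong refl) (simp only: mult_ac)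
        also have "\<dots> = t M * of_bool (occurs M s)" using c[of M s] M s by (simp only: mem_Collect_eq)
        finally show "(\<Sum>i<m. of_bool (occurs (B i) s) * (t M * c M i)) = (if occurs M s then t M else 0)" by simp
      qed
      also have "\<dots> = (\<Sum>M\<in>{M \<in> {M. is_packing C M}. occurs M s}. t M)" by (rule sum.inter_filter[OF finP, symmetric])
      finally show ?thesis by (simp only: mem_Collect_eq)
    qed
    have "({}, {}) \<in> events r U C" by (simp add: events_def)
    from \<tau>[OF this] have "(\<Sum>i<m. \<tau> i) = 1" using t(1) by (simp add: occurs_total pseudo_dist_def)
    moreover have "\<forall>s\<in>events r U C. 0 \<le> (\<Sum>i<m. of_bool (occurs (B i) s) * \<tau> i)"
      using t(1) by (auto simp only: \<tau>) (auto simp: events_def occurs_def pseudo_dist_def)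
    moreover have "(\<Sum>i<m. of_bool (S \<in> B i) * \<tau> i) = (\<Sum>M | is_packing C M \<and> S \<in> M. t M)" if S: "S \<in> C" for S
    proof -
      have "S \<subseteq> U" "card S = k" using inst S by (auto simp: packing_instance_def)
      hence "S \<noteq> {}" using k by auto
      then obtain y where y: "y \<in> S" "y \<in> U" using \<open>S \<subseteq> U\<close> by blast
      have "({y}, {S}) \<in> events r U C" using y S r by (simp add: events_def)
      note \<tau>[OF this]
      moreover have "(\<Sum>i<m. of_bool (occurs (B i) ({y}, {S})) * \<tau> i) = (\<Sum>i<m. of_bool (S \<in> B i) * \<tau> i)"
        using occurs_member[OF BP y(1)] by (intro sum.cong refl) simp
      moreover have "{M. is_packing C M \<and> occurs M ({y}, {S})} = {M. is_packing C M \<and> S \<in> M}"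
        using occurs_member[OF _ y(1)] by auto
      ultimately show ?thesis by simp
    qed
    hence "x = (\<lambda>S. if S \<in> C then (\<Sum>i<m. of_bool (S \<in> B i) * \<tau> i) else 0)" unfolding t(2) by auto
    ultimately show "\<exists>\<tau>. (\<Sum>i<m. \<tau> i) = 1 \<and> (\<forall>s\<in>events r U C. 0 \<le> (\<Sum>i<m. of_bool (occurs (B i) s) * \<tau> i)) \<and>
      x = (\<lambda>S. if S \<in> C then (\<Sum>i<m. of_bool (S \<in> B i) * \<tau> i) else 0)" by (intro exI[of _ \<tau>] conjI)
  qed
qed

section \<open>The clauses of a relaxation\<close>

lemma wf_pseudo_sdp:
  assumes "packing_instance k U C" shows "wf_sdp C (pseudo_sdp r U C)"
proof -
  obtain m B es where "pseudo_sdp r U C = span_sdp (m, B, es)"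
    using spanning_exists[OF packing_finite(1,2)[OF assms]] .
  thus ?thesis by (auto simp: wf_sdp_def span_sdp_def diagonal_def)
qed

lemma packing_in_pseudo_sdp:
  assumes inst: "packing_instance k U C" and k: "0 < k" and r: "1 \<le> r" and M: "is_packing C M"
  shows "(\<lambda>S. of_bool (S \<in> M)) \<in> sdp_region C (pseudo_sdp r U C)"
  unfolding pseudo_sdp_region[OF inst k r]
proof (intro exI conjI)
  define t :: "nat set set \<Rightarrow> real" where "t M' = (if M' = M then 1 else 0)" for M'
  have t: "(\<Sum>M' | is_packing C M' \<and> Q M'. t M') = of_bool (Q M)" for Q
    using M packing_finite(3)[OF inst, of Q] by (simp add: t_def sum.delta)
  show "pseudo_dist r U C t" using t[of "\<lambda>_. True"] by (simp add: pseudo_dist_def t)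
  show "(\<lambda>S. of_bool (S \<in> M)) = (\<lambda>S. if S \<in> C then (\<Sum>M | is_packing C M \<and> S \<in> M. t M) else 0)"
    unfolding t using M by (intro ext) (auto simp: is_packing_def)
qed

text \<open>An event of the image measure is the disjoint union of the events with patterns
  \<open>N'\<close> such that \<open>N' \<inter> C' = N\<close>, each of nonnegative mass.\<close>

lemma pseudo_sdp_delete:
  assumes inst: "packing_instance k U C" and k: "0 < k" and r: "1 \<le> r" and C': "C' \<subseteq> C"
    and x: "x \<in> sdp_region C (pseudo_sdp r U C)" "\<forall>S\<in>C - C'. x S = 0"
  shows "x \<in> sdp_region C' (pseudo_sdp r U C')"
proof -
  have inst': "packing_instance k U C'" using inst C' by (auto simp: packing_instance_def)
  note fin = packing_finite[OF inst] and fin' = packing_finite[OF inst']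
  obtain t where t: "pseudo_dist r U C t" "x = (\<lambda>S. if S \<in> C then (\<Sum>M | is_packing C M \<and> S \<in> M. t M) else 0)"
    using x(1) unfolding pseudo_sdp_region[OF inst k r] by (elim exE conjE)
  define t' where "t' M' = (\<Sum>M | is_packing C M \<and> M \<inter> C' = M'. t M)" for M'
  have sub: "is_packing C' (M \<inter> C')" if "is_packing C M" for M
    using that pairwise_subset[of disjnt M "M \<inter> C'"] by (auto simp: is_packing_def)
  have t': "(\<Sum>M' | is_packing C' M' \<and> Q M'. t' M') = (\<Sum>M | is_packing C M \<and> Q (M \<inter> C'). t M)" for Q
  proof -
    have "(\<Sum>M' | is_packing C' M' \<and> Q M'. t' M') =
        (\<Sum>M'\<in>{M'. is_packing C' M' \<and> Q M'}. sum t {M \<in> {M. is_packing C M \<and> Q (M \<inter> C')}. M \<inter> C' = M'})"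
      unfolding t'_def by (intro sum.cong refl) auto
    also have "\<dots> = (\<Sum>M | is_packing C M \<and> Q (M \<inter> C'). t M)"
      by (rule sum.group[OF fin(3) fin'(3)]) (use sub in auto)
    finally show ?thesis .
  qed
  have "pseudo_dist r U C' t'" unfolding pseudo_dist_def
  proof (intro conjI allI impI)
    show "(\<Sum>M | is_packing C' M. t' M) = 1" using t'[of "\<lambda>_. True"] t(1) by (simp add: pseudo_dist_def)
    fix V N assume V: "V \<subseteq> U" "card V \<le> r"
    have "(\<Sum>M' | is_packing C' M' \<and> restr M' V = N. t' M') = (\<Sum>M | is_packing C M \<and> restr M V \<inter> C' = N. t M)"
      unfolding t' by (intro sum.cong) (auto simp: restr_def)
    also have "\<dots> = (\<Sum>N'\<in>{N'. N' \<subseteq> C \<and> N' \<inter> C' = N}. sum t {M \<in> {M. is_packing C M \<and> restr M V \<inter> C' = N}. restr M V = N'})"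
      by (rule sum.group[OF fin(3), symmetric]) (use fin(2) in \<open>auto simp: is_packing_def restr_def\<close>)
    also have "\<dots> \<ge> 0"
    proof (rule sum_nonneg)
      fix N' assume "N' \<in> {N'. N' \<subseteq> C \<and> N' \<inter> C' = N}"
      hence "{M \<in> {M. is_packing C M \<and> restr M V \<inter> C' = N}. restr M V = N'} = {M. is_packing C M \<and> restr M V = N'}" by auto
      thus "0 \<le> sum t {M \<in> {M. is_packing C M \<and> restr M V \<inter> C' = N}. restr M V = N'}"
        using t(1) V by (simp add: pseudo_dist_def)
    qed
    finally show "0 \<le> (\<Sum>M' | is_packing C' M' \<and> restr M' V = N. t' M')" .
  qed
  moreover have "x = (\<lambda>S. if S \<in> C' then (\<Sum>M' | is_packing C' M' \<and> S \<in> M'. t' M') else 0)"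
  proof
    fix S
    show "x S = (if S \<in> C' then (\<Sum>M' | is_packing C' M' \<and> S \<in> M'. t' M') else 0)"
    proof (cases "S \<in> C'")
      case True
      hence "{M. is_packing C M \<and> S \<in> M \<inter> C'} = {M. is_packing C M \<and> S \<in> M}" by auto
      moreover have "x S = (\<Sum>M | is_packing C M \<and> S \<in> M. t M)" using True C' by (auto simp: t(2))
      ultimately show ?thesis unfolding t' using True by simp
    next
      case False
      thus ?thesis using x(2) by (cases "S \<in> C") (auto simp: t(2))
    qed
  qed
  ultimately show ?thesis unfolding pseudo_sdp_region[OF inst' k r] by (intro exI[of _ t'] conjI)
qed

section \<open>Polynomial encoding length\<close>

lemma rat_size_le: "x \<in> {-1, 0, 1} \<Longrightarrow> rat_size x \<le> 3"
  by (auto simp: rat_size_def bitlen_def floorlog_def)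

lemma mat_size_diagonal:
  assumes "\<And>i. g i \<in> {-1, 0, 1}"
  shows "mat_size (diagonal m g) \<le> 12 * m\<^sup>2"
proof -
  have "rat_size (diagonal m g $$ (i, j)) \<le> 3" if "i < 2 * m" "j < 2 * m" for i j
    using assms[of i] assms[of "i - m"] that by (intro rat_size_le) (auto simp: diagonal_def)
  moreover have "dim_row (diagonal m g) = 2 * m" "dim_col (diagonal m g) = 2 * m" by (simp_all add: diagonal_def)
  ultimately have "mat_size (diagonal m g) \<le> (\<Sum>i<2 * m. \<Sum>j<2 * m. 3)"
    unfolding mat_size_def by (simp only:) (intro sum_mono, simp)
  thus ?thesis by (simp add: power2_eq_square)
qed

text \<open>There are at most \<open>s\<close> events: exponent \<open>r\<close> for the choice of
  \<open>V\<close> and \<open>r\<close> for that of \<open>N\<close>. Since the sets are nonempty,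
  \<open>card C\<close> is at most the instance size.\<close>

lemma pseudo_sdp_size:
  fixes r :: nat
  assumes inst: "packing_instance k U C" and k: "0 < k"
  defines "s \<equiv> (instance_size U C + 1) ^ (2 * r)"
  shows "sdp_size C (pseudo_sdp r U C) \<le> 2 * s + (s + 2) * (12 * s\<^sup>2 + 3) + instance_size U C * (12 * s\<^sup>2)"
proof -
  note fin = packing_finite[OF inst]
  obtain m B es where sp: "spanning r U C (m, B, es)" and eq: "pseudo_sdp r U C = span_sdp (m, B, es)"
    using spanning_exists[OF fin(1,2)] .
  have "(\<Sum>S\<in>C. 1) \<le> (\<Sum>S\<in>C. card S)"
    using inst k by (intro sum_mono) (auto simp: packing_instance_def)
  hence cC: "card C \<le> instance_size U C" by (simp add: instance_size_def)
  have cU: "card U \<le> instance_size U C" by (simp add: instance_size_def)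
  have "card (events r U C) \<le> (card U + 1) ^ r * (card C + 1) ^ r"
    unfolding events_def card_cartesian_product by (intro mult_mono card_small_subsets fin) auto
  also have "\<dots> \<le> (instance_size U C + 1) ^ r * (instance_size U C + 1) ^ r"
    using cU cC by (intro mult_mono power_mono) auto
  also have "\<dots> = s" by (simp add: s_def mult_2 power_add)
  finally have es: "length es \<le> s" and ms: "m \<le> s" using sp by (auto simp: spanning_def)
  have ms2: "12 * m\<^sup>2 \<le> 12 * s\<^sup>2" using ms by simp
  have size: "mat_size (diagonal m g) \<le> 12 * s\<^sup>2" if "\<And>i. g i \<in> {-1, 0, 1}" for g
    using mat_size_diagonal[OF that] ms2 by (rule order.trans)
  have con: "mat_size A + rat_size b \<le> 12 * s\<^sup>2 + 3" if "(A, b) \<in> set (sdp_constraints (span_sdp (m, B, es)))" for A b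
    using that unfolding span_sdp_def by (auto intro!: add_mono size rat_size_le)
  have "(\<Sum>(A, b) \<leftarrow> sdp_constraints (span_sdp (m, B, es)). mat_size A + rat_size b)
      \<le> (\<Sum>c \<leftarrow> sdp_constraints (span_sdp (m, B, es)). 12 * s\<^sup>2 + 3)"
    by (rule sum_list_mono) (use con in auto)
  also have "\<dots> = (length es + 2) * (12 * s\<^sup>2 + 3)"
    by (simp add: span_sdp_def sum_list_triv comp_def)
  also have "\<dots> \<le> (s + 2) * (12 * s\<^sup>2 + 3)" using es by (intro mult_le_mono1) simp
  finally have 1: "(\<Sum>(A, b) \<leftarrow> sdp_constraints (span_sdp (m, B, es)). mat_size A + rat_size b) \<le> (s + 2) * (12 * s\<^sup>2 + 3)" .
  have "(\<Sum>S\<in>C. mat_size (sdp_var (span_sdp (m, B, es)) S)) \<le> (\<Sum>S\<in>C. 12 * s\<^sup>2)"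
    unfolding span_sdp_def by (intro sum_mono) (auto intro!: size)
  also have "\<dots> = card C * (12 * s\<^sup>2)" by simp
  also have "\<dots> \<le> instance_size U C * (12 * s\<^sup>2)" using cC by (rule mult_le_mono1)
  finally have 2: "(\<Sum>S\<in>C. mat_size (sdp_var (span_sdp (m, B, es)) S)) \<le> instance_size U C * (12 * s\<^sup>2)" .
  have "sdp_dim (span_sdp (m, B, es)) \<le> 2 * s" using ms by (simp add: span_sdp_def)
  thus ?thesis unfolding eq sdp_size_def using 1 2 by (intro add_mono)
qed

lemma polynomial_pseudo_sdp:
  assumes "0 < k" shows "polynomial_size k (pseudo_sdp r)"
proof -
  define s :: "nat poly" where "s = [:1, 1:] ^ (2 * r)"
  have s: "poly s n = (n + 1) ^ (2 * r)" for n by (simp add: s_def poly_power)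
  let ?p = "[:2:] * s + (s + [:2:]) * ([:12:] * s\<^sup>2 + [:3:]) + [:0, 1:] * ([:12:] * s\<^sup>2)"
  have "sdp_size C (pseudo_sdp r U C) \<le> poly ?p (instance_size U C)" if "packing_instance k U C" for U C
    using pseudo_sdp_size[OF that assms, of r]
    by (simp only: poly_add poly_mult poly_power poly_pCons poly_0 s mult_zero_right add_0_right mult_1_right add_0)
  thus ?thesis unfolding polynomial_size_def by blast
qed

lemma relaxation_pseudo_sdp:
  assumes "0 < k" "1 \<le> r" shows "sdp_relaxation k (pseudo_sdp r)"
  unfolding sdp_relaxation_def
  using wf_pseudo_sdp packing_in_pseudo_sdp[OF _ assms] pseudo_sdp_delete[OF _ assms] by blast

theorem theorem24:
  fixes k :: nat and \<epsilon> :: real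
  assumes "k > 0" and "\<epsilon> > 0"
  shows "\<exists>R. sdp_relaxation k R \<and> polynomial_size k R \<and>
           integrality_gap k R \<le> ereal (real k / 3 + 1 + \<epsilon>)"
proof -
  obtain r where r: "1 \<le> r" and gap: "\<And>U C A t. packing_graph k U C A \<Longrightarrow> pseudo_dist r U C t \<Longrightarrow>
      (\<Sum>S\<in>C. \<Sum>M | is_packing C M \<and> S \<in> M. t M) \<le> (real k / 3 + 1 + \<epsilon>) * real (card A)"
    using pseudo_gap[OF assms] by blast
  have "sdp_value C (pseudo_sdp r U C) / ereal (real (max_packing C)) \<le> ereal (real k / 3 + 1 + \<epsilon>)"
    if inst: "packing_instance k U C" and C0: "C \<noteq> {}" for U C
  proof -
    have finP: "finite {M. is_packing C M}" using packing_finite(3)[OF inst, of "\<lambda>_. True"] by simp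
    have "is_packing C {}" by (simp add: is_packing_def)
    hence ne: "card ` {M. is_packing C M} \<noteq> {}" by blast
    obtain A where A: "is_packing C A" "max_packing C = card A"
      using Max_in[OF finite_imageI[OF finP] ne] unfolding max_packing_def by auto
    have max: "card M \<le> card A" if "is_packing C M" for M
      unfolding A(2)[symmetric] max_packing_def using finP that by (intro Max_ge) auto
    interpret packing_graph k U C A by unfold_locales (rule inst assms(1) A(1) max | assumption)+
    obtain S where "S \<in> C" using C0 by blast
    \<comment> \<open>A single member of the collection is a packing, so the denominator is
      positive.\<close>
    hence "0 < card A" using max[of "{S}"] by (simp add: is_packing_def)
    moreover have "sdp_value C (pseudo_sdp r U C) \<le> ereal ((real k / 3 + 1 + \<epsilon>) * real (card A))"
      unfolding sdp_value_def
    proof (rule SUP_least)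
      fix x assume "x \<in> sdp_region C (pseudo_sdp r U C)"
      then obtain t where t: "pseudo_dist r U C t"
          "x = (\<lambda>S. if S \<in> C then (\<Sum>M | is_packing C M \<and> S \<in> M. t M) else 0)"
        unfolding pseudo_sdp_region[OF inst assms(1) r] by (elim exE conjE)
      have "(\<Sum>S\<in>C. x S) = (\<Sum>S\<in>C. \<Sum>M | is_packing C M \<and> S \<in> M. t M)" unfolding t(2) by simp
      thus "ereal (\<Sum>S\<in>C. x S) \<le> ereal ((real k / 3 + 1 + \<epsilon>) * real (card A))"
        using gap[OF packing_graph_axioms t(1)] by simp
    qed
    ultimately show ?thesis unfolding A(2) by (subst ereal_divide_le_pos) (auto simp: mult.commute)
  qed
  hence "integrality_gap k (pseudo_sdp r) \<le> ereal (real k / 3 + 1 + \<epsilon>)"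
    unfolding integrality_gap_def by (auto intro!: SUP_least)
  thus ?thesis
    using relaxation_pseudo_sdp[OF assms(1) r] polynomial_pseudo_sdp[OF assms(1), of r] by (intro exI[of _ "pseudo_sdp r"] conjI)
qed

end
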